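(* Let $\Omega_0\subseteq\mathbb{R}^n_t\times\mathbb{R}^m_x$ be a convex domain, let $p_0:\Omega_0\to\mathbb{R}^n_t$ be the natural projection, and let $\Omega_{0,t}=p_0^{-1}(t)$ for $t\in D_0:=p_0(\Omega_0)$, viewed as an open subset of $\mathbb{R}^m$. Let $\tilde g(t,x):\Omega_0\to GL(r,\mathbb{C})$ be a smooth Hermitian metric on the trivial complex vector bundle $\tilde E_0=\Omega_0\times\mathbb{C}^r\to\Omega_0$. Let $g(t):D_0\to GL(r,\mathbb{C})$ be the Hermitian metric on the trivial complex vector bundle $E_0=D_0\times\mathbb{C}^r\to D_0$ given by $$g(t):=\int_{\Omega_{0,t}}\tilde g(t,x)\,dV_x .$$ If $(\tilde E_0,\tilde g)$ is Nakano semi-positive and $g$ is $C^2$, then $(E_0,g)$ is Nakano semi-positive.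
   Context: $dV_x$ is Lebesgue measure on $\mathbb{R}^m$, and the integral of the matrix-valued function is taken entrywise. A Hermitian metric on a trivial complex vector bundle $U\times\mathbb{C}^r$ over an open set $U\subset\mathbb{R}^N$ is a map $G:U\to GL(r,\mathbb{C})$ whose values are positive definite Hermitian matrices, with associated inner product $(u,v)_G=v^*Gu$ on $\mathbb{C}^r$ at each point. Nakano semi-positivity over real domains: for a Hermitian metric $G$ of class $C^2$ on $U\times\mathbb{C}^r$, with $U\subset\mathbb{R}^N$ open with coordinates $x_1,\dots,x_N$, let $$\Theta^G_{jk}=-\frac{\partial}{\partial x_k}\left(G^{-1}\frac{\partial G}{\partial x_j}\right),\quad 1\le j,k\le N,$$ where differentiation is elementwise. Then $(U\times\mathbb{C}^r,G)$ is called Nakano semi-positive if for every $N$-tuple of vectors $u_1,\dots,u_N\in\mathbb{C}^r$ one has $\sum_{j,k=1}^N(\Theta^G_{jk}u_j,u_k)_G\ge 0$ at every point of $U$. (For $\tilde g$ on $\Omega_0$ this is applied with $N=n+m$ and all variables $(t,x)$; for $g$ on $D_0$ with $N=n$.) *)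

theory Defs
  imports "HOL-Analysis.Analysis"
begin

text \<open>
  Coordinates on a Euclidean space \<open>'a\<close> are those of its orthonormal basis \<open>Basis\<close>, so the
  coordinate indices \<open>1, \<dots>, N\<close> become the elements of \<open>Basis\<close>. For \<open>(real ^ 'n) \<times> (real ^ 'm)\<close>
  these are exactly the \<open>n + m\<close> standard coordinate directions \<open>(t, x)\<close>.
\<close>

definition partial_deriv :: "'a::euclidean_space \<Rightarrow> ('a \<Rightarrow> 'b::real_normed_vector) \<Rightarrow> 'a \<Rightarrow> 'b"
  where "partial_deriv b f x = vector_derivative (\<lambda>s. f (x + s *\<^sub>R b)) (at 0)"

text \<open>Class \<open>C\<^sup>k\<close>; only used on open sets \<open>U\<close>.\<close>

primrec Ck_on :: "nat \<Rightarrow> 'a::euclidean_space set \<Rightarrow> ('a \<Rightarrow> 'b::real_normed_vector) \<Rightarrow> bool" where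
  "Ck_on 0 U f \<longleftrightarrow> continuous_on U f"
| "Ck_on (Suc k) U f \<longleftrightarrow>
     (\<forall>x\<in>U. f differentiable (at x)) \<and> (\<forall>b\<in>Basis. Ck_on k U (partial_deriv b f))"

definition smooth_on :: "'a::euclidean_space set \<Rightarrow> ('a \<Rightarrow> 'b::real_normed_vector) \<Rightarrow> bool"
  where "smooth_on U f \<longleftrightarrow> (\<forall>k. Ck_on k U f)"

definition inner_of :: "complex ^ 'r ^ 'r \<Rightarrow> complex ^ 'r \<Rightarrow> complex ^ 'r \<Rightarrow> complex"
  where "inner_of A u v = (\<Sum>i\<in>UNIV. cnj (v $ i) * (A *v u) $ i)"

definition hermitian_matrix :: "complex ^ 'r ^ 'r \<Rightarrow> bool"
  where "hermitian_matrix A \<longleftrightarrow> map_matrix cnj (transpose A) = A"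

text \<open>For Hermitian \<open>A\<close> the number \<open>inner_of A u u\<close> is real, so taking \<open>Re\<close> loses nothing.\<close>

definition pos_def_matrix :: "complex ^ 'r ^ 'r \<Rightarrow> bool"
  where "pos_def_matrix A \<longleftrightarrow> hermitian_matrix A \<and> (\<forall>u. u \<noteq> 0 \<longrightarrow> 0 < Re (inner_of A u u))"

definition hermitian_metric_on :: "'a set \<Rightarrow> ('a \<Rightarrow> complex ^ 'r ^ 'r) \<Rightarrow> bool"
  where "hermitian_metric_on U G \<longleftrightarrow> (\<forall>x\<in>U. invertible (G x) \<and> pos_def_matrix (G x))"

definition curvature ::
    "('a::euclidean_space \<Rightarrow> complex ^ 'r ^ 'r) \<Rightarrow> 'a \<Rightarrow> 'a \<Rightarrow> 'a \<Rightarrow> complex ^ 'r ^ 'r"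
  where "curvature G j k x = - partial_deriv k (\<lambda>y. matrix_inv (G y) ** partial_deriv j G y) x"

text \<open>
  An \<open>N\<close>-tuple of vectors is a function \<open>u\<close> on the coordinate directions; its values outside
  \<open>Basis\<close> play no role. Membership in \<open>\<real>\<^sub>\<ge>\<^sub>0\<close> says that the complex number is real and nonnegative.
\<close>

definition nakano_semipositive ::
    "'a::euclidean_space set \<Rightarrow> ('a \<Rightarrow> complex ^ 'r ^ 'r) \<Rightarrow> bool"
  where "nakano_semipositive U G \<longleftrightarrow>
    open U \<and> hermitian_metric_on U G \<and> Ck_on 2 U G \<and>
    (\<forall>x\<in>U. \<forall>u :: 'a \<Rightarrow> complex ^ 'r.
       (\<Sum>j\<in>Basis. \<Sum>k\<in>Basis. inner_of (G x) (curvature G j k x *v u j) (u k)) \<in> \<real>\<^sub>\<ge>\<^sub>0)"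

definition slice :: "('a \<times> 'b) set \<Rightarrow> 'a \<Rightarrow> 'b set"
  where "slice \<Omega> t = {x. (t, x) \<in> \<Omega>}"

definition fiber_integrable ::
    "('a \<times> 'b::euclidean_space) set \<Rightarrow> ('a \<times> 'b \<Rightarrow> complex ^ 'r ^ 'r) \<Rightarrow> 'a \<Rightarrow> bool"
  where "fiber_integrable \<Omega> G t \<longleftrightarrow>
    (\<forall>i j. set_integrable lborel (slice \<Omega> t) (\<lambda>x. G (t, x) $ i $ j))"

definition fiber_integral ::
    "('a \<times> 'b::euclidean_space) set \<Rightarrow> ('a \<times> 'b \<Rightarrow> complex ^ 'r ^ 'r) \<Rightarrow> 'a \<Rightarrow> complex ^ 'r ^ 'r"
  where "fiber_integral \<Omega> G t = (\<chi> i j. LINT x:slice \<Omega> t|lborel. G (t, x) $ i $ j)"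

end

theory Submission
  imports Defs
begin

text \<open>
  The real part of the Hermitian inner product makes the complex vector space a real Euclidean space,
  on which Hermitian matrices act as self-adjoint operators. Multiplying out the curvature, Nakano
  semi-positivity of \<open>G\<close> says that for all vectors \<open>u\<^sub>j\<close>
  \<open>\<Sum>\<^sub>j\<^sub>k (\<partial>\<^sub>j \<partial>\<^sub>k G) u\<^sub>j \<bullet> u\<^sub>k \<le> G\<^sup>-\<^sup>1 p \<bullet> p\<close> where \<open>p = \<Sum>\<^sub>j (\<partial>\<^sub>j G) u\<^sub>j\<close>
  (\<open>curvature_sum_nonneg_iff\<close>). The left-hand side is linear in \<open>G\<close>, so it may be integrated over the
  fibre; the work lies in comparing the right-hand sides.

  Suppose first that the fibre is one-dimensional, with coordinate \<open>s\<close>, that \<open>G\<close> has compact support,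
  and let \<open>g\<close> be its integral and \<open>y\<close> the solution of \<open>g y = \<integral> p ds\<close>. The curvature inequality for
  \<open>G\<close> may be used with an additional vector \<open>\<alpha>\<close> in the direction of \<open>s\<close>. Choose
  \<open>\<alpha>\<close> with \<open>(G \<alpha>)' = G y - p\<close>, which can be solved with \<open>G \<alpha>\<close> vanishing at both ends because \<open>G y\<close>
  and \<open>p\<close> have the same integral. Then the inequality becomes
  \<open>\<Sum>\<^sub>j\<^sub>k (\<partial>\<^sub>j \<partial>\<^sub>k G) u\<^sub>j \<bullet> u\<^sub>k \<le> G y \<bullet> y - 2 y \<bullet> (G \<alpha>)' + (G \<alpha> \<bullet> \<alpha>)'' - G \<alpha>' \<bullet> \<alpha>'\<close>, and
  integration gives the claim for \<open>g\<close>: the second term integrates to zero, and so does, up to a good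
  sign, the third one, since \<open>G \<alpha> \<bullet> \<alpha>\<close> is nonnegative and tends to zero at the ends
  (\<open>one_variable_estimate\<close>).

  A fibre of higher dimension is integrated one coordinate at a time (\<open>marginal_density\<close>,
  \<open>iterated_marginal\<close>). For the marginals to be regular the metric is first multiplied by a
  cutoff, a product of log-concave functions of affine functions; such factors preserve Nakano
  semi-positivity, and convexity of the domain provides enough of them (\<open>nakano_cutoff_prod\<close>,
  \<open>separating_cutoffs\<close>).

  It remains to remove the cutoffs, that is, to pass to pointwise limits (\<open>nakano_limit\<close>). Along each
  coordinate line the curvature inequality makes \<open>G\<^sup>-\<^sup>1\<close> a convex function. For convex functions
  pointwise convergence to a differentiable limit entails convergence of first derivatives, so \<open>p\<close>
  and the right-hand side of the inequality converge. The left-hand side is linear in the second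
  derivatives and converges when it is integrated against test functions.
\<close>

section \<open>Self-adjoint operators and solutions of linear equations\<close>

definition self_adjoint :: "('v::euclidean_space \<Rightarrow>\<^sub>L 'v) \<Rightarrow> bool"
  where "self_adjoint A \<longleftrightarrow> (\<forall>u v. A u \<bullet> v = u \<bullet> A v)"

lemma self_adjointD: "self_adjoint A \<Longrightarrow> A u \<bullet> v = u \<bullet> A v"
  by (simp add: self_adjoint_def)

text \<open>
  A self-adjoint operator is determined by its quadratic form, by polarization; this bounds its norm.
\<close>

lemma norm_self_adjoint_le:
  assumes "self_adjoint A" and "0 \<le> c" and le: "\<And>v. \<bar>A v \<bullet> v\<bar> \<le> c * (v \<bullet> v)"
  shows "norm A \<le> c"
proof (rule norm_blinfun_bound[OF \<open>0 \<le> c\<close>])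
  fix x
  have bil: "A u \<bullet> v \<le> c / 2 * (u \<bullet> u + v \<bullet> v)" for u v
  proof -
    have "4 * (A u \<bullet> v) = A (u + v) \<bullet> (u + v) - A (u - v) \<bullet> (u - v)"
      using self_adjointD[OF assms(1), of v u]
      by (simp add: blinfun.add_right blinfun.diff_right inner_add inner_diff inner_commute)
    also have "\<dots> \<le> c * ((u + v) \<bullet> (u + v)) + c * ((u - v) \<bullet> (u - v))"
      using le[of "u + v"] le[of "u - v"] by linarith
    also have "\<dots> = 2 * c * (u \<bullet> u + v \<bullet> v)"
      by (simp add: inner_add inner_diff inner_commute algebra_simps)
    finally show ?thesis by linarith
  qed
  show "norm (A x) \<le> c * norm x"
  proof (cases "x = 0 \<or> A x = 0")
    case True then show ?thesis using \<open>0 \<le> c\<close> by (auto simp: blinfun.zero_right)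
  next
    case False
    define a where "a = norm x"
    define b where "b = norm (A x)"
    have ab: "a > 0" "b > 0" using False by (auto simp: a_def b_def)
    have xx: "x \<bullet> x = a^2" "A x \<bullet> A x = b^2"
      by (simp_all add: a_def b_def power2_norm_eq_inner)
    have "A x \<bullet> ((a / b) *\<^sub>R A x) \<le> c / 2 * (x \<bullet> x + ((a / b) *\<^sub>R A x) \<bullet> ((a / b) *\<^sub>R A x))"
      by (rule bil)
    also have "\<dots> = c * a^2"
      using ab by (simp add: xx power2_eq_square field_simps)
    finally have "a * b \<le> c * a * a"
      using ab by (simp add: xx power2_eq_square field_simps)
    then have "b \<le> c * a" using ab(1) by (simp add: mult.commute mult.left_commute)
    then show ?thesis by (simp add: a_def b_def)
  qed
qed

lemma coercive_norm_le:
  fixes A :: "'v::euclidean_space \<Rightarrow>\<^sub>L 'v"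
  assumes "\<And>v. l * (v \<bullet> v) \<le> A v \<bullet> v"
  shows "l * norm v \<le> norm (A v)"
proof (cases "v = 0")
  case False
  have "l * (norm v * norm v) \<le> A v \<bullet> v"
    using assms[of v] by (simp add: power2_norm_eq_inner[symmetric] power2_eq_square)
  also have "\<dots> \<le> norm (A v) * norm v" by (rule norm_cauchy_schwarz)
  finally show ?thesis using False by (simp add: mult.assoc[symmetric])
qed simp

lemma positive_definite_surj:
  fixes A :: "'v::euclidean_space \<Rightarrow>\<^sub>L 'v"
  assumes "\<And>v. v \<noteq> 0 \<Longrightarrow> 0 < A v \<bullet> v"
  obtains y where "A y = w"
proof -
  have "inj (blinfun_apply A)"
  proof (rule injI)
    fix x y assume "A x = A y"
    then have "A (x - y) \<bullet> (x - y) = 0" by (simp add: blinfun.diff_right)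
    then show "x = y" using assms[of "x - y"] by fastforce
  qed
  then have "surj (blinfun_apply A)"
    by (rule linear_injective_imp_surjective[OF bounded_linear.linear[OF blinfun.bounded_linear_right]]) auto
  then show ?thesis using that by (metis surjD)
qed

text \<open>
  A solution of a linear equation depends continuously on its data as soon as the limiting
  operator is bounded below, because its perturbations then are bounded below uniformly.
\<close>

lemma (in bounded_bilinear) tendsto_solution:
  assumes M: "(M \<longlongrightarrow> M0) F" and b: "(b \<longlongrightarrow> b0) F"
    and eq: "\<forall>\<^sub>F t in F. prod (M t) (x t) = b t" and eq0: "prod M0 x0 = b0"
    and l: "0 < l" "\<And>v. l * norm v \<le> norm (prod M0 v)"
  shows "(x \<longlongrightarrow> x0) F"
proof -
  obtain K where K: "K > 0" "\<And>a b. norm (prod a b) \<le> norm a * norm b * K"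
    using pos_bounded by blast
  have "((\<lambda>t. M t - M0) \<longlongrightarrow> 0) F" using M by (simp add: LIM_zero)
  then have ev: "\<forall>\<^sub>F t in F. norm (M t - M0) < l / (2 * K)"
    using l K by (intro order_tendstoD(2)[of "\<lambda>t. norm (M t - M0)" 0]) (auto intro: tendsto_norm_zero)
  have bd: "\<forall>\<^sub>F t in F. norm (x t - x0) \<le> norm (b t - prod (M t) x0) * (2 / l)"
    using ev eq
  proof eventually_elim
    case (elim t)
    let ?v = "x t - x0"
    have "l * norm ?v \<le> norm (prod M0 ?v)" by (rule l)
    also have "\<dots> = norm (prod (M t) ?v - prod (M t - M0) ?v)"
      by (simp add: diff_left)
    also have "\<dots> \<le> norm (prod (M t) ?v) + norm (M t - M0) * norm ?v * K"
      using norm_triangle_ineq4 K(2) by (meson add_left_mono order_trans)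
    also have "norm (M t - M0) * norm ?v * K \<le> l / (2 * K) * norm ?v * K"
      using elim(1) K(1) by (intro mult_right_mono) auto
    also have "\<dots> = l / 2 * norm ?v" using K by simp
    finally have "l * norm ?v / 2 \<le> norm (prod (M t) ?v)" by linarith
    also have "prod (M t) ?v = b t - prod (M t) x0" using elim(2) by (simp add: diff_right)
    finally show ?case using l(1) by (simp add: field_simps)
  qed
  have "((\<lambda>t. b t - prod (M t) x0) \<longlongrightarrow> b0 - prod M0 x0) F"
    by (intro tendsto_intros b tendsto[OF M])
  then have "((\<lambda>t. norm (b t - prod (M t) x0) * (2 / l)) \<longlongrightarrow> 0) F"
    using eq0 by (intro tendsto_mult_left_zero tendsto_norm_zero) simp
  then have "((\<lambda>t. x t - x0) \<longlongrightarrow> 0) F"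
    by (rule Lim_null_comparison[OF bd])
  then show ?thesis by (simp add: LIM_zero_iff)
qed

lemma has_vector_derivative_iff_slope:
  "(f has_vector_derivative f') (at s) \<longleftrightarrow> ((\<lambda>t. (1 / (t - s)) *\<^sub>R (f t - f s)) \<longlongrightarrow> f') (at s)"
proof -
  have "norm (f t - f s - (t - s) *\<^sub>R f') / norm (t - s) = norm ((1 / (t - s)) *\<^sub>R (f t - f s) - f')"
    if "t \<noteq> s" for t
  proof -
    have "(1 / (t - s)) *\<^sub>R (f t - f s) - f' = (1 / (t - s)) *\<^sub>R (f t - f s - (t - s) *\<^sub>R f')"
      using that by (simp add: scaleR_diff_right)
    then show ?thesis by simp
  qed
  then have "((\<lambda>t. norm (f t - f s - (t - s) *\<^sub>R f') / norm (t - s)) \<longlongrightarrow> 0) (at s)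
      \<longleftrightarrow> ((\<lambda>t. norm ((1 / (t - s)) *\<^sub>R (f t - f s) - f')) \<longlongrightarrow> 0) (at s)"
    by (intro filterlim_cong refl) (auto simp: eventually_at_filter)
  then show ?thesis
    by (simp add: has_vector_derivative_def has_derivative_iff_norm bounded_linear_scaleR_left
        tendsto_norm_zero_iff LIM_zero_iff)
qed

text \<open>
  The difference quotients of a solution solve the equation whose right-hand side is the difference
  quotient of the data, so the continuity statement above identifies their limit \<open>q\<close>.
\<close>

lemma (in bounded_bilinear) has_vector_derivative_solution:
  assumes M: "(M has_vector_derivative M') (at s)" and b: "(b has_vector_derivative b') (at s)"
    and eq: "\<forall>\<^sub>F t in nhds s. prod (M t) (x t) = b t"
    and q: "prod (M s) q = b' - prod M' (x s)"
    and l: "0 < l" "\<And>v. l * norm v \<le> norm (prod (M s) v)"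
  shows "(x has_vector_derivative q) (at s)"
proof -
  have eqs: "prod (M s) (x s) = b s" using eq by (rule eventually_nhds_x_imp_x)
  have "((\<lambda>t. (1 / (t - s)) *\<^sub>R (x t - x s)) \<longlongrightarrow> q) (at s)"
  proof (rule tendsto_solution[OF _ _ _ q l])
    show "(M \<longlongrightarrow> M s) (at s)"
      using has_vector_derivative_continuous[OF M] by (simp add: continuous_at)
    have *: "((\<lambda>t. (1 / (t - s)) *\<^sub>R (f t - f s)) \<longlongrightarrow> f') (at s)"
      if "(f has_vector_derivative f') (at s)" for f :: "real \<Rightarrow> 'z::real_normed_vector" and f'
      using that by (simp add: has_vector_derivative_iff_slope)
    show "((\<lambda>t. (1 / (t - s)) *\<^sub>R (b t - b s) - prod ((1 / (t - s)) *\<^sub>R (M t - M s)) (x s))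
        \<longlongrightarrow> b' - prod M' (x s)) (at s)"
      by (intro tendsto_intros tendsto * M b)
    have "\<forall>\<^sub>F t in at s. prod (M t) (x t) = b t"
      using eq by (simp add: eventually_nhds_conv_at)
    then show "\<forall>\<^sub>F t in at s. prod (M t) ((1 / (t - s)) *\<^sub>R (x t - x s))
       = (1 / (t - s)) *\<^sub>R (b t - b s) - prod ((1 / (t - s)) *\<^sub>R (M t - M s)) (x s)"
      by eventually_elim (simp add: scaleR_left scaleR_right diff_left diff_right eqs
           scaleR_diff_right[symmetric])
  qed
  then show ?thesis
    by (simp add: has_vector_derivative_iff_slope)
qed

section \<open>Functions with continuous first and second derivatives\<close>

text \<open>
  The derivative is a plain function of the direction, and continuity is required for each direction
  separately. In finite dimensions this is the usual notion, and it keeps operator-valued functions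
  free of nested operator spaces.
\<close>

definition C1 ::
    "'a::real_normed_vector set \<Rightarrow> ('a \<Rightarrow> 'b::real_normed_vector) \<Rightarrow> ('a \<Rightarrow> 'a \<Rightarrow> 'b) \<Rightarrow> bool"
  where "C1 U f f' \<longleftrightarrow>
    (\<forall>z\<in>U. (f has_derivative f' z) (at z)) \<and> (\<forall>h. continuous_on U (\<lambda>z. f' z h))"

text \<open>
  In \<open>DD z k h\<close> the function is differentiated first in direction \<open>h\<close> and then in direction \<open>k\<close>.
\<close>

definition C2 ::
    "'a::real_normed_vector set \<Rightarrow> ('a \<Rightarrow> 'b::real_normed_vector) \<Rightarrow> ('a \<Rightarrow> 'a \<Rightarrow> 'b) \<Rightarrow>
      ('a \<Rightarrow> 'a \<Rightarrow> 'a \<Rightarrow> 'b) \<Rightarrow> bool"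
  where "C2 U f D DD \<longleftrightarrow> C1 U f D \<and> (\<forall>h. C1 U (\<lambda>z. D z h) (\<lambda>z k. DD z k h))"

lemma C1_cont: "C1 U f f' \<Longrightarrow> continuous_on U f"
  by (auto simp: C1_def intro!: continuous_at_imp_continuous_on has_derivative_continuous)

lemma C1_linear: "C1 U f f' \<Longrightarrow> z \<in> U \<Longrightarrow> bounded_linear (f' z)"
  by (auto simp: C1_def intro: has_derivative_bounded_linear)

lemma C1_subset: "C1 U f f' \<Longrightarrow> W \<subseteq> U \<Longrightarrow> C1 W f f'"
  by (auto simp: C1_def intro: continuous_on_subset)

lemma C2_subset: "C2 U f D DD \<Longrightarrow> W \<subseteq> U \<Longrightarrow> C2 W f D DD"
  by (auto simp: C2_def intro: C1_subset)

lemma C1_line: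
  assumes "C1 U f f'" "z + s *\<^sub>R h \<in> U"
  shows "((\<lambda>s. f (z + s *\<^sub>R h)) has_vector_derivative f' (z + s *\<^sub>R h) h) (at s)"
proof -
  have d: "(f has_derivative f' (z + s *\<^sub>R h)) (at (z + s *\<^sub>R h))"
    using assms by (auto simp: C1_def)
  interpret bounded_linear "f' (z + s *\<^sub>R h)" using C1_linear[OF assms] .
  have "((\<lambda>s. z + s *\<^sub>R h) has_derivative (\<lambda>r. r *\<^sub>R h)) (at s)"
    by (auto intro!: derivative_eq_intros)
  from diff_chain_at[OF this d] show ?thesis
    by (simp add: has_vector_derivative_def o_def scaleR)
qed

lemma C1_bounded_linear:
  assumes "bounded_linear L" "C1 U f f'"
  shows "C1 U (\<lambda>z. L (f z)) (\<lambda>z h. L (f' z h))"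
  using assms(2) unfolding C1_def
  by (intro conjI ballI allI bounded_linear.has_derivative[OF assms(1)]
      bounded_linear.continuous_on[OF assms(1)]) auto

lemma C2_bounded_linear:
  assumes "bounded_linear L" "C2 U f D DD"
  shows "C2 U (\<lambda>z. L (f z)) (\<lambda>z h. L (D z h)) (\<lambda>z h k. L (DD z h k))"
  using assms(2) unfolding C2_def
  by (intro conjI allI C1_bounded_linear[OF assms(1)]) auto

lemma (in bounded_bilinear) C1_mult:
  assumes f: "C1 U f f'" and g: "C1 U g g'"
  shows "C1 U (\<lambda>z. prod (f z) (g z)) (\<lambda>z h. prod (f z) (g' z h) + prod (f' z h) (g z))"
  unfolding C1_def
proof (intro conjI ballI allI)
  show "continuous_on U (\<lambda>z. prod (f z) (g' z h) + prod (f' z h) (g z))" for h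
    using C1_cont[OF f] C1_cont[OF g] f g by (auto simp: C1_def intro!: continuous_intros continuous_on)
qed (use f g in \<open>auto simp: C1_def intro!: FDERIV\<close>)

lemma C1_add: "C1 U f f' \<Longrightarrow> C1 U g g' \<Longrightarrow> C1 U (\<lambda>z. f z + g z) (\<lambda>z h. f' z h + g' z h)"
  by (auto simp: C1_def intro!: has_derivative_add continuous_intros)

lemma (in bounded_bilinear) C2_mult:
  assumes f: "C2 U f Df DDf" and g: "C2 U g Dg DDg"
  shows "C2 U (\<lambda>z. prod (f z) (g z)) (\<lambda>z h. prod (f z) (Dg z h) + prod (Df z h) (g z))
     (\<lambda>z k h. (prod (f z) (DDg z k h) + prod (Df z k) (Dg z h))
            + (prod (Df z h) (Dg z k) + prod (DDf z k h) (g z)))"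
  using f g unfolding C2_def by (intro conjI allI C1_mult C1_add) auto

text \<open>
  Symmetry of second derivatives: by the mean value theorem, applied twice, the second difference
  of the function over a small parallelogram is a value of either mixed derivative.
\<close>

lemma second_difference_mvt:
  fixes f :: "'a::real_normed_vector \<Rightarrow> real"
  assumes "C2 U f D DD" and "0 < s"
    and inU: "\<And>a b. 0 \<le> a \<Longrightarrow> a \<le> s \<Longrightarrow> 0 \<le> b \<Longrightarrow> b \<le> s \<Longrightarrow> z + a *\<^sub>R h + b *\<^sub>R k \<in> U"
  shows "\<exists>a b. 0 < a \<and> a < s \<and> 0 < b \<and> b < s \<and>
    f (z + s *\<^sub>R h + s *\<^sub>R k) - f (z + s *\<^sub>R h) - f (z + s *\<^sub>R k) + f z
      = s\<^sup>2 * DD (z + a *\<^sub>R h + b *\<^sub>R k) k h"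
proof -
  have C1: "C1 U f D" "\<And>h. C1 U (\<lambda>z. D z h) (\<lambda>z k. DD z k h)" using assms(1) by (auto simp: C2_def)
  define F where "F a = f ((z + s *\<^sub>R k) + a *\<^sub>R h) - f (z + a *\<^sub>R h)" for a
  have "DERIV F a :> D ((z + s *\<^sub>R k) + a *\<^sub>R h) h - D (z + a *\<^sub>R h) h" if "0 \<le> a" "a \<le> s" for a
    unfolding F_def
    using C1_line[OF C1(1), of "z + s *\<^sub>R k" a h] C1_line[OF C1(1), of z a h]
      inU[OF that, of s] inU[OF that, of 0] \<open>0 < s\<close>
    by (auto simp: has_real_derivative_iff_has_vector_derivative algebra_simps
        intro!: has_vector_derivative_diff)
  from MVT2[OF \<open>0 < s\<close> this] obtain a where a: "0 < a" "a < s"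
    and Fa: "F s - F 0 = (s - 0) * (D ((z + s *\<^sub>R k) + a *\<^sub>R h) h - D (z + a *\<^sub>R h) h)" by blast
  have "DERIV (\<lambda>b. D ((z + a *\<^sub>R h) + b *\<^sub>R k) h) b :> DD ((z + a *\<^sub>R h) + b *\<^sub>R k) k h"
    if "0 \<le> b" "b \<le> s" for b
    using C1_line[OF C1(2)[of h], of "z + a *\<^sub>R h" b k] inU[of a b] a that
    by (simp add: has_real_derivative_iff_has_vector_derivative)
  from MVT2[OF \<open>0 < s\<close> this] obtain b where b: "0 < b" "b < s"
    and Db: "D ((z + a *\<^sub>R h) + s *\<^sub>R k) h - D ((z + a *\<^sub>R h) + 0 *\<^sub>R k) h
        = (s - 0) * DD ((z + a *\<^sub>R h) + b *\<^sub>R k) k h" by blast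
  have "F s - F 0 = s * (s * DD ((z + a *\<^sub>R h) + b *\<^sub>R k) k h)"
    using Fa Db by (simp add: algebra_simps)
  moreover have "F s - F 0 = f (z + s *\<^sub>R h + s *\<^sub>R k) - f (z + s *\<^sub>R h) - f (z + s *\<^sub>R k) + f z"
    by (simp add: F_def algebra_simps)
  ultimately show ?thesis using a b by (auto simp: power2_eq_square)
qed

lemma C2_symmetric_real:
  fixes f :: "'a::real_normed_vector \<Rightarrow> real"
  assumes C2: "C2 U f D DD" and "open U" "z \<in> U"
  shows "DD z h k = DD z k h"
proof (rule ccontr)
  assume ne: "DD z h k \<noteq> DD z k h"
  define e where "e = \<bar>DD z h k - DD z k h\<bar> / 2"
  have "e > 0" using ne by (simp add: e_def)
  have cont: "((\<lambda>w. DD w x y) \<longlongrightarrow> DD z x y) (nhds z)" for x y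
  proof -
    have "continuous_on U (\<lambda>w. DD w x y)" using C2 by (auto simp: C2_def C1_def)
    then have "isCont (\<lambda>w. DD w x y) z"
      using assms(2,3) continuous_on_eq_continuous_at by blast
    then show ?thesis
      unfolding isCont_def
      by (rule iffD1[OF tendsto_at_iff_tendsto_nhds[of "\<lambda>w. DD w x y" z]])
  qed
  have "\<forall>\<^sub>F w in nhds z. w \<in> U \<and> \<bar>DD w h k - DD z h k\<bar> < e \<and> \<bar>DD w k h - DD z k h\<bar> < e"
    using tendstoD[OF cont[of h k] \<open>e > 0\<close>] tendstoD[OF cont[of k h] \<open>e > 0\<close>]
      eventually_nhds_in_open[OF \<open>open U\<close> \<open>z \<in> U\<close>]
    by (simp add: dist_real_def eventually_conj_iff)
  then obtain d where d: "d > 0" and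
    near: "\<And>w. dist w z < d \<Longrightarrow> w \<in> U \<and> \<bar>DD w h k - DD z h k\<bar> < e \<and> \<bar>DD w k h - DD z k h\<bar> < e"
    unfolding eventually_nhds_metric by blast
  define s where "s = d / (2 * (norm h + norm k + 1))"
  have "s > 0" using d by (simp add: s_def add_nonneg_pos)
  have close: "dist (z + a *\<^sub>R h + b *\<^sub>R k) z < d" if "0 \<le> a" "a \<le> s" "0 \<le> b" "b \<le> s" for a b
  proof -
    have "dist (z + a *\<^sub>R h + b *\<^sub>R k) z = norm (a *\<^sub>R h + b *\<^sub>R k)" by (simp add: dist_norm algebra_simps)
    also have "\<dots> \<le> a * norm h + b * norm k" using norm_triangle_ineq[of "a *\<^sub>R h" "b *\<^sub>R k"] that by simp
    also have "\<dots> \<le> s * norm h + s * norm k" using that by (intro add_mono mult_right_mono) auto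
    also have "\<dots> \<le> s * (norm h + norm k + 1)" using \<open>s > 0\<close> by (simp add: algebra_simps)
    also have "\<dots> = d / 2"
      using add_nonneg_pos[of "norm h + norm k" 1] by (simp add: s_def field_simps)
    finally show ?thesis using d by simp
  qed
  have inU: "z + a *\<^sub>R h + b *\<^sub>R k \<in> U" if "0 \<le> a" "a \<le> s" "0 \<le> b" "b \<le> s" for a b
    using near[OF close[OF that]] by blast
  have inU': "z + a *\<^sub>R k + b *\<^sub>R h \<in> U" if "0 \<le> a" "a \<le> s" "0 \<le> b" "b \<le> s" for a b
    using inU[OF that(3,4,1,2)] by (simp add: algebra_simps)
  obtain a b where ab: "0 < a" "a < s" "0 < b" "b < s"
    "f (z + s *\<^sub>R h + s *\<^sub>R k) - f (z + s *\<^sub>R h) - f (z + s *\<^sub>R k) + f z = s\<^sup>2 * DD (z + a *\<^sub>R h + b *\<^sub>R k) k h"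
    using second_difference_mvt[OF C2 \<open>s > 0\<close> inU] by blast
  obtain a' b' where ab': "0 < a'" "a' < s" "0 < b'" "b' < s"
    "f (z + s *\<^sub>R k + s *\<^sub>R h) - f (z + s *\<^sub>R k) - f (z + s *\<^sub>R h) + f z = s\<^sup>2 * DD (z + a' *\<^sub>R k + b' *\<^sub>R h) h k"
    using second_difference_mvt[OF C2 \<open>s > 0\<close> inU'] by blast
  have "s\<^sup>2 * DD (z + a *\<^sub>R h + b *\<^sub>R k) k h = s\<^sup>2 * DD (z + a' *\<^sub>R k + b' *\<^sub>R h) h k"
    using ab(5) ab'(5) by (simp add: algebra_simps)
  then have "DD (z + a *\<^sub>R h + b *\<^sub>R k) k h = DD (z + b' *\<^sub>R h + a' *\<^sub>R k) h k"
    using \<open>s > 0\<close> by (simp add: algebra_simps)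
  moreover have "\<bar>DD (z + a *\<^sub>R h + b *\<^sub>R k) k h - DD z k h\<bar> < e"
    using near[OF close[of a b]] ab by auto
  moreover have "\<bar>DD (z + b' *\<^sub>R h + a' *\<^sub>R k) h k - DD z h k\<bar> < e"
    using near[OF close[of b' a']] ab' by auto
  ultimately show False by (auto simp: e_def abs_if split: if_splits)
qed

lemma C2_symmetric:
  fixes f :: "'a::real_normed_vector \<Rightarrow> 'b::real_inner"
  assumes C2: "C2 U f D DD" and "open U" "z \<in> U"
  shows "DD z h k = DD z k h"
proof -
  have "DD z h k \<bullet> w = DD z k h \<bullet> w" for w
    by (rule C2_symmetric_real[OF C2_bounded_linear[OF bounded_linear_inner_left C2] assms(2,3)])
  then show ?thesis by (metis inner_commute vector_eq_rdot)
qed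

lemma C2_symmetric_blinfun:
  fixes f :: "'a::real_normed_vector \<Rightarrow> 'v::real_normed_vector \<Rightarrow>\<^sub>L 'b::real_inner"
  assumes C2: "C2 U f D DD" and "open U" "z \<in> U"
  shows "DD z h k = DD z k h"
  by (rule blinfun_eqI, rule C2_symmetric[OF C2_bounded_linear[OF blinfun.bounded_linear_left C2] assms(2,3)])

text \<open>
  Marginals inherit differentiability. In the applications \<open>L\<close> is the projection along \<open>b\<close>, so that
  the integral runs over the line through the given point.
\<close>

lemma C1_line_integral:
  fixes f :: "'a::euclidean_space \<Rightarrow> 'b::banach"
  and L :: "'a \<Rightarrow> 'a"
  assumes f: "C1 UNIV f f'" and L: "bounded_linear L"
  shows "C1 UNIV (\<lambda>z. integral {a..c} (\<lambda>s. f (L z + s *\<^sub>R b)))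
    (\<lambda>z h. integral {a..c} (\<lambda>s. f' (L z + s *\<^sub>R b) (L h)))"
  unfolding C1_def
proof (intro conjI ballI allI)
  have contL: "continuous_on UNIV L" using L by (rule linear_continuous_on)
  note contL' [continuous_intros] = continuous_on_compose2[OF contL]
  have contf': "continuous_on UNIV (\<lambda>z. f' z h)" for h using f by (auto simp: C1_def)
  note contf'' = continuous_on_compose2[OF contf']
  note contf = continuous_on_compose2[OF C1_cont[OF f]]
  have lin: "bounded_linear (\<lambda>h. f' z (L h))" for z
    using bounded_linear_compose[OF C1_linear[OF f] L] by simp
  define fx where "fx z s = Blinfun (\<lambda>h. f' (L z + s *\<^sub>R b) (L h))" for z s
  have fx: "blinfun_apply (fx z s) = (\<lambda>h. f' (L z + s *\<^sub>R b) (L h))" for z s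
    unfolding fx_def by (rule bounded_linear_Blinfun_apply[OF lin])
  have contfx: "continuous_on X (\<lambda>(z, s). fx z s)" for X
    unfolding continuous_on_def split_beta
  proof (intro ballI tendsto_componentwise1)
    fix p j assume "p \<in> X" "j \<in> (Basis :: 'a set)"
    have "continuous_on X (\<lambda>p. L (fst p) + snd p *\<^sub>R b)"
      by (intro continuous_intros subset_UNIV)
    then have "continuous_on X (\<lambda>p. f' (L (fst p) + snd p *\<^sub>R b) (L j))"
      by (rule contf'') (rule subset_UNIV)
    then show "((\<lambda>p. fx (fst p) (snd p) j) \<longlongrightarrow> fx (fst p) (snd p) j) (at p within X)"
      using \<open>p \<in> X\<close> unfolding fx by (rule continuous_on_def[THEN iffD1, THEN bspec])
  qed
  show "continuous_on UNIV (\<lambda>z. integral {a..c} (\<lambda>s. f' (L z + s *\<^sub>R b) (L h)))" for h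
  proof -
    have "continuous_on (UNIV \<times> cbox a c) (\<lambda>(z, s). f' (L z + s *\<^sub>R b) (L h))"
      unfolding split_beta by (rule contf'') (intro continuous_intros subset_UNIV)+
    from integral_continuous_on_param[OF this] show ?thesis by simp
  qed
  fix z
  have "((\<lambda>z. integral (cbox a c) (\<lambda>s. f (L z + s *\<^sub>R b))) has_derivative
      blinfun_apply (integral (cbox a c) (fx z))) (at z within UNIV)"
  proof (rule leibniz_rule)
    fix z s
    have "(L has_derivative L) (at z)" by (rule bounded_linear_imp_has_derivative[OF L])
    then have "((\<lambda>z. L z + s *\<^sub>R b) has_derivative L) (at z)"
      by (rule has_derivative_add_const)
    moreover have "(f has_derivative f' (L z + s *\<^sub>R b)) (at (L z + s *\<^sub>R b))"
      using f by (auto simp: C1_def)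
    ultimately show "((\<lambda>z. f (L z + s *\<^sub>R b)) has_derivative blinfun_apply (fx z s)) (at z within UNIV)"
      unfolding fx using diff_chain_at[of "\<lambda>z. L z + s *\<^sub>R b" L z f] by (simp add: o_def)
  next
    fix z show "(\<lambda>s. f (L z + s *\<^sub>R b)) integrable_on cbox a c"
      by (rule integrable_continuous, rule contf) (intro continuous_intros subset_UNIV)+
  qed (auto intro: contfx)
  moreover have "blinfun_apply (integral (cbox a c) (fx z)) = (\<lambda>h. integral {a..c} (\<lambda>s. f' (L z + s *\<^sub>R b) (L h)))"
  proof
    fix h
    have "fx z integrable_on cbox a c"
    proof (rule integrable_continuous)
      have "continuous_on (cbox a c) (\<lambda>s. case (z, s) of (z, s) \<Rightarrow> fx z s)"
        by (rule continuous_on_compose2[OF contfx[of UNIV]]) (auto intro!: continuous_intros)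
      then show "continuous_on (cbox a c) (fx z)" by simp
    qed
    from integral_linear[OF this blinfun.bounded_linear_left[of h]]
    show "blinfun_apply (integral (cbox a c) (fx z)) h = integral {a..c} (\<lambda>s. f' (L z + s *\<^sub>R b) (L h))"
      by (simp add: o_def fx)
  qed
  ultimately show "((\<lambda>z. integral {a..c} (\<lambda>s. f (L z + s *\<^sub>R b))) has_derivative
      (\<lambda>h. integral {a..c} (\<lambda>s. f' (L z + s *\<^sub>R b) (L h)))) (at z)" by simp
qed

lemma C2_line_integral:
  fixes f :: "'a::euclidean_space \<Rightarrow> 'b::banach"
  and L :: "'a \<Rightarrow> 'a"
  assumes "C2 UNIV f D DD" and "bounded_linear L"
  shows "C2 UNIV (\<lambda>z. integral {a..c} (\<lambda>s. f (L z + s *\<^sub>R b)))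
    (\<lambda>z h. integral {a..c} (\<lambda>s. D (L z + s *\<^sub>R b) (L h)))
    (\<lambda>z h k. integral {a..c} (\<lambda>s. DD (L z + s *\<^sub>R b) (L h) (L k)))"
  unfolding C2_def
proof (intro conjI allI)
  show "C1 UNIV (\<lambda>z. integral {a..c} (\<lambda>s. f (L z + s *\<^sub>R b)))
    (\<lambda>z h. integral {a..c} (\<lambda>s. D (L z + s *\<^sub>R b) (L h)))"
    using assms by (intro C1_line_integral) (auto simp: C2_def)
  show "C1 UNIV (\<lambda>z. integral {a..c} (\<lambda>s. D (L z + s *\<^sub>R b) (L h)))
    (\<lambda>z k. integral {a..c} (\<lambda>s. DD (L z + s *\<^sub>R b) (L k) (L h)))" for h
    by (rule C1_line_integral[OF _ assms(2), of "\<lambda>z. D z (L h)" "\<lambda>z k. DD z k (L h)"])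
       (use assms in \<open>auto simp: C2_def\<close>)
qed

section \<open>A log-concave cutoff function\<close>

definition clamp01 :: "real \<Rightarrow> real" where "clamp01 s = max 0 (min 1 s)"

text \<open>
  \<open>cutoff\<close> is the distribution function of the density \<open>30 q\<^sup>2 (1 - q)\<^sup>2\<close> on the unit interval. The
  density vanishes to second order at the end points, which makes \<open>cutoff\<close> of class C2.
\<close>

definition cutoff :: "real \<Rightarrow> real"
  where "cutoff s = 10 * clamp01 s ^ 3 - 15 * clamp01 s ^ 4 + 6 * clamp01 s ^ 5"

definition cutoff' :: "real \<Rightarrow> real"
  where "cutoff' s = 30 * clamp01 s ^ 2 * (1 - clamp01 s) ^ 2"

definition cutoff'' :: "real \<Rightarrow> real"
  where "cutoff'' s = 60 * clamp01 s * (1 - clamp01 s) * (1 - 2 * clamp01 s)"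

lemma clamp01_range: "0 \<le> clamp01 s" "clamp01 s \<le> 1"
  by (auto simp: clamp01_def)

lemma continuous_on_clamp01: "continuous_on S clamp01"
  unfolding clamp01_def by (intro continuous_intros)

lemma DERIV_clamp01_compose:
  assumes f: "\<And>q. DERIV f q :> f' q" and "f' 0 = 0" "f' 1 = 0"
  shows "DERIV (\<lambda>s. f (clamp01 s)) s :> f' (clamp01 s)"
proof (cases "0 < s \<and> s < 1")
  case True
  then have "\<forall>\<^sub>F t in nhds s. t \<in> {0<..<1}" by (intro eventually_nhds_in_open) auto
  then have "\<forall>\<^sub>F t in nhds s. f (clamp01 t) = f t"
    by eventually_elim (auto simp: clamp01_def)
  then have "DERIV (\<lambda>s. f (clamp01 s)) s :> f' (clamp01 s) \<longleftrightarrow> DERIV f s :> f' (clamp01 s)"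
    by (intro DERIV_cong_ev) auto
  then show ?thesis using True f[of s] by (simp add: clamp01_def)
next
  case False
  then have "clamp01 s = 0 \<or> clamp01 s = 1" by (auto simp: clamp01_def)
  then have z: "f' (clamp01 s) = 0" using assms by auto
  have lim: "((\<lambda>q. norm (f q - f (clamp01 s)) / norm (q - clamp01 s)) \<longlongrightarrow> 0) (at (clamp01 s))"
    using f[of "clamp01 s"] by (simp add: z has_field_derivative_def has_derivative_iff_norm)
  have "((\<lambda>t. norm (f (clamp01 t) - f (clamp01 s)) / norm (t - s)) \<longlongrightarrow> 0) (at s)"
  proof (rule tendstoI)
    fix e :: real assume "e > 0"
    from tendstoD[OF lim this] obtain d where d: "d > 0"
      "\<And>q. q \<noteq> clamp01 s \<Longrightarrow> dist q (clamp01 s) < d \<Longrightarrow> norm (f q - f (clamp01 s)) / norm (q - clamp01 s) < e"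
      by (auto simp: eventually_at)
    have lip: "\<bar>clamp01 t - clamp01 s\<bar> \<le> \<bar>t - s\<bar>" for t by (auto simp: clamp01_def)
    have "norm (f (clamp01 t) - f (clamp01 s)) / norm (t - s) < e" if "t \<noteq> s" "dist t s < d" for t
    proof (cases "clamp01 t = clamp01 s")
      case False
      then have "norm (f (clamp01 t) - f (clamp01 s)) < e * \<bar>clamp01 t - clamp01 s\<bar>"
        using d(2)[of "clamp01 t"] that lip[of t] by (simp add: dist_real_def field_simps)
      also have "\<dots> \<le> e * \<bar>t - s\<bar>" using lip[of t] \<open>e > 0\<close> by (intro mult_left_mono) auto
      finally show ?thesis using that by (simp add: field_simps)
    qed (use \<open>e > 0\<close> in simp)
    then show "\<forall>\<^sub>F t in at s. dist (norm (f (clamp01 t) - f (clamp01 s)) / norm (t - s)) 0 < e"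
      using d(1) by (auto simp: eventually_at)
  qed
  then show ?thesis
    by (simp add: z has_field_derivative_def has_derivative_iff_norm bounded_linear_mult_right)
qed

lemma DERIV_cutoff: "DERIV cutoff s :> cutoff' s"
  unfolding cutoff_def cutoff'_def
  by (rule DERIV_clamp01_compose[where f = "\<lambda>q. 10 * q ^ 3 - 15 * q ^ 4 + 6 * q ^ 5"
        and f' = "\<lambda>q. 30 * q ^ 2 * (1 - q) ^ 2"])
     (auto intro!: derivative_eq_intros simp: algebra_simps power2_eq_square eval_nat_numeral)

lemma DERIV_cutoff': "DERIV cutoff' s :> cutoff'' s"
  unfolding cutoff'_def cutoff''_def
  by (rule DERIV_clamp01_compose[where f = "\<lambda>q. 30 * q ^ 2 * (1 - q) ^ 2"
        and f' = "\<lambda>q. 60 * q * (1 - q) * (1 - 2 * q)"])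
     (auto intro!: derivative_eq_intros simp: algebra_simps power2_eq_square eval_nat_numeral)

lemma cutoff_eq_0: "s \<le> 0 \<Longrightarrow> cutoff s = 0" "s \<le> 0 \<Longrightarrow> cutoff' s = 0" "s \<le> 0 \<Longrightarrow> cutoff'' s = 0"
  by (auto simp: cutoff_def cutoff'_def cutoff''_def clamp01_def)

lemma cutoff_eq_1: "1 \<le> s \<Longrightarrow> cutoff s = 1"
  by (auto simp: cutoff_def clamp01_def)

lemma cutoff_pos: assumes "0 < s" shows "0 < cutoff s"
proof -
  let ?q = "clamp01 s"
  have q: "0 < ?q" "?q \<le> 1" using assms by (auto simp: clamp01_def)
  have "cutoff s = ?q ^ 3 * (6 * (?q - 5/4)\<^sup>2 + 5/8)"
    by (simp add: cutoff_def algebra_simps power2_eq_square eval_nat_numeral)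
  then show ?thesis using q by (simp add: add_nonneg_pos)
qed

lemma cutoff_nonneg: "0 \<le> cutoff s"
  using cutoff_pos[of s] cutoff_eq_0(1)[of s] by (cases "0 < s") auto

lemma cutoff_le_1: "cutoff s \<le> 1"
proof -
  let ?q = "clamp01 s"
  have "1 - cutoff s = (1 - ?q) ^ 3 * (1 + 3 * ?q + 6 * ?q\<^sup>2)"
    by (simp add: cutoff_def algebra_simps power2_eq_square eval_nat_numeral)
  also have "\<dots> \<ge> 0" using clamp01_range[of s] by simp
  finally show ?thesis by simp
qed

text \<open>
  Logarithmic concavity in the form without division. It holds because the density has the same
  property; here the difference of the two sides is an explicit product of nonnegative factors.
\<close>

lemma cutoff_log_concave: "cutoff s * cutoff'' s \<le> (cutoff' s)\<^sup>2"
proof -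
  let ?q = "clamp01 s"
  have "(cutoff' s)\<^sup>2 - cutoff s * cutoff'' s
      = 60 * ?q ^ 4 * (1 - ?q) * (1 + (1 - ?q) * (3 * (?q - 1)\<^sup>2 + 1))"
    by (simp add: cutoff_def cutoff'_def cutoff''_def algebra_simps power2_eq_square eval_nat_numeral)
  also have "\<dots> \<ge> 0" using clamp01_range[of s] by (auto intro!: mult_nonneg_nonneg add_nonneg_nonneg)
  finally show ?thesis by simp
qed

lemma C2_cutoff_affine:
  fixes n :: "'a::euclidean_space"
  shows "C2 U (\<lambda>z. cutoff (c + n \<bullet> z)) (\<lambda>z h. cutoff' (c + n \<bullet> z) * (n \<bullet> h))
     (\<lambda>z k h. cutoff'' (c + n \<bullet> z) * (n \<bullet> k) * (n \<bullet> h))"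
proof -
  have cont: "continuous_on UNIV cutoff'" "continuous_on UNIV cutoff''"
    unfolding cutoff'_def cutoff''_def
    by (auto intro!: continuous_intros continuous_on_clamp01)
  have d: "((\<lambda>z. f (c + n \<bullet> z)) has_derivative (\<lambda>h. f' (c + n \<bullet> z) * (n \<bullet> h))) (at z)"
    if "\<And>s. DERIV f s :> f' s" for f f' :: "real \<Rightarrow> real" and z
  proof -
    have "((\<lambda>z. c + n \<bullet> z) has_derivative (\<lambda>h. n \<bullet> h)) (at z)"
      by (auto intro!: derivative_eq_intros)
    from has_derivative_compose[OF this that[unfolded has_field_derivative_def]]
    show ?thesis by (simp add: mult.commute)
  qed
  show ?thesis unfolding C2_def C1_def
  proof (intro conjI ballI allI)
    fix z h
    show "((\<lambda>z. cutoff' (c + n \<bullet> z) * (n \<bullet> h)) has_derivative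
        (\<lambda>k. cutoff'' (c + n \<bullet> z) * (n \<bullet> k) * (n \<bullet> h))) (at z)"
      by (rule has_derivative_mult_left[OF d[OF DERIV_cutoff']])
  next
    fix z show "((\<lambda>z. cutoff (c + n \<bullet> z)) has_derivative (\<lambda>h. cutoff' (c + n \<bullet> z) * (n \<bullet> h))) (at z)"
      by (rule d[OF DERIV_cutoff])
  next
    fix h k :: 'a
    have aff: "continuous_on U (\<lambda>z. c + n \<bullet> z)" by (intro continuous_intros)
    show "continuous_on U (\<lambda>z. cutoff' (c + n \<bullet> z) * (n \<bullet> h))"
      by (rule continuous_on_mult_right[OF continuous_on_compose2[OF cont(1) aff subset_UNIV]])
    show "continuous_on U (\<lambda>z. cutoff'' (c + n \<bullet> z) * (n \<bullet> k) * (n \<bullet> h))"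
      by (intro continuous_on_mult_right continuous_on_compose2[OF cont(2) aff subset_UNIV])
  qed
qed

section \<open>Nakano semi-positivity of operator-valued functions\<close>

text \<open>
  Here \<open>A\<close>, \<open>B j\<close> and \<open>C j k\<close> stand for the value of a metric \<open>G\<close> and its first and second
  derivatives at a point. Multiplying out \<open>- \<partial>\<^sub>k (G\<^sup>-\<^sup>1 \<partial>\<^sub>j G)\<close> turns Nakano semi-positivity into
  \<open>\<Sum>\<^sub>j\<^sub>k (\<partial>\<^sub>j \<partial>\<^sub>k G) u\<^sub>j \<bullet> u\<^sub>k \<le> G\<^sup>-\<^sup>1 p \<bullet> p\<close> with \<open>p = \<Sum>\<^sub>j (\<partial>\<^sub>j G) u\<^sub>j\<close>. The vector \<open>y\<close> is
  \<open>G\<^sup>-\<^sup>1 p\<close>, so that no inverse has to be mentioned.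
\<close>

definition nakano ::
    "('v::euclidean_space \<Rightarrow>\<^sub>L 'v) \<Rightarrow> ('a::euclidean_space \<Rightarrow> 'v \<Rightarrow>\<^sub>L 'v) \<Rightarrow> ('a \<Rightarrow> 'a \<Rightarrow> 'v \<Rightarrow>\<^sub>L 'v) \<Rightarrow> bool"
  where "nakano A B C \<longleftrightarrow> (\<forall>u y. A y = (\<Sum>j\<in>Basis. B j (u j)) \<longrightarrow>
    (\<Sum>j\<in>Basis. \<Sum>k\<in>Basis. C j k (u j) \<bullet> u k) \<le> A y \<bullet> y)"

lemma nakanoD:
  "nakano A B C \<Longrightarrow> A y = (\<Sum>j\<in>Basis. B j (u j)) \<Longrightarrow>
    (\<Sum>j\<in>Basis. \<Sum>k\<in>Basis. C j k (u j) \<bullet> u k) \<le> A y \<bullet> y"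
  by (auto simp: nakano_def)

text \<open>
  A tuple with a single nonzero entry: the curvature in one coordinate direction is nonnegative.
\<close>

lemma nakano_direction:
  assumes "nakano A B C" "b \<in> Basis" "A y = B b w"
  shows "C b b w \<bullet> w \<le> A y \<bullet> y"
proof -
  define u where "u j = (if j = b then w else 0)" for j
  have "(\<Sum>j\<in>Basis. B j (u j)) = (\<Sum>j\<in>Basis. if j = b then B b w else 0)"
    by (intro sum.cong) (auto simp: u_def blinfun.zero_right)
  also have "\<dots> = B b w" using assms(2) by simp
  finally have B: "A y = (\<Sum>j\<in>Basis. B j (u j))" using assms(3) by simp
  have "(\<Sum>j\<in>Basis. \<Sum>k\<in>Basis. C j k (u j) \<bullet> u k)
     = (\<Sum>j\<in>Basis. \<Sum>k\<in>Basis. if k = b then (if j = b then C b b w \<bullet> w else 0) else 0)"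
    by (intro sum.cong refl) (auto simp: u_def blinfun.zero_right)
  also have "\<dots> = C b b w \<bullet> w" using assms(2) by simp
  finally show ?thesis using nakanoD[OF assms(1) B] by simp
qed

text \<open>
  Multiplication by a log-concave function \<open>r\<close> of the affine function \<open>n \<bullet> z\<close>, with \<open>r1\<close> and \<open>r2\<close> the
  values of its derivatives. With \<open>U = \<Sum>\<^sub>j (n \<bullet> j) u\<^sub>j\<close> the solution \<open>y\<close> is shifted by
  \<open>(r1 / r) U\<close>, and completing the square leaves the term \<open>(r2 - r1\<^sup>2 / r) (A U \<bullet> U)\<close>, which is
  at most zero.
\<close>

lemma nakano_log_concave_mult:
  fixes A :: "'v::euclidean_space \<Rightarrow>\<^sub>L 'v" and n :: "'a::euclidean_space"
  assumes nak: "nakano A B C" and A: "self_adjoint A" "\<And>v. 0 \<le> A v \<bullet> v"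
    and B: "\<And>k. self_adjoint (B k)" and r: "0 < r" "r * r2 \<le> r1\<^sup>2"
  shows "nakano (r *\<^sub>R A) (\<lambda>h. r *\<^sub>R B h + (r1 * (n \<bullet> h)) *\<^sub>R A)
    (\<lambda>k h. (r *\<^sub>R C k h + (r1 * (n \<bullet> k)) *\<^sub>R B h) + ((r1 * (n \<bullet> h)) *\<^sub>R B k + (r2 * (n \<bullet> k) * (n \<bullet> h)) *\<^sub>R A))"
  unfolding nakano_def
proof (intro allI impI)
  fix u :: "'a \<Rightarrow> 'v" and y
  assume eq: "(r *\<^sub>R A) y = (\<Sum>j\<in>Basis. (r *\<^sub>R B j + (r1 * (n \<bullet> j)) *\<^sub>R A) (u j))"
  define U where "U = (\<Sum>j\<in>Basis. (n \<bullet> j) *\<^sub>R u j)"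
  define P where "P = (\<Sum>j\<in>Basis. B j (u j))"
  define y0 where "y0 = y - (r1 / r) *\<^sub>R U"
  have AU: "A U = (\<Sum>j\<in>Basis. (n \<bullet> j) *\<^sub>R A (u j))"
    by (simp add: U_def blinfun.sum_right blinfun.scaleR_right)
  have "r *\<^sub>R A y = r *\<^sub>R P + r1 *\<^sub>R A U"
    using eq by (simp add: P_def AU blinfun.bilinear_simps sum.distrib scaleR_sum_right)
  then have "r *\<^sub>R A y0 = r *\<^sub>R P"
    using r by (simp add: y0_def blinfun.bilinear_simps scaleR_diff_right)
  then have Ay0: "A y0 = P" using r by simp
  have L: "(\<Sum>j\<in>Basis. \<Sum>k\<in>Basis. C j k (u j) \<bullet> u k) \<le> A y0 \<bullet> y0"
    using nak Ay0 by (intro nakanoD) (auto simp: P_def)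
  have wU: "w \<bullet> U = (\<Sum>k\<in>Basis. (n \<bullet> k) * (w \<bullet> u k))" for w
    by (simp add: U_def inner_sum_right)
  have s2: "(\<Sum>j\<in>Basis. \<Sum>k\<in>Basis. (n \<bullet> k) * (B j (u j) \<bullet> u k)) = P \<bullet> U"
  proof -
    have "P \<bullet> U = (\<Sum>j\<in>Basis. B j (u j) \<bullet> U)" by (simp add: P_def inner_sum_left)
    then show ?thesis by (simp add: wU)
  qed
  have "(\<Sum>j\<in>Basis. \<Sum>k\<in>Basis. (n \<bullet> j) * (B k (u j) \<bullet> u k))
      = (\<Sum>j\<in>Basis. \<Sum>k\<in>Basis. (n \<bullet> j) * (B k (u k) \<bullet> u j))"
    by (intro sum.cong refl) (use self_adjointD[OF B] inner_commute in metis)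
  also have "\<dots> = P \<bullet> U" unfolding s2[symmetric] by (rule sum.swap)
  finally have s1: "(\<Sum>j\<in>Basis. \<Sum>k\<in>Basis. (n \<bullet> j) * (B k (u j) \<bullet> u k)) = P \<bullet> U" .
  have s3: "(\<Sum>j\<in>Basis. \<Sum>k\<in>Basis. (n \<bullet> j) * (n \<bullet> k) * (A (u j) \<bullet> u k)) = A U \<bullet> U"
  proof -
    have "A U \<bullet> U = (\<Sum>j\<in>Basis. (n \<bullet> j) * (A (u j) \<bullet> U))" by (simp add: AU inner_sum_left)
    then show ?thesis by (simp add: wU sum_distrib_left mult.assoc)
  qed
  have "(\<Sum>j\<in>Basis. \<Sum>k\<in>Basis. ((r *\<^sub>R C j k + (r1 * (n \<bullet> j)) *\<^sub>R B k) +
      ((r1 * (n \<bullet> k)) *\<^sub>R B j + (r2 * (n \<bullet> j) * (n \<bullet> k)) *\<^sub>R A)) (u j) \<bullet> u k)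
    = (\<Sum>j\<in>Basis. \<Sum>k\<in>Basis. r * (C j k (u j) \<bullet> u k) + r1 * ((n \<bullet> j) * (B k (u j) \<bullet> u k))
        + r1 * ((n \<bullet> k) * (B j (u j) \<bullet> u k)) + r2 * ((n \<bullet> j) * (n \<bullet> k) * (A (u j) \<bullet> u k)))"
    by (intro sum.cong refl) (simp add: blinfun.bilinear_simps inner_add_left mult_ac)
  also have "\<dots> = r * (\<Sum>j\<in>Basis. \<Sum>k\<in>Basis. C j k (u j) \<bullet> u k) + 2 * r1 * (P \<bullet> U) + r2 * (A U \<bullet> U)"
  proof -
    have lin: "(\<Sum>j\<in>S. \<Sum>k\<in>T. r * a j k + r1 * b j k + r1 * c j k + r2 * d j k)
        = r * (\<Sum>j\<in>S. \<Sum>k\<in>T. a j k) + r1 * (\<Sum>j\<in>S. \<Sum>k\<in>T. b j k)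
        + r1 * (\<Sum>j\<in>S. \<Sum>k\<in>T. c j k) + r2 * (\<Sum>j\<in>S. \<Sum>k\<in>T. d j k)"
      for S T :: "'a set" and a b c d
      by (simp add: sum.distrib sum_distrib_left)
    show ?thesis unfolding lin s1 s2 s3 by simp
  qed
  also have "\<dots> \<le> r * (A y0 \<bullet> y0) + 2 * r1 * (A y0 \<bullet> U) + r1\<^sup>2 / r * (A U \<bullet> U)"
  proof -
    have "r2 \<le> r1\<^sup>2 / r" using r by (simp add: field_simps)
    then have "r2 * (A U \<bullet> U) \<le> r1\<^sup>2 / r * (A U \<bullet> U)" using A(2) by (rule mult_right_mono)
    moreover have "r * (\<Sum>j\<in>Basis. \<Sum>k\<in>Basis. C j k (u j) \<bullet> u k) \<le> r * (A y0 \<bullet> y0)"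
      using L r(1) by simp
    ultimately show ?thesis by (simp add: Ay0)
  qed
  also have "\<dots> = r * (A (y0 + (r1 / r) *\<^sub>R U) \<bullet> (y0 + (r1 / r) *\<^sub>R U))"
    using r self_adjointD[OF A(1), of U y0]
    by (simp add: blinfun.bilinear_simps inner_add inner_commute field_simps power2_eq_square)
  also have "\<dots> = (r *\<^sub>R A) y \<bullet> y" by (simp add: y0_def blinfun.bilinear_simps)
  finally show "(\<Sum>j\<in>Basis. \<Sum>k\<in>Basis. ((r *\<^sub>R C j k + (r1 * (n \<bullet> j)) *\<^sub>R B k) +
      ((r1 * (n \<bullet> k)) *\<^sub>R B j + (r2 * (n \<bullet> j) * (n \<bullet> k)) *\<^sub>R A)) (u j) \<bullet> u k) \<le> (r *\<^sub>R A) y \<bullet> y" .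
qed

lemma positive_definite_coercive:
  fixes A :: "'v::euclidean_space \<Rightarrow>\<^sub>L 'v"
  assumes "\<And>v. v \<noteq> 0 \<Longrightarrow> 0 < A v \<bullet> v"
  obtains l where "0 < l" "\<And>v. l * (v \<bullet> v) \<le> A v \<bullet> v"
proof -
  have ne: "sphere (0 :: 'v) 1 \<noteq> {}" by simp
  have "continuous_on (sphere 0 1) (\<lambda>v. A v \<bullet> v)" by (intro continuous_intros)
  from continuous_attains_inf[OF compact_sphere ne this]
  obtain w where w: "w \<in> sphere 0 1" "\<And>v. v \<in> sphere 0 1 \<Longrightarrow> A w \<bullet> w \<le> A v \<bullet> v" by auto
  show thesis
  proof
    have "w \<noteq> 0" using w(1) by auto
    then show "0 < A w \<bullet> w" by (rule assms)
    fix v show "A w \<bullet> w * (v \<bullet> v) \<le> A v \<bullet> v"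
    proof (cases "v = 0")
      case False
      have "A w \<bullet> w \<le> A (v /\<^sub>R norm v) \<bullet> (v /\<^sub>R norm v)" using False by (intro w(2)) simp
      also have "\<dots> = (A v \<bullet> v) / (norm v)\<^sup>2"
        by (simp add: blinfun.scaleR_right power2_eq_square field_simps)
      finally show ?thesis using False by (simp add: field_simps power2_norm_eq_inner)
    qed (simp add: blinfun.zero_right)
  qed
qed

text \<open>
  Differentiating \<open>M a = e\<close> gives \<open>M a' = - M' a\<close>; testing with \<open>a\<close> gives the derivative of the
  quadratic form \<open>M\<^sup>-\<^sup>1 e \<bullet> e = a \<bullet> e\<close>.
\<close>

lemma solution_form_derivative:
  fixes M :: "real \<Rightarrow> 'v::euclidean_space \<Rightarrow>\<^sub>L 'v"
  assumes M: "(M has_vector_derivative M') (at s)" and sa: "self_adjoint (M s)"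
    and pos: "\<And>v. v \<noteq> 0 \<Longrightarrow> 0 < M s v \<bullet> v"
    and a: "\<forall>\<^sub>F t in nhds s. M t (a t) = e"
  obtains a' where "(a has_vector_derivative a') (at s)" "M s a' = - M' (a s)"
    "((\<lambda>t. a t \<bullet> e) has_real_derivative - (M' (a s) \<bullet> a s)) (at s)"
proof -
  obtain a' where Ma': "M s a' = - M' (a s)" using positive_definite_surj[OF pos] by blast
  obtain l where l: "0 < l" "\<And>v. l * (v \<bullet> v) \<le> M s v \<bullet> v"
    using positive_definite_coercive[OF pos] by blast
  have a': "(a has_vector_derivative a') (at s)"
  proof (rule blinfun.has_vector_derivative_solution[OF M _ a])
    show "((\<lambda>t. e) has_vector_derivative 0) (at s)" by simp
    show "M s a' = 0 - M' (a s)" using Ma' by simp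
  qed (use l coercive_norm_le[OF l(2)] in auto)
  have "((\<lambda>t. a t \<bullet> e) has_vector_derivative a' \<bullet> e) (at s)"
    by (rule bounded_linear.has_vector_derivative[OF bounded_linear_inner_left a'])
  moreover have "a' \<bullet> e = - (M' (a s) \<bullet> a s)"
    using self_adjointD[OF sa, of a' "a s"] eventually_nhds_x_imp_x[OF a] Ma' by simp
  ultimately show thesis
    using that a' Ma' by (simp add: has_real_derivative_iff_has_vector_derivative)
qed

text \<open>
  Positivity of the curvature along one line makes the inverse operators a convex function: with
  \<open>a = M\<^sup>-\<^sup>1 e\<close> one has \<open>M a' = - M' a\<close>, so the second derivative of \<open>a \<bullet> e\<close> is
  \<open>2 (M a' \<bullet> a') - M'' a \<bullet> a\<close>, and the curvature bounds the last term by \<open>M a' \<bullet> a'\<close>.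
\<close>

lemma inverse_form_convex:
  fixes M M' M'' :: "real \<Rightarrow> 'v::euclidean_space \<Rightarrow>\<^sub>L 'v"
  assumes J: "open J" "convex J"
    and M: "\<And>s. s \<in> J \<Longrightarrow> (M has_vector_derivative M' s) (at s)"
    and M': "\<And>s. s \<in> J \<Longrightarrow> (M' has_vector_derivative M'' s) (at s)"
    and sa: "\<And>s. s \<in> J \<Longrightarrow> self_adjoint (M s)" "\<And>s. s \<in> J \<Longrightarrow> self_adjoint (M' s)"
    and pos: "\<And>s v. s \<in> J \<Longrightarrow> v \<noteq> 0 \<Longrightarrow> 0 < M s v \<bullet> v"
    and curv: "\<And>s w y. s \<in> J \<Longrightarrow> M s y = M' s w \<Longrightarrow> M'' s w \<bullet> w \<le> M s y \<bullet> y"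
    and a: "\<And>s. s \<in> J \<Longrightarrow> M s (a s) = e"
  shows "convex_on J (\<lambda>s. a s \<bullet> e)"
proof -
  have "\<exists>a'. (a has_vector_derivative a') (at s) \<and> M s a' = - M' s (a s) \<and>
      ((\<lambda>t. a t \<bullet> e) has_real_derivative - (M' s (a s) \<bullet> a s)) (at s)" if s: "s \<in> J" for s
  proof -
    have "\<forall>\<^sub>F t in nhds s. M t (a t) = e"
      using eventually_nhds_in_open[OF J(1) s] by eventually_elim (rule a)
    from solution_form_derivative[OF M[OF s] sa(1)[OF s] pos[OF s] this] show ?thesis by blast
  qed
  then obtain a' where a': "\<And>s. s \<in> J \<Longrightarrow> (a has_vector_derivative a' s) (at s)"
    "\<And>s. s \<in> J \<Longrightarrow> M s (a' s) = - M' s (a s)"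
    and d1: "\<And>s. s \<in> J \<Longrightarrow> ((\<lambda>t. a t \<bullet> e) has_real_derivative - (M' s (a s) \<bullet> a s)) (at s)"
    by metis
  show ?thesis
  proof (rule f''_ge0_imp_convex[OF J(2) d1])
    fix s assume s: "s \<in> J"
    have "((\<lambda>s. M' s (a s)) has_vector_derivative (M' s (a' s) + M'' s (a s))) (at s)"
      using blinfun.has_vector_derivative[OF M'[OF s] a'(1)[OF s]] by simp
    from bounded_bilinear.has_vector_derivative[OF bounded_bilinear_inner this a'(1)[OF s]]
    have "((\<lambda>s. M' s (a s) \<bullet> a s) has_vector_derivative
        (M' s (a s) \<bullet> a' s + (M' s (a' s) + M'' s (a s)) \<bullet> a s)) (at s)" .
    moreover have "M' s (a s) \<bullet> a' s + (M' s (a' s) + M'' s (a s)) \<bullet> a s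
        = M'' s (a s) \<bullet> a s - 2 * (M s (a' s) \<bullet> a' s)"
      using self_adjointD[OF sa(2)[OF s], of "a' s" "a s"] a'(2)[OF s]
      by (simp add: inner_add inner_commute)
    ultimately show "((\<lambda>s. - (M' s (a s) \<bullet> a s)) has_real_derivative
        2 * (M s (a' s) \<bullet> a' s) - M'' s (a s) \<bullet> a s) (at s)"
      by (auto simp: has_real_derivative_iff_has_vector_derivative intro!: derivative_eq_intros)
    have "M s (- a' s) = M' s (a s)" using a'(2)[OF s] by (simp add: blinfun.minus_right)
    from curv[OF s this] have "M'' s (a s) \<bullet> a s \<le> M s (a' s) \<bullet> a' s"
      by (simp add: blinfun.minus_right)
    moreover have "0 \<le> M s (a' s) \<bullet> a' s"
      using pos[OF s, of "a' s"] by (cases "a' s = 0") (auto simp: less_imp_le)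
    ultimately show "0 \<le> 2 * (M s (a' s) \<bullet> a' s) - M'' s (a s) \<bullet> a s" by linarith
  qed
qed

section \<open>The estimate in one variable\<close>

lemma open_convex_bounded_real:
  fixes J :: "real set"
  assumes "open J" "convex J" "bounded J" "J \<noteq> {}"
  obtains a c where "a < c" "J = {a<..<c}"
proof -
  have bdd: "bdd_below J" "bdd_above J"
    using assms(3) by (auto intro: bounded_imp_bdd_below bounded_imp_bdd_above)
  have eq: "J = {Inf J<..<Sup J}"
  proof (intro set_eqI iffI)
    fix s assume "s \<in> J"
    then obtain e where e: "e > 0" "ball s e \<subseteq> J" using assms(1) open_contains_ball by blast
    have "s - e/2 \<in> J" "s + e/2 \<in> J" using e by (auto simp: subset_iff dist_real_def)
    then have "Inf J \<le> s - e/2" "s + e/2 \<le> Sup J"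
      using bdd by (auto intro: cInf_lower cSup_upper)
    then show "s \<in> {Inf J<..<Sup J}" using e by auto
  next
    fix s assume "s \<in> {Inf J<..<Sup J}"
    then obtain x y where "x \<in> J" "x < s" "y \<in> J" "s < y"
      using cInf_lessD[OF assms(4), of s] less_cSupD[OF assms(4), of s] by auto
    then show "s \<in> J"
      using assms(2) mem_is_interval_1_I[of J x y s] is_interval_convex_1[of J] by simp
  qed
  then have "Inf J < Sup J" using assms(4) by (metis greaterThanLessThan_empty_iff not_less)
  then show thesis using eq that by blast
qed

text \<open>
  A nonnegative function which tends to zero at the left end point of an interval cannot be
  decreasing there.
\<close>

lemma deriv_nonneg_near_zero:
  fixes f :: "real \<Rightarrow> real"
  assumes "a < d"
    and deriv: "\<And>s. a < s \<Longrightarrow> s < d \<Longrightarrow> DERIV f s :> f' s"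
    and nonneg: "\<And>s. a < s \<Longrightarrow> s < d \<Longrightarrow> 0 \<le> f s"
    and le: "\<And>s. a < s \<Longrightarrow> s < d \<Longrightarrow> f s \<le> k * (s - a)\<^sup>2"
  shows "\<exists>s. a < s \<and> s < d \<and> 0 \<le> f' s"
proof (rule ccontr)
  assume "\<not> ?thesis"
  then have neg: "\<And>s. a < s \<Longrightarrow> s < d \<Longrightarrow> f' s < 0" by force
  have dec: "f t < f s" if "a < s" "s < t" "t < d" for s t
  proof (rule DERIV_neg_imp_decreasing[OF \<open>s < t\<close>])
    fix x assume "s \<le> x" "x \<le> t"
    then have "a < x" "x < d" using that by auto
    then show "\<exists>y. DERIV f x :> y \<and> y < 0" using deriv neg by blast
  qed
  define m where "m = (a + d) / 2"
  have m: "a < m" "m < d" using \<open>a < d\<close> by (auto simp: m_def)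
  have "0 \<le> f ((m + d) / 2)" using m by (intro nonneg) auto
  also have "\<dots> < f m" using m by (intro dec) auto
  finally have fm: "0 < f m" .
  have lim: "((\<lambda>s. k * (s - a)\<^sup>2) \<longlongrightarrow> k * (a - a)\<^sup>2) (at_right a)" by (intro tendsto_intros)
  then have "\<forall>\<^sub>F s in at_right a. k * (s - a)\<^sup>2 < f m" using fm by (intro order_tendstoD(2)[OF lim]) auto
  moreover have "\<forall>\<^sub>F s in at_right a. s \<in> {a<..<m}" using m by (intro eventually_at_right_real) auto
  ultimately have "\<forall>\<^sub>F s in at_right a. False"
  proof eventually_elim
    case (elim s)
    then show False using dec[of s m] le[of s] m by auto
  qed
  then show False by (simp add: trivial_limit_at_right_real)
qed

lemma deriv_nonpos_near_zero:
  fixes f :: "real \<Rightarrow> real"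
  assumes "d < c"
    and deriv: "\<And>s. d < s \<Longrightarrow> s < c \<Longrightarrow> DERIV f s :> f' s"
    and nonneg: "\<And>s. d < s \<Longrightarrow> s < c \<Longrightarrow> 0 \<le> f s"
    and le: "\<And>s. d < s \<Longrightarrow> s < c \<Longrightarrow> f s \<le> k * (c - s)\<^sup>2"
  shows "\<exists>s. d < s \<and> s < c \<and> f' s \<le> 0"
proof -
  have "\<exists>s. - c < s \<and> s < - d \<and> 0 \<le> - f' (- s)"
  proof (rule deriv_nonneg_near_zero[where f = "\<lambda>s. f (- s)" and k = k])
    fix s :: real assume s: "- c < s" "s < - d"
    show "DERIV (\<lambda>s. f (- s)) s :> - f' (- s)"
      using DERIV_mirror[of f "f' (- s)" s] deriv[of "- s"] s by simp
    show "0 \<le> f (- s)" using s by (intro nonneg) auto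
    show "f (- s) \<le> k * (s - (- c))\<^sup>2" using le[of "- s"] s by (simp add: add.commute)
  qed (use assms in auto)
  then obtain s where "- c < s" "s < - d" "0 \<le> - f' (- s)" by blast
  then show ?thesis by (intro exI[of _ "- s"]) auto
qed

lemma norm_integral_le_const:
  fixes f :: "real \<Rightarrow> 'v::euclidean_space"
  assumes "a \<le> c" "continuous_on {a..c} f" "\<And>t. a < t \<Longrightarrow> t < c \<Longrightarrow> norm (f t) \<le> B" "0 \<le> B"
  shows "norm (integral {a..c} f) \<le> B * (c - a)"
proof (cases "a = c")
  case False
  then have "a < c" using assms(1) by simp
  have "norm (f t) \<le> B" if "t \<in> {a..c}" for t
  proof (rule continuous_ge_on_Ioo[of a c "\<lambda>t. B - norm (f t)" 0 t, simplified])
  qed (use \<open>a < c\<close> assms that in \<open>auto intro!: continuous_intros\<close>)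
  then show ?thesis using integral_bound[OF assms(1,2)] by auto
qed simp

text \<open>
  The heart of the proof. The vector field \<open>\<alpha>\<close> solves \<open>p + (M \<alpha>)' = M y\<close>; because
  \<open>p\<close> and \<open>M y\<close> have the same integral, \<open>\<beta> = M \<alpha>\<close> can vanish at both end points. Inserting
  \<open>\<alpha>\<close> into the curvature inequality in the direction of integration turns it into
  \<open>l \<le> M y \<bullet> y - 2 y \<bullet> \<beta>' + (\<beta> \<bullet> \<alpha>)''\<close>. The function \<open>\<beta> \<bullet> \<alpha> = M \<alpha> \<bullet> \<alpha>\<close> is nonnegative and
  tends to zero at the end points, so its derivative contributes with the right sign.
\<close>

lemma one_variable_estimate:
  fixes M M' M'' :: "real \<Rightarrow> 'v::euclidean_space \<Rightarrow>\<^sub>L 'v" and p p' :: "real \<Rightarrow> 'v"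
    and l :: "real \<Rightarrow> real" and y :: 'v
  assumes M: "\<And>s. (M has_vector_derivative M' s) (at s)"
    and M': "\<And>s. (M' has_vector_derivative M'' s) (at s)"
    and p: "\<And>s. (p has_vector_derivative p' s) (at s)"
    and l: "continuous_on UNIV l"
    and supp: "\<And>s. M s \<noteq> 0 \<Longrightarrow> \<bar>s\<bar> < R"
    and conv: "convex {s. M s \<noteq> 0}"
    and zero: "\<And>s. M s = 0 \<Longrightarrow> p s = 0 \<and> l s = 0"
    and sa: "\<And>s. self_adjoint (M s)" "\<And>s. self_adjoint (M' s)"
    and C0: "0 \<le> C" and C: "\<And>s v. norm (M s) * (v \<bullet> v) \<le> C * (M s v \<bullet> v)"
    and Cp0: "0 \<le> Cp" and pC: "\<And>s. (norm (p s))\<^sup>2 \<le> Cp * norm (M s)"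
    and curv: "\<And>s w Y. M s \<noteq> 0 \<Longrightarrow> M s Y = M' s w \<Longrightarrow> M'' s w \<bullet> w \<le> M s Y \<bullet> Y"
    and nak: "\<And>s w Y. M s \<noteq> 0 \<Longrightarrow> M s Y = p s + M' s w \<Longrightarrow>
        l s + 2 * (p' s \<bullet> w) + M'' s w \<bullet> w \<le> M s Y \<bullet> Y"
    and eq: "(integral {-R..R} M) y = integral {-R..R} p"
  shows "integral {-R..R} l \<le> (integral {-R..R} M) y \<bullet> y"
proof (cases "\<exists>s. M s \<noteq> 0")
  case False
  then have "M = (\<lambda>s. 0)" "l = (\<lambda>s. 0)" using zero by auto
  then show ?thesis by simp
next
  case True
  define J where "J = {s. M s \<noteq> 0}"
  have contM: "continuous_on S M" for S
    by (auto intro!: continuous_at_imp_continuous_on has_vector_derivative_continuous M)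
  have contp: "continuous_on S p" for S
    by (auto intro!: continuous_at_imp_continuous_on has_vector_derivative_continuous p)
  have contl: "continuous_on S l" for S using l by (rule continuous_on_subset) simp
  have "open J" unfolding J_def by (intro open_Collect_neq contM continuous_intros)
  moreover have "bounded J" using supp by (auto simp: J_def intro!: boundedI[of _ R] less_imp_le)
  ultimately obtain a c where ac: "a < c" "J = {a<..<c}"
    using open_convex_bounded_real[of J] conv True by (auto simp: J_def)
  have J_iff: "M s \<noteq> 0 \<longleftrightarrow> a < s \<and> s < c" for s using ac by (auto simp: J_def set_eq_iff)
  have acR: "-R \<le> a" "c \<le> R"
  proof -
    have "-R \<le> s" if "s \<in> {a<..<c}" for s using supp[of s] that ac by (auto simp: J_def set_eq_iff)
    then show "-R \<le> a" using ac(1) dense_le_bounded by (metis dense_ge_bounded greaterThanLessThan_iff)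
    have "s \<le> R" if "s \<in> {a<..<c}" for s using supp[of s] that ac by (auto simp: J_def set_eq_iff)
    then show "c \<le> R" using ac(1) by (metis dense_le_bounded greaterThanLessThan_iff)
  qed
  have pos: "0 < M s v \<bullet> v" if "s \<in> J" "v \<noteq> 0" for s v
  proof -
    have "0 < norm (M s) * (v \<bullet> v)" using that by (simp add: J_def)
    then have "0 < C * (M s v \<bullet> v)" using C[of s v] by linarith
    then show ?thesis using C0 by (simp add: zero_less_mult_iff)
  qed
  have m_pos: "0 < norm (M s)" if "s \<in> J" for s using that by (simp add: J_def)
  have int_eq: "integral {-R..R} g = integral {a..c} g"
    if "continuous_on UNIV g" "\<And>s. M s = 0 \<Longrightarrow> g s = 0" for g :: "real \<Rightarrow> 'z::banach"
  proof -
    have "g integrable_on {a..c}"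
      using that(1) by (intro integrable_continuous_real) (auto intro: continuous_on_subset)
    then have "(g has_integral integral {a..c} g) {-R..R}"
    proof (rule has_integral_on_superset[OF integrable_integral])
      fix x assume "x \<notin> {a..c}"
      then show "g x = 0" using J_iff[of x] by (intro that(2)) auto
    next
      show "{a..c} \<subseteq> {-R..R}" using acR by auto
    qed
    then show ?thesis by (rule integral_unique)
  qed

  define f where "f s = M s y - p s" for s
  define f' where "f' s = M' s y - p' s" for s
  have f_deriv: "(f has_vector_derivative f' s) (at s)" for s
    unfolding f_def f'_def
    by (intro has_vector_derivative_diff p bounded_linear.has_vector_derivative[OF blinfun.bounded_linear_left] M)
  have contf: "continuous_on S f" for S
    by (auto intro!: continuous_at_imp_continuous_on has_vector_derivative_continuous f_deriv)
  have f0: "f s = 0" if "M s = 0" for s using zero[OF that] that by (simp add: f_def)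
  have intM: "M integrable_on {-R..R}" using contM by (rule integrable_continuous_real)
  have intMy: "integral {-R..R} (\<lambda>s. M s v) = (integral {-R..R} M) v" for v
    using integral_linear[OF intM blinfun.bounded_linear_left[of v]] by (simp add: o_def)
  have intf: "integral {a..c} f = 0"
  proof -
    have "integral {a..c} f = integral {-R..R} f" using contf f0 by (rule int_eq[symmetric])
    also have "\<dots> = integral {-R..R} (\<lambda>s. M s y) - integral {-R..R} p"
      unfolding f_def
      by (intro integral_diff integrable_continuous_real continuous_intros contM contp)
    finally show ?thesis using eq by (simp add: intMy)
  qed
  define \<beta> where "\<beta> s = integral {a..s} f" for s
  have \<beta>_deriv: "(\<beta> has_vector_derivative f s) (at s)" if "s \<in> J" for s
  proof -
    have "(\<beta> has_vector_derivative f s) (at s within {a..c})"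
      unfolding \<beta>_def using that ac by (intro integral_has_vector_derivative contf) auto
    then show ?thesis using that ac at_within_Icc_at[of a s c] by auto
  qed
  have "\<forall>s. \<exists>x. s \<in> J \<longrightarrow> M s x = \<beta> s" using positive_definite_surj[OF pos] by metis
  then obtain \<alpha> where \<alpha>: "\<And>s. s \<in> J \<Longrightarrow> M s (\<alpha> s) = \<beta> s" by metis
  have "\<exists>x. (\<alpha> has_vector_derivative x) (at s) \<and> M s x = f s - M' s (\<alpha> s)" if s: "s \<in> J" for s
  proof -
    obtain x where x: "M s x = f s - M' s (\<alpha> s)" using positive_definite_surj[OF pos[OF s]] by blast
    obtain d where d: "0 < d" "\<And>v. d * (v \<bullet> v) \<le> M s v \<bullet> v"
      using positive_definite_coercive[OF pos[OF s]] by blast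
    have "(\<alpha> has_vector_derivative x) (at s)"
    proof (rule blinfun.has_vector_derivative_solution[OF M[of s] \<beta>_deriv[OF s] _ _ d(1)])
      show "M s x = f s - M' s (\<alpha> s)" by (rule x)
      show "\<forall>\<^sub>F t in nhds s. M t (\<alpha> t) = \<beta> t"
        using eventually_nhds_in_open[OF \<open>open J\<close> s] by eventually_elim (rule \<alpha>)
    qed (rule coercive_norm_le[OF d(2)])
    then show ?thesis using x by blast
  qed
  then obtain \<alpha>' where \<alpha>': "\<And>s. s \<in> J \<Longrightarrow> (\<alpha> has_vector_derivative \<alpha>' s) (at s)"
    "\<And>s. s \<in> J \<Longrightarrow> M s (\<alpha>' s) = f s - M' s (\<alpha> s)" by metis

  define \<phi> where "\<phi> s = \<beta> s \<bullet> \<alpha> s" for s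
  define \<phi>1 where "\<phi>1 s = 2 * (f s \<bullet> \<alpha> s) - M' s (\<alpha> s) \<bullet> \<alpha> s" for s
  define \<phi>2 where "\<phi>2 s = 2 * (f' s \<bullet> \<alpha> s) + 2 * (M s (\<alpha>' s) \<bullet> \<alpha>' s) - M'' s (\<alpha> s) \<bullet> \<alpha> s" for s
  have \<phi>_deriv: "(\<phi> has_real_derivative \<phi>1 s) (at s)" if s: "s \<in> J" for s
  proof -
    have "(\<phi> has_vector_derivative (\<beta> s \<bullet> \<alpha>' s + f s \<bullet> \<alpha> s)) (at s)"
      unfolding \<phi>_def
      by (rule bounded_bilinear.has_vector_derivative[OF bounded_bilinear_inner \<beta>_deriv[OF s] \<alpha>'(1)[OF s]])
    moreover have "\<beta> s \<bullet> \<alpha>' s = f s \<bullet> \<alpha> s - M' s (\<alpha> s) \<bullet> \<alpha> s"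
      using self_adjointD[OF sa(1), of s "\<alpha> s" "\<alpha>' s"] \<alpha>[OF s] \<alpha>'(2)[OF s]
      by (simp add: inner_commute inner_diff)
    ultimately show ?thesis
      by (simp add: \<phi>1_def has_real_derivative_iff_has_vector_derivative)
  qed
  have \<phi>1_deriv: "(\<phi>1 has_real_derivative \<phi>2 s) (at s)" if s: "s \<in> J" for s
  proof -
    have 1: "((\<lambda>s. f s \<bullet> \<alpha> s) has_vector_derivative (f s \<bullet> \<alpha>' s + f' s \<bullet> \<alpha> s)) (at s)"
      by (rule bounded_bilinear.has_vector_derivative[OF bounded_bilinear_inner f_deriv \<alpha>'(1)[OF s]])
    have 2: "((\<lambda>s. M' s (\<alpha> s)) has_vector_derivative (M' s (\<alpha>' s) + M'' s (\<alpha> s))) (at s)"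
      by (rule blinfun.has_vector_derivative[OF M' \<alpha>'(1)[OF s]])
    have 3: "((\<lambda>s. M' s (\<alpha> s) \<bullet> \<alpha> s) has_vector_derivative
        (M' s (\<alpha> s) \<bullet> \<alpha>' s + (M' s (\<alpha>' s) + M'' s (\<alpha> s)) \<bullet> \<alpha> s)) (at s)"
      by (rule bounded_bilinear.has_vector_derivative[OF bounded_bilinear_inner 2 \<alpha>'(1)[OF s]])
    have "(\<phi>1 has_real_derivative (2 * (f s \<bullet> \<alpha>' s + f' s \<bullet> \<alpha> s)
        - (M' s (\<alpha> s) \<bullet> \<alpha>' s + (M' s (\<alpha>' s) + M'' s (\<alpha> s)) \<bullet> \<alpha> s))) (at s)"
      unfolding \<phi>1_def
      by (intro DERIV_diff DERIV_cmult) (use 1 3 in \<open>simp_all add: has_real_derivative_iff_has_vector_derivative\<close>)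
    moreover have "2 * (f s \<bullet> \<alpha>' s + f' s \<bullet> \<alpha> s)
        - (M' s (\<alpha> s) \<bullet> \<alpha>' s + (M' s (\<alpha>' s) + M'' s (\<alpha> s)) \<bullet> \<alpha> s) = \<phi>2 s"
      using self_adjointD[OF sa(2), of s "\<alpha>' s" "\<alpha> s"] \<alpha>'(2)[OF s]
      by (simp add: \<phi>2_def inner_add inner_diff inner_commute)
    ultimately show ?thesis by simp
  qed

  define g where "g s = M s y \<bullet> y - l s - 2 * (f s \<bullet> y)" for s
  have contg: "continuous_on S g" for S
    unfolding g_def by (intro continuous_intros contM contl contf)
  define H where "H s = integral {a..s} g" for s
  have H_deriv: "(H has_real_derivative g s) (at s)" if "s \<in> J" for s
  proof -
    have "(H has_vector_derivative g s) (at s within {a..c})"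
      unfolding H_def using that ac by (intro integral_has_vector_derivative contg) auto
    then show ?thesis using that ac at_within_Icc_at[of a s c]
      by (auto simp: has_real_derivative_iff_has_vector_derivative)
  qed
  \<comment> \<open>The curvature inequality with \<open>\<alpha>\<close> in the direction of integration; its solution vector is
    \<open>y - \<alpha>'\<close> by the choice of \<open>\<alpha>\<close>.\<close>
  have key: "0 \<le> \<phi>2 s + g s" if s: "s \<in> J" for s
  proof -
    have "M s (y - \<alpha>' s) = p s + M' s (\<alpha> s)"
      using \<alpha>'(2)[OF s] by (simp add: blinfun.diff_right f_def)
    then have "l s + 2 * (p' s \<bullet> \<alpha> s) + M'' s (\<alpha> s) \<bullet> \<alpha> s \<le> M s (y - \<alpha>' s) \<bullet> (y - \<alpha>' s)"
      using s by (intro nak) (simp_all add: J_def)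
    also have "\<dots> = M s y \<bullet> y - 2 * (M s (\<alpha>' s) \<bullet> y) + M s (\<alpha>' s) \<bullet> \<alpha>' s"
      using self_adjointD[OF sa(1), of s "\<alpha>' s" y]
      by (simp add: blinfun.diff_right inner_diff inner_commute)
    finally have "l s + 2 * (p' s \<bullet> \<alpha> s) + M'' s (\<alpha> s) \<bullet> \<alpha> s
        \<le> M s y \<bullet> y - 2 * (M s (\<alpha>' s) \<bullet> y) + M s (\<alpha>' s) \<bullet> \<alpha>' s" .
    moreover have "0 \<le> M s (\<alpha>' s) \<bullet> \<alpha>' s"
      using pos[OF s, of "\<alpha>' s"] by (cases "\<alpha>' s = 0") (auto simp: less_imp_le)
    moreover have "M' s y \<bullet> \<alpha> s = M' s (\<alpha> s) \<bullet> y"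
      using self_adjointD[OF sa(2), of s y "\<alpha> s"] by (simp add: inner_commute)
    moreover have "M s (\<alpha>' s) \<bullet> y = f s \<bullet> y - M' s (\<alpha> s) \<bullet> y"
      using \<alpha>'(2)[OF s] by (simp add: inner_diff)
    ultimately show ?thesis by (simp add: \<phi>2_def g_def f'_def inner_diff)
  qed
  have mono: "\<phi>1 s + H s \<le> \<phi>1 t + H t" if "s \<in> J" "t \<in> J" "s < t" for s t
  proof (rule DERIV_nonneg_imp_nondecreasing[of s t "\<lambda>s. \<phi>1 s + H s"])
    fix x assume "s \<le> x" "x \<le> t"
    then have "x \<in> J" using that ac by auto
    then show "\<exists>y. ((\<lambda>s. \<phi>1 s + H s) has_real_derivative y) (at x) \<and> 0 \<le> y"
      using DERIV_add[OF \<phi>1_deriv H_deriv] key by blast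
  qed (use that in auto)

  \<comment> \<open>All quantities at a point are compared with the convex function \<open>h\<close>, which is of the order
    of the inverse of the norm of \<open>M\<close>.\<close>
  obtain e :: 'v where e: "norm e = 1" using vector_choose_size[of 1] by auto
  have "\<forall>s. \<exists>x. s \<in> J \<longrightarrow> M s x = e" using positive_definite_surj[OF pos] by metis
  then obtain v where v: "\<And>s. s \<in> J \<Longrightarrow> M s (v s) = e" by metis
  define h where "h s = v s \<bullet> e" for s
  have h_convex: "convex_on J h"
    unfolding h_def
  proof (rule inverse_form_convex[OF \<open>open J\<close> _ M M' sa pos _ v])
    show "M'' s w \<bullet> w \<le> M s y \<bullet> y" if "s \<in> J" "M s y = M' s w" for s w y
      using that by (intro curv) (auto simp: J_def)
    show "convex J" using ac by simp
  qed
  have Chm: "1 \<le> C * h s * norm (M s)" and mh: "norm (M s) * h s \<le> C" if s: "s \<in> J" for s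
  proof -
    have m: "0 < norm (M s)" using m_pos[OF s] .
    have le: "norm (M s) * (norm (v s))\<^sup>2 \<le> C * h s"
      using C[of s "v s"] v[OF s] by (simp add: h_def power2_norm_eq_inner inner_commute)
    have "1 \<le> norm (M s) * norm (v s)" using norm_blinfun[of "M s" "v s"] v[OF s] e by simp
    then have "1\<^sup>2 \<le> (norm (M s) * norm (v s))\<^sup>2" by (intro power_mono) auto
    also have "\<dots> = norm (M s) * (norm (M s) * (norm (v s))\<^sup>2)" by (simp add: power2_eq_square)
    also have "\<dots> \<le> norm (M s) * (C * h s)" using le m by (intro mult_left_mono) auto
    finally show "1 \<le> C * h s * norm (M s)" by (simp add: mult_ac)
    have hv: "h s \<le> norm (v s)" using norm_cauchy_schwarz[of "v s" e] e by (simp add: h_def)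
    have "norm (M s) * norm (v s) * norm (v s) \<le> C * norm (v s)"
      using le mult_left_mono[OF hv C0] by (simp add: power2_eq_square)
    moreover have "0 < norm (v s)" using v[OF s] e by (auto simp: blinfun.zero_right)
    ultimately have "norm (M s) * norm (v s) \<le> C" by simp
    then show "norm (M s) * h s \<le> C" using mult_left_mono[OF hv, of "norm (M s)"] by simp
  qed
  have h_pos: "0 < h s" if "s \<in> J" for s
    using Chm[OF that] C0 m_pos[OF that]
    by (smt (verit) mult_nonneg_nonneg mult_nonneg_nonpos mult_nonneg_nonpos2)
  obtain B where B: "\<And>s. s \<in> J \<Longrightarrow> norm (M s) \<le> B" "0 \<le> B"
  proof -
    have "bounded (M ` {a..c})" by (intro compact_imp_bounded compact_continuous_image contM) auto
    then obtain B where "\<forall>s\<in>{a..c}. norm (M s) \<le> B" by (auto simp: bounded_iff)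
    then have "norm (M s) \<le> max B 0" if "s \<in> J" for s using that ac by (force intro: max.coboundedI1)
    then show thesis by (rule that[of "max B 0"]) (assumption, rule max.cobounded2)
  qed
  define F where "F = 2 * B\<^sup>2 * (norm y)\<^sup>2 + 2 * Cp * B"
  define K where "K = 2 * B * C * (norm y)\<^sup>2 + 2 * Cp * C"
  have f_sq: "(norm (f s))\<^sup>2 \<le> 2 * (norm (M s))\<^sup>2 * (norm y)\<^sup>2 + 2 * Cp * norm (M s)" for s
  proof -
    have "norm (f s) \<le> norm (M s) * norm y + norm (p s)"
      unfolding f_def using norm_triangle_ineq4[of "M s y" "p s"] norm_blinfun[of "M s" y] by linarith
    then have "(norm (f s))\<^sup>2 \<le> (norm (M s) * norm y + norm (p s))\<^sup>2" by (intro power_mono) auto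
    also have "\<dots> \<le> 2 * (norm (M s) * norm y)\<^sup>2 + 2 * (norm (p s))\<^sup>2"
      using sum_squares_bound[of "norm (M s) * norm y" "norm (p s)"] by (simp add: power2_sum)
    also have "\<dots> \<le> 2 * (norm (M s))\<^sup>2 * (norm y)\<^sup>2 + 2 * Cp * norm (M s)"
      using pC[of s] by (simp add: power_mult_distrib)
    finally show ?thesis .
  qed
  have fF: "(norm (f s))\<^sup>2 \<le> F" if s: "s \<in> J" for s
  proof -
    have "2 * (norm (M s))\<^sup>2 * (norm y)\<^sup>2 \<le> 2 * B\<^sup>2 * (norm y)\<^sup>2"
      using B(1)[OF s] by (intro mult_right_mono mult_left_mono power_mono) auto
    moreover have "2 * Cp * norm (M s) \<le> 2 * Cp * B"
      using B(1)[OF s] Cp0 by (intro mult_left_mono) auto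
    ultimately show ?thesis using f_sq[of s] by (simp add: F_def)
  qed
  have fK: "(norm (f s))\<^sup>2 * h s \<le> K" if s: "s \<in> J" for s
  proof -
    have "(norm (f s))\<^sup>2 * h s \<le> (2 * (norm (M s))\<^sup>2 * (norm y)\<^sup>2 + 2 * Cp * norm (M s)) * h s"
      using f_sq h_pos[OF s] by (intro mult_right_mono) auto
    also have "\<dots> = 2 * (norm y)\<^sup>2 * (norm (M s) * (norm (M s) * h s)) + 2 * Cp * (norm (M s) * h s)"
      by (simp add: algebra_simps power2_eq_square)
    also have "\<dots> \<le> 2 * (norm y)\<^sup>2 * (B * C) + 2 * Cp * C"
      using mh[OF s] B(1)[OF s] B(2) Cp0 h_pos[OF s]
      by (intro add_mono mult_left_mono mult_mono) (auto intro: mult_nonneg_nonneg)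
    finally show ?thesis by (simp add: K_def mult_ac)
  qed
  define m where "m = (a + c) / 2"
  have m: "m \<in> J" "a < m" "m < c" using ac by (auto simp: m_def)
  define K2 where "K2 = max K (F * h m)"
  have K2: "0 \<le> K2"
    using fK[OF m(1)] h_pos[OF m(1)] unfolding K2_def
    by (smt (verit) mult_nonneg_nonneg zero_le_power2)
  \<comment> \<open>Convexity of \<open>h\<close> carries the bound from a point near an end of the interval to the points between
    it and the middle; integration bounds \<open>\<beta>\<close> by \<open>sqrt (K2 / h s)\<close> times the distance to that end.\<close>
  have between: "norm (f t) \<le> sqrt (K2 / h s)"
    if st: "s \<in> J" "t \<in> J" "t \<le> s \<and> s \<le> m \<or> m \<le> s \<and> s \<le> t" for s t
  proof -
    have "s \<in> closed_segment t m" using st(3) by (auto simp: closed_segment_eq_real_ivl)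
    then have "h s \<le> max (h t) (h m)"
    proof -
      obtain r where r: "0 \<le> r" "r \<le> 1" "s = (1 - r) *\<^sub>R t + r *\<^sub>R m"
        using \<open>s \<in> closed_segment t m\<close> by (auto simp: in_segment)
      have "h s \<le> (1 - r) * h t + r * h m"
        unfolding r(3) using h_convex st(2) m(1) r by (intro convex_onD) auto
      also have "\<dots> \<le> max (h t) (h m)" using r by (intro convex_bound_le) auto
      finally show ?thesis .
    qed
    then have "(norm (f t))\<^sup>2 * h s \<le> (norm (f t))\<^sup>2 * max (h t) (h m)" by (intro mult_left_mono) auto
    also have "\<dots> \<le> K2"
    proof -
      have "(norm (f t))\<^sup>2 * h m \<le> F * h m"
        using fF[OF st(2)] h_pos[OF m(1)] by (intro mult_right_mono) auto
      then show ?thesis using fK[OF st(2)] by (auto simp: max_def K2_def)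
    qed
    finally have "(norm (f t))\<^sup>2 \<le> K2 / h s" using h_pos[OF st(1)] by (simp add: field_simps)
    then show ?thesis by (rule real_le_rsqrt)
  qed
  have \<phi>_nonneg: "0 \<le> \<phi> s" if s: "s \<in> J" for s
    using pos[OF s, of "\<alpha> s"] \<alpha>[OF s] by (cases "\<alpha> s = 0") (auto simp: \<phi>_def less_imp_le)
  have \<phi>_le: "\<phi> s \<le> C\<^sup>2 * K2 * d\<^sup>2" if s: "s \<in> J" and d: "0 \<le> d" "norm (\<beta> s) \<le> sqrt (K2 / h s) * d" for s d
  proof -
    have m': "0 < norm (M s)" using m_pos[OF s] .
    have \<phi>1: "\<phi> s \<le> norm (\<beta> s) * norm (\<alpha> s)" unfolding \<phi>_def by (rule norm_cauchy_schwarz)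
    have "norm (M s) * (norm (\<alpha> s))\<^sup>2 \<le> C * \<phi> s"
      using C[of s "\<alpha> s"] \<alpha>[OF s] by (simp add: \<phi>_def power2_norm_eq_inner)
    also have "\<dots> \<le> C * (norm (\<beta> s) * norm (\<alpha> s))" using \<phi>1 C0 by (rule mult_left_mono)
    finally have "(norm (M s) * norm (\<alpha> s)) * norm (\<alpha> s) \<le> (C * norm (\<beta> s)) * norm (\<alpha> s)"
      by (simp add: power2_eq_square mult_ac)
    then have a\<beta>: "norm (M s) * norm (\<alpha> s) \<le> C * norm (\<beta> s)"
      using C0 by (cases "\<alpha> s = 0") auto
    have "\<phi> s \<le> \<phi> s * (C * h s * norm (M s))"
      using Chm[OF s] \<phi>_nonneg[OF s] mult_left_mono[of 1 "C * h s * norm (M s)" "\<phi> s"] by simp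
    also have "\<dots> \<le> (norm (\<beta> s) * norm (\<alpha> s)) * (C * h s * norm (M s))"
      using \<phi>1 C0 h_pos[OF s] by (intro mult_right_mono) auto
    also have "\<dots> = C * h s * norm (\<beta> s) * (norm (M s) * norm (\<alpha> s))" by (simp add: mult_ac)
    also have "\<dots> \<le> C * h s * norm (\<beta> s) * (C * norm (\<beta> s))"
      using a\<beta> C0 h_pos[OF s] by (intro mult_left_mono) auto
    also have "\<dots> = C\<^sup>2 * (h s * (norm (\<beta> s))\<^sup>2)" by (simp add: power2_eq_square mult_ac)
    also have "\<dots> \<le> C\<^sup>2 * (h s * (sqrt (K2 / h s) * d)\<^sup>2)"
      using d h_pos[OF s] by (intro mult_left_mono power_mono) auto
    also have "\<dots> = C\<^sup>2 * K2 * d\<^sup>2" using K2 h_pos[OF s] by (simp add: power_mult_distrib)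
    finally show ?thesis .
  qed
  have ends: "\<exists>k. \<forall>s\<in>J. 0 \<le> \<phi> s \<and> (s \<le> (a + c) / 2 \<longrightarrow> \<phi> s \<le> k * (s - a)\<^sup>2) \<and>
      ((a + c) / 2 \<le> s \<longrightarrow> \<phi> s \<le> k * (c - s)\<^sup>2)"
  proof (intro exI[of _ "C\<^sup>2 * K2"] ballI conjI impI \<phi>_nonneg)
    fix s assume s: "s \<in> J" "s \<le> (a + c) / 2"
    have "norm (integral {a..s} f) \<le> sqrt (K2 / h s) * (s - a)"
      using s ac K2 h_pos[OF s(1)]
      by (intro norm_integral_le_const contf between) (auto simp: m_def)
    then show "\<phi> s \<le> C\<^sup>2 * K2 * (s - a)\<^sup>2" using s ac by (intro \<phi>_le) (auto simp: \<beta>_def)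
  next
    fix s assume s: "s \<in> J" "(a + c) / 2 \<le> s"
    have "integral {a..s} f + integral {s..c} f = 0"
      using s ac intf by (subst Henstock_Kurzweil_Integration.integral_combine)
        (auto intro!: integrable_continuous_real contf)
    then have "norm (\<beta> s) = norm (integral {s..c} f)"
      by (simp add: \<beta>_def add_eq_0_iff)
    also have "\<dots> \<le> sqrt (K2 / h s) * (c - s)"
      using s ac K2 h_pos[OF s(1)]
      by (intro norm_integral_le_const contf between) (auto simp: m_def)
    finally show "\<phi> s \<le> C\<^sup>2 * K2 * (c - s)\<^sup>2" using s ac by (intro \<phi>_le) auto
  qed
  then obtain k where k: "\<And>s. s \<in> J \<Longrightarrow> 0 \<le> \<phi> s"
    "\<And>s. s \<in> J \<Longrightarrow> s \<le> (a + c) / 2 \<Longrightarrow> \<phi> s \<le> k * (s - a)\<^sup>2"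
    "\<And>s. s \<in> J \<Longrightarrow> (a + c) / 2 \<le> s \<Longrightarrow> \<phi> s \<le> k * (c - s)\<^sup>2" by blast
  have left: "\<exists>s. a < s \<and> s < d \<and> 0 \<le> \<phi>1 s" if "a < d" "d \<le> (a + c) / 2" for d
    using that ac by (intro deriv_nonneg_near_zero[where f = \<phi> and k = k] \<phi>_deriv k) auto
  have right: "\<exists>s. d < s \<and> s < c \<and> \<phi>1 s \<le> 0" if "d < c" "(a + c) / 2 \<le> d" for d
    using that ac by (intro deriv_nonpos_near_zero[where f = \<phi> and k = k] \<phi>_deriv k) auto

  \<comment> \<open>Monotonicity is applied between points where \<open>\<phi>1\<close> has the favourable signs, arbitrarily close to
    the two ends.\<close>
  have Hc: "0 \<le> H c"
  proof (rule ccontr)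
    assume neg: "\<not> 0 \<le> H c"
    have contH: "continuous_on {a..c} H"
      unfolding H_def using contg by (intro indefinite_integral_continuous_1 integrable_continuous_real)
    have "(H \<longlongrightarrow> H a) (at a within {a..c})" "(H \<longlongrightarrow> H c) (at c within {a..c})"
      using contH ac(1) by (auto simp: continuous_on_def)
    then have lim: "(H \<longlongrightarrow> 0) (at_right a)" "(H \<longlongrightarrow> H c) (at_left c)"
      using ac(1) by (simp_all add: at_within_Icc_at_right at_within_Icc_at_left H_def)
    have "\<forall>\<^sub>F s in at_right a. H c / 2 < H s" using neg by (intro order_tendstoD(1)[OF lim(1)]) auto
    then obtain d1 where d1: "a < d1" "\<And>s. a < s \<Longrightarrow> s < d1 \<Longrightarrow> H c / 2 < H s"
      by (auto simp: eventually_at_right_field)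
    have "\<forall>\<^sub>F s in at_left c. H s < H c / 2" using neg by (intro order_tendstoD(2)[OF lim(2)]) auto
    then obtain d2 where d2: "d2 < c" "\<And>s. d2 < s \<Longrightarrow> s < c \<Longrightarrow> H s < H c / 2"
      by (auto simp: eventually_at_left_field)
    obtain s where s: "a < s" "s < min d1 ((a + c) / 2)" "0 \<le> \<phi>1 s"
    proof -
      have "a < min d1 ((a + c) / 2)" using d1(1) ac(1) by simp
      from left[OF this min.cobounded2] show thesis using that by blast
    qed
    obtain t where t: "max d2 ((a + c) / 2) < t" "t < c" "\<phi>1 t \<le> 0"
    proof -
      have "max d2 ((a + c) / 2) < c" using d2(1) ac(1) by simp
      from right[OF this max.cobounded2] show thesis using that by blast
    qed
    have "\<phi>1 s + H s \<le> \<phi>1 t + H t" using s t ac by (intro mono) auto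
    then show False using d1(2)[of s] d2(2)[of t] s t by auto
  qed
  have "H c = integral {a..c} (\<lambda>s. M s y \<bullet> y) - integral {a..c} l - 2 * integral {a..c} (\<lambda>s. f s \<bullet> y)"
    unfolding H_def g_def
    by (subst integral_diff integral_mult_right,
        (intro integrable_continuous_real continuous_intros contM contl contf)+)+ simp
  also have "integral {a..c} (\<lambda>s. f s \<bullet> y) = 0"
    using integral_linear[OF integrable_continuous_real[OF contf] bounded_linear_inner_left[of y], of a c] intf
    by (simp add: o_def)
  also have "integral {a..c} l = integral {-R..R} l"
    using l zero by (intro int_eq[symmetric]) auto
  also have "integral {a..c} (\<lambda>s. M s y \<bullet> y) = integral {-R..R} (\<lambda>s. M s y \<bullet> y)"
    by (intro int_eq[symmetric] continuous_intros contM) auto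
  also have "integral {-R..R} (\<lambda>s. M s y \<bullet> y) = (integral {-R..R} M) y \<bullet> y"
    using integral_linear[OF intM, of "\<lambda>A. A y \<bullet> y"]
    by (simp add: o_def bounded_linear_compose[OF bounded_linear_inner_left blinfun.bounded_linear_left])
  finally show ?thesis using Hc by simp
qed

section \<open>Integration along one direction\<close>

text \<open>
  The properties that survive integration along a coordinate direction; \<open>S\<close> is the set of those
  coordinate directions in which the support is bounded. The operators are uniformly pinched, so that
  all quantities can be compared with the norm of \<open>G\<close>, and the derivatives vanish wherever \<open>G\<close> does,
  so that the boundary of the support contributes nothing to integrals of second derivatives.
\<close>

definition nakano_density ::
    "'a::euclidean_space set \<Rightarrow> ('a \<Rightarrow> 'v::euclidean_space \<Rightarrow>\<^sub>L 'v) \<Rightarrow> ('a \<Rightarrow> 'a \<Rightarrow> 'v \<Rightarrow>\<^sub>L 'v) \<Rightarrow>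
      ('a \<Rightarrow> 'a \<Rightarrow> 'a \<Rightarrow> 'v \<Rightarrow>\<^sub>L 'v) \<Rightarrow> bool"
  where "nakano_density S G D DD \<longleftrightarrow>
    C2 UNIV G D DD \<and> (\<forall>z. self_adjoint (G z)) \<and>
    (\<exists>C\<ge>0. \<forall>z v. norm (G z) * (v \<bullet> v) \<le> C * (G z v \<bullet> v)) \<and>
    (\<forall>h k. \<exists>B. \<forall>z. norm (DD z h k) \<le> B) \<and>
    convex {z. G z \<noteq> 0} \<and>
    (\<forall>z. G z \<noteq> 0 \<longrightarrow> nakano (G z) (D z) (DD z)) \<and>
    (\<forall>z h k. G z = 0 \<longrightarrow> D z h = 0 \<and> DD z h k = 0) \<and>
    (\<exists>R. \<forall>z. G z \<noteq> 0 \<longrightarrow> (\<forall>b\<in>S. \<bar>z \<bullet> b\<bar> < R))"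

lemma C1_self_adjoint:
  fixes G :: "'a::real_normed_vector \<Rightarrow> 'v::euclidean_space \<Rightarrow>\<^sub>L 'v"
  assumes "C1 U G D" "open U" "\<And>z. z \<in> U \<Longrightarrow> self_adjoint (G z)" "z \<in> U"
  shows "self_adjoint (D z h)"
  unfolding self_adjoint_def
proof (intro allI)
  fix u v :: 'v
  have bl: "bounded_linear (\<lambda>A. blinfun_apply A u \<bullet> v - u \<bullet> A v)"
    by (intro bounded_linear_sub bounded_linear_compose[OF bounded_linear_inner_left]
        bounded_linear_compose[OF bounded_linear_inner_right] blinfun.bounded_linear_left)
  have "((\<lambda>z. G z u \<bullet> v - u \<bullet> G z v) has_derivative (\<lambda>h. D z h u \<bullet> v - u \<bullet> D z h v)) (at z)"
    using bounded_linear.has_derivative[OF bl, of G "D z" "at z"] assms by (auto simp: C1_def)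
  then have "((\<lambda>z. 0) has_derivative (\<lambda>h. D z h u \<bullet> v - u \<bullet> D z h v)) (at z)"
    by (rule has_derivative_transform_within_open[OF _ assms(2,4)])
       (use assms(3) in \<open>auto simp: self_adjoint_def\<close>)
  from has_derivative_unique[OF this has_derivative_const]
  have "D z h u \<bullet> v - u \<bullet> D z h v = 0" by (rule fun_cong)
  then show "D z h u \<bullet> v = u \<bullet> D z h v" by simp
qed

lemma C2_self_adjoint:
  fixes G :: "'a::real_normed_vector \<Rightarrow> 'v::euclidean_space \<Rightarrow>\<^sub>L 'v"
  assumes "C2 U G D DD" "open U" "\<And>z. z \<in> U \<Longrightarrow> self_adjoint (G z)" "z \<in> U"
  shows "self_adjoint (D z h)" "self_adjoint (DD z k h)"
proof -
  have *: "self_adjoint (D z h)" if "z \<in> U" for z h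
    using C1_self_adjoint[OF _ assms(2,3) that] assms(1) by (auto simp: C2_def)
  then show "self_adjoint (D z h)" using assms(4) .
  have "C1 U (\<lambda>z. D z h) (\<lambda>z k. DD z k h)" using assms(1) by (auto simp: C2_def)
  then show "self_adjoint (DD z k h)" by (rule C1_self_adjoint) (use assms * in auto)
qed

text \<open>
  The Taylor bound \<open>f s + f' s (t - s) + B (t - s)\<^sup>2 / 2\<close> is an upper bound for a nonnegative function,
  hence nonnegative at its minimum point \<open>t\<close>.
\<close>

lemma deriv_square_le:
  fixes f :: "real \<Rightarrow> real"
  assumes d: "\<And>s. DERIV f s :> f' s" "\<And>s. DERIV f' s :> f'' s"
    and f: "\<And>s. 0 \<le> f s" and B: "0 < B" "\<And>s. f'' s \<le> B"
  shows "(f' s)\<^sup>2 \<le> 2 * B * f s"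
proof -
  define t where "t = s - f' s / B"
  have "(B * s - f' s) * (t - s) \<le> (B * t\<^sup>2 / 2 - f t) - (B * s\<^sup>2 / 2 - f s)"
  proof (rule f''_imp_f'[where C = UNIV and f = "\<lambda>t. B * t\<^sup>2 / 2 - f t" and f' = "\<lambda>t. B * t - f' t"
        and f'' = "\<lambda>t. B - f'' t"])
    fix x
    show "((\<lambda>t. B * t\<^sup>2 / 2 - f t) has_real_derivative B * x - f' x) (at x)"
      by (auto intro!: derivative_eq_intros d(1))
    show "((\<lambda>t. B * t - f' t) has_real_derivative B - f'' x) (at x)"
      by (auto intro!: derivative_eq_intros d(2))
  qed (use B in auto)
  then have "f t \<le> f s + f' s * (t - s) + B / 2 * (t - s)\<^sup>2"
    by (simp add: power2_eq_square algebra_simps)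
  also have "\<dots> = f s - (f' s)\<^sup>2 / (2 * B)"
    using B(1) by (simp add: t_def power2_eq_square field_simps)
  finally have "(f' s)\<^sup>2 / (2 * B) \<le> f s" using f[of t] by linarith
  then show ?thesis using B(1) by (simp add: field_simps)
qed

lemma nakano_density_psd:
  fixes G :: "'a::euclidean_space \<Rightarrow> 'v::euclidean_space \<Rightarrow>\<^sub>L 'v"
  assumes "nakano_density S G D DD"
  shows "0 \<le> G z v \<bullet> v"
proof (cases "G z = 0 \<or> v = 0")
  case False
  obtain C where C: "0 \<le> C" "\<And>z v. norm (G z) * (v \<bullet> v) \<le> C * (G z v \<bullet> v)"
    using assms by (auto simp: nakano_density_def)
  have "0 < norm (G z) * (v \<bullet> v)" using False by simp
  then have "0 < C * (G z v \<bullet> v)" using C(2)[of z v] by linarith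
  then show ?thesis using C(1) by (simp add: zero_less_mult_iff)
qed (auto simp: blinfun.zero_right)

text \<open>
  Applied to the quadratic forms of \<open>G\<close>, \<open>deriv_square_le\<close> gives the square root. The bound
  controls the solution field of the one-variable estimate near the boundary of the support.
\<close>

lemma nakano_density_gradient_bound:
  fixes G :: "'a::euclidean_space \<Rightarrow> 'v::euclidean_space \<Rightarrow>\<^sub>L 'v"
  assumes "nakano_density S G D DD"
  obtains c where "0 \<le> c" "\<And>z. norm (D z h) \<le> c * sqrt (norm (G z))"
proof -
  have C2: "C2 UNIV G D DD" and sa: "\<And>z. self_adjoint (G z)" using assms by (auto simp: nakano_density_def)
  have "\<exists>B. \<forall>z. norm (DD z h h) \<le> B" using assms by (auto simp: nakano_density_def)
  then obtain B0 where B0: "\<And>z. norm (DD z h h) \<le> B0" by blast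
  define B where "B = max B0 1"
  have B: "0 < B" "\<And>z. norm (DD z h h) \<le> B" using B0 by (auto simp: B_def max.coboundedI1)
  note psd = nakano_density_psd[OF assms]
  have "norm (D z h) \<le> sqrt (2 * B) * sqrt (norm (G z))" for z
  proof (rule norm_self_adjoint_le)
    show "self_adjoint (D z h)" using C2_self_adjoint(1)[OF C2 open_UNIV sa] by simp
    fix v :: 'v
    have bl: "bounded_linear (\<lambda>A. blinfun_apply A v \<bullet> v)"
      by (intro bounded_linear_compose[OF bounded_linear_inner_left] blinfun.bounded_linear_left)
    have C2': "C1 UNIV (\<lambda>z. G z v \<bullet> v) (\<lambda>z h. D z h v \<bullet> v)" "C1 UNIV (\<lambda>z. D z h v \<bullet> v) (\<lambda>z k. DD z k h v \<bullet> v)"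
      using C2_bounded_linear[OF bl C2] by (auto simp: C2_def)
    show "\<bar>D z h v \<bullet> v\<bar> \<le> sqrt (2 * B) * sqrt (norm (G z)) * (v \<bullet> v)"
    proof (cases "v = 0")
      case False
      have "(D (z + 0 *\<^sub>R h) h v \<bullet> v)\<^sup>2 \<le> 2 * (B * (v \<bullet> v)) * (G (z + 0 *\<^sub>R h) v \<bullet> v)"
      proof (rule deriv_square_le[where f = "\<lambda>s. G (z + s *\<^sub>R h) v \<bullet> v" and f' = "\<lambda>s. D (z + s *\<^sub>R h) h v \<bullet> v"
            and f'' = "\<lambda>s. DD (z + s *\<^sub>R h) h h v \<bullet> v"])
        fix s
        have "DD (z + s *\<^sub>R h) h h v \<bullet> v \<le> norm (DD (z + s *\<^sub>R h) h h v) * norm v" by (rule norm_cauchy_schwarz)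
        also have "\<dots> \<le> (B * norm v) * norm v"
          by (intro mult_right_mono order_trans[OF norm_blinfun] B) auto
        finally show "DD (z + s *\<^sub>R h) h h v \<bullet> v \<le> B * (v \<bullet> v)"
          by (simp add: power2_norm_eq_inner[symmetric] power2_eq_square mult_ac)
      qed (use C1_line[OF C2'(1), of z _ h] C1_line[OF C2'(2), of z _ h] psd B(1) False
          in \<open>auto simp: has_real_derivative_iff_has_vector_derivative\<close>)
      also have "\<dots> \<le> 2 * (B * (v \<bullet> v)) * (norm (G z) * (v \<bullet> v))"
      proof (intro mult_left_mono)
        have "G z v \<bullet> v \<le> norm (G z v) * norm v" by (rule norm_cauchy_schwarz)
        also have "\<dots> \<le> (norm (G z) * norm v) * norm v" by (intro mult_right_mono norm_blinfun) auto
        finally show "G (z + 0 *\<^sub>R h) v \<bullet> v \<le> norm (G z) * (v \<bullet> v)"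
          by (simp add: power2_norm_eq_inner[symmetric] power2_eq_square mult_ac)
      qed (use B(1) in auto)
      also have "\<dots> = (sqrt (2 * B) * sqrt (norm (G z)) * (v \<bullet> v))\<^sup>2"
        using B(1) by (simp add: power_mult_distrib power2_eq_square[of "v \<bullet> v"])
      finally have "\<bar>D z h v \<bullet> v\<bar>\<^sup>2 \<le> (sqrt (2 * B) * sqrt (norm (G z)) * (v \<bullet> v))\<^sup>2"
        by simp
      then show ?thesis by (rule power2_le_imp_le) (use B(1) in simp)
    qed (simp add: blinfun.zero_right)
  qed (use B(1) in auto)
  then show thesis using that[of "sqrt (2 * B)"] B(1) by auto
qed

text \<open>
  The one-variable estimate on the line through \<open>w0\<close> in direction \<open>b\<close>. The curvature inequality is
  used for the given vectors in the remaining directions and the vector \<open>w\<close>, which the estimate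
  is free to choose, in direction \<open>b\<close>.
\<close>

lemma marginal_estimate:
  fixes G :: "'a::euclidean_space \<Rightarrow> 'v::euclidean_space \<Rightarrow>\<^sub>L 'v"
  assumes dens: "nakano_density S G D DD" and b: "b \<in> Basis"
    and R: "\<And>s. G (w0 + s *\<^sub>R b) \<noteq> 0 \<Longrightarrow> \<bar>s\<bar> < R"
    and eq: "integral {-R..R} (\<lambda>s. G (w0 + s *\<^sub>R b)) y
      = integral {-R..R} (\<lambda>s. \<Sum>j\<in>Basis - {b}. D (w0 + s *\<^sub>R b) j (u j))"
  shows "integral {-R..R} (\<lambda>s. \<Sum>j\<in>Basis - {b}. \<Sum>k\<in>Basis - {b}. DD (w0 + s *\<^sub>R b) j k (u j) \<bullet> u k)
     \<le> integral {-R..R} (\<lambda>s. G (w0 + s *\<^sub>R b)) y \<bullet> y"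
proof -
  let ?N = "Basis - {b}"
  have C2: "C2 UNIV G D DD" and sa: "\<And>z. self_adjoint (G z)" using dens by (auto simp: nakano_density_def)
  have C1: "C1 UNIV G D" "\<And>h. C1 UNIV (\<lambda>z. D z h) (\<lambda>z k. DD z k h)" using C2 by (auto simp: C2_def)
  note saD = C2_self_adjoint[OF C2 open_UNIV sa UNIV_I]
  obtain C where C: "0 \<le> C" "\<And>z v. norm (G z) * (v \<bullet> v) \<le> C * (G z v \<bullet> v)"
    using dens by (auto simp: nakano_density_def)
  have nak: "nakano (G z) (D z) (DD z)" if "G z \<noteq> 0" for z using dens that by (auto simp: nakano_density_def)
  have contDD: "continuous_on X (\<lambda>s. DD (w0 + s *\<^sub>R b) h k)" for X h k
  proof -
    have "continuous_on UNIV (\<lambda>z. DD z h k)" using C1(2)[of k] by (simp add: C1_def)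
    moreover have "continuous_on X (\<lambda>s. w0 + s *\<^sub>R b)" by (intro continuous_intros)
    ultimately show ?thesis by (rule continuous_on_compose2) simp
  qed
  have "\<exists>c. 0 \<le> c \<and> (\<forall>z. norm (D z j) \<le> c * sqrt (norm (G z)))" for j
    by (rule nakano_density_gradient_bound[OF dens, of j]) blast
  then obtain c where c: "\<And>j. 0 \<le> c j" "\<And>j z. norm (D z j) \<le> c j * sqrt (norm (G z))" by metis
  have split: "(\<Sum>j\<in>Basis. F j) = F b + (\<Sum>j\<in>?N. F j)" for F :: "'a \<Rightarrow> 'z::comm_monoid_add"
    using b by (simp add: sum.remove)
  show ?thesis
  proof (rule one_variable_estimate[where M = "\<lambda>s. G (w0 + s *\<^sub>R b)" and M' = "\<lambda>s. D (w0 + s *\<^sub>R b) b"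
        and M'' = "\<lambda>s. DD (w0 + s *\<^sub>R b) b b" and p = "\<lambda>s. \<Sum>j\<in>?N. D (w0 + s *\<^sub>R b) j (u j)"
        and p' = "\<lambda>s. \<Sum>j\<in>?N. DD (w0 + s *\<^sub>R b) b j (u j)" and C = C
        and Cp = "(\<Sum>j\<in>?N. c j * norm (u j))\<^sup>2"])
    fix s
    show "((\<lambda>s. G (w0 + s *\<^sub>R b)) has_vector_derivative D (w0 + s *\<^sub>R b) b) (at s)"
      using C1(1) by (rule C1_line) simp
    show "((\<lambda>s. D (w0 + s *\<^sub>R b) b) has_vector_derivative DD (w0 + s *\<^sub>R b) b b) (at s)"
      using C1(2) by (rule C1_line) simp
    show "((\<lambda>s. \<Sum>j\<in>?N. D (w0 + s *\<^sub>R b) j (u j)) has_vector_derivative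
        (\<Sum>j\<in>?N. DD (w0 + s *\<^sub>R b) b j (u j))) (at s)"
      by (intro has_vector_derivative_sum bounded_linear.has_vector_derivative[OF blinfun.bounded_linear_left]
          C1_line[OF C1(2)]) simp
    show "self_adjoint (G (w0 + s *\<^sub>R b))" "self_adjoint (D (w0 + s *\<^sub>R b) b)" by (fact sa saD)+
    show "norm (G (w0 + s *\<^sub>R b)) * (v \<bullet> v) \<le> C * (G (w0 + s *\<^sub>R b) v \<bullet> v)" for v by (rule C)
    show "(norm (\<Sum>j\<in>?N. D (w0 + s *\<^sub>R b) j (u j)))\<^sup>2 \<le> (\<Sum>j\<in>?N. c j * norm (u j))\<^sup>2 * norm (G (w0 + s *\<^sub>R b))"
    proof -
      have "norm (\<Sum>j\<in>?N. D (w0 + s *\<^sub>R b) j (u j)) \<le> (\<Sum>j\<in>?N. c j * sqrt (norm (G (w0 + s *\<^sub>R b))) * norm (u j))"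
        by (intro sum_norm_le order_trans[OF norm_blinfun] mult_right_mono c) auto
      also have "\<dots> = (\<Sum>j\<in>?N. c j * norm (u j)) * sqrt (norm (G (w0 + s *\<^sub>R b)))"
        unfolding sum_distrib_right by (intro sum.cong refl) simp
      finally have "(norm (\<Sum>j\<in>?N. D (w0 + s *\<^sub>R b) j (u j)))\<^sup>2
          \<le> ((\<Sum>j\<in>?N. c j * norm (u j)) * sqrt (norm (G (w0 + s *\<^sub>R b))))\<^sup>2"
        by (intro power_mono) auto
      then show ?thesis by (simp add: power_mult_distrib)
    qed
    show "(\<Sum>j\<in>?N. D (w0 + s *\<^sub>R b) j (u j)) = 0 \<and>
        (\<Sum>j\<in>?N. \<Sum>k\<in>?N. DD (w0 + s *\<^sub>R b) j k (u j) \<bullet> u k) = 0" if "G (w0 + s *\<^sub>R b) = 0"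
      using dens that by (auto simp: nakano_density_def)
    show "DD (w0 + s *\<^sub>R b) b b w \<bullet> w \<le> G (w0 + s *\<^sub>R b) Y \<bullet> Y"
      if "G (w0 + s *\<^sub>R b) \<noteq> 0" "G (w0 + s *\<^sub>R b) Y = D (w0 + s *\<^sub>R b) b w" for w Y
      using nakano_direction[OF nak[OF that(1)] b that(2)] .
    fix w Y
    let ?z = "w0 + s *\<^sub>R b"
    assume G: "G ?z \<noteq> 0" and Y: "G ?z Y = (\<Sum>j\<in>?N. D ?z j (u j)) + D ?z b w"
    let ?u = "\<lambda>j. if j = b then w else u j"
    have "G ?z Y = (\<Sum>j\<in>Basis. D ?z j (?u j))"
      unfolding split[of "\<lambda>j. D ?z j (?u j)"] Y by (simp add: add.commute)
    from nakanoD[OF nak[OF G] this]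
    have "(\<Sum>j\<in>Basis. \<Sum>k\<in>Basis. DD ?z j k (?u j) \<bullet> ?u k) \<le> G ?z Y \<bullet> Y" .
    also have "(\<Sum>j\<in>Basis. \<Sum>k\<in>Basis. DD ?z j k (?u j) \<bullet> ?u k)
      = (DD ?z b b w \<bullet> w + (\<Sum>k\<in>?N. DD ?z b k w \<bullet> u k))
        + (\<Sum>j\<in>?N. DD ?z j b (u j) \<bullet> w + (\<Sum>k\<in>?N. DD ?z j k (u j) \<bullet> u k))"
      by (simp add: split)
    also have "(\<Sum>k\<in>?N. DD ?z b k w \<bullet> u k) = (\<Sum>j\<in>?N. DD ?z b j (u j)) \<bullet> w"
      by (simp add: inner_sum_left self_adjointD[OF saD(2), of _ _ _ w] inner_commute[of w])
    also have "(\<Sum>j\<in>?N. DD ?z j b (u j) \<bullet> w + (\<Sum>k\<in>?N. DD ?z j k (u j) \<bullet> u k))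
       = (\<Sum>j\<in>?N. DD ?z b j (u j)) \<bullet> w + (\<Sum>j\<in>?N. \<Sum>k\<in>?N. DD ?z j k (u j) \<bullet> u k)"
      by (simp add: inner_sum_left sum.distrib C2_symmetric_blinfun[OF C2 open_UNIV UNIV_I, of _ b])
    finally show "(\<Sum>j\<in>?N. \<Sum>k\<in>?N. DD ?z j k (u j) \<bullet> u k) + 2 * ((\<Sum>j\<in>?N. DD ?z b j (u j)) \<bullet> w)
        + DD ?z b b w \<bullet> w \<le> G ?z Y \<bullet> Y" by simp
  next
    show "continuous_on UNIV (\<lambda>s. \<Sum>j\<in>?N. \<Sum>k\<in>?N. DD (w0 + s *\<^sub>R b) j k (u j) \<bullet> u k)"
      by (intro continuous_intros contDD)
    have "{s. G (w0 + s *\<^sub>R b) \<noteq> 0} = (\<lambda>s. w0 + s *\<^sub>R b) -` {z. G z \<noteq> 0}" by auto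
    also have "convex \<dots>"
    proof -
      have "convex ((\<lambda>s. s *\<^sub>R b) -` ((\<lambda>x. - w0 + x) ` {z. G z \<noteq> 0}))"
        using dens by (intro convex_linear_vimage convex_translation) (auto simp: nakano_density_def intro: linear_scaleR_left)
      also have "(\<lambda>s. s *\<^sub>R b) -` ((\<lambda>x. - w0 + x) ` {z. G z \<noteq> 0}) = (\<lambda>s. w0 + s *\<^sub>R b) -` {z. G z \<noteq> 0}"
        by (force simp: image_iff algebra_simps)
      finally show ?thesis .
    qed
    finally show "convex {s. G (w0 + s *\<^sub>R b) \<noteq> 0}" .
  qed (use R C eq in auto)
qed


definition drop_coord :: "'a::euclidean_space \<Rightarrow> 'a \<Rightarrow> 'a"
  where "drop_coord b z = z - (z \<bullet> b) *\<^sub>R b"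

lemma bounded_linear_drop_coord: "bounded_linear (drop_coord b)"
  unfolding drop_coord_def
  by (intro bounded_linear_sub bounded_linear_ident bounded_linear_compose[OF bounded_linear_scaleR_left]
      bounded_linear_inner_left)

lemma drop_coord_Basis:
  "b \<in> Basis \<Longrightarrow> j \<in> Basis \<Longrightarrow> drop_coord b j = (if j = b then 0 else j)"
  by (auto simp: drop_coord_def inner_Basis)

text \<open>
  The marginal is kept as a function on the same space which does not depend on the coordinate that
  has been integrated out. Hence it can be integrated in the next direction by the same lemma.
\<close>

lemma marginal_density:
  fixes G :: "'a::euclidean_space \<Rightarrow> 'v::euclidean_space \<Rightarrow>\<^sub>L 'v"
  assumes dens: "nakano_density S G D DD" and b: "b \<in> S" "b \<in> Basis"
    and R0: "0 < R" and R: "\<And>z. G z \<noteq> 0 \<Longrightarrow> \<bar>z \<bullet> b\<bar> < R"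
  shows "nakano_density (S \<inter> Basis - {b})
    (\<lambda>z. integral {-R..R} (\<lambda>s. G (drop_coord b z + s *\<^sub>R b)))
    (\<lambda>z h. integral {-R..R} (\<lambda>s. D (drop_coord b z + s *\<^sub>R b) (drop_coord b h)))
    (\<lambda>z h k. integral {-R..R} (\<lambda>s. DD (drop_coord b z + s *\<^sub>R b) (drop_coord b h) (drop_coord b k)))"
proof -
  let ?L = "drop_coord b"
  define M where "M z s = G (?L z + s *\<^sub>R b)" for z s
  define G1 where "G1 z = integral {-R..R} (M z)" for z
  define D1 where "D1 z h = integral {-R..R} (\<lambda>s. D (?L z + s *\<^sub>R b) (?L h))" for z h
  define DD1 where "DD1 z h k = integral {-R..R} (\<lambda>s. DD (?L z + s *\<^sub>R b) (?L h) (?L k))" for z h k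
  interpret L: bounded_linear ?L by (rule bounded_linear_drop_coord)
  have C2: "C2 UNIV G D DD" and sa: "\<And>z. self_adjoint (G z)" using dens by (auto simp: nakano_density_def)
  have C1: "C1 UNIV G D" "\<And>h. C1 UNIV (\<lambda>z. D z h) (\<lambda>z k. DD z k h)" using C2 by (auto simp: C2_def)
  have C2': "C2 UNIV G1 D1 DD1"
    unfolding G1_def D1_def DD1_def M_def by (rule C2_line_integral[OF C2 bounded_linear_drop_coord])
  obtain C where C: "0 \<le> C" "\<And>z v. norm (G z) * (v \<bullet> v) \<le> C * (G z v \<bullet> v)"
    using dens by (auto simp: nakano_density_def)
  note psd = nakano_density_psd[OF dens]
  have Lb: "(?L z + s *\<^sub>R b) \<bullet> b = s" for z s
    using b by (simp add: drop_coord_def inner_add inner_diff)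
  have Lb': "(?L z + s *\<^sub>R b) \<bullet> b' = z \<bullet> b'" if "b' \<in> Basis - {b}" for z s b'
    using b that by (auto simp: drop_coord_def inner_add inner_diff inner_Basis)
  have line: "continuous_on X (\<lambda>s. ?L z + s *\<^sub>R b)" for X z by (intro continuous_intros)
  have contM: "continuous_on X (M z)" for X z
    unfolding M_def by (rule continuous_on_compose2[OF C1_cont[OF C1(1)] line]) simp
  have contD: "continuous_on X (\<lambda>s. D (?L z + s *\<^sub>R b) h)" for X z h
    by (rule continuous_on_compose2[OF C1_cont[OF C1(2)] line]) simp
  have contDD: "continuous_on X (\<lambda>s. DD (?L z + s *\<^sub>R b) h k)" for X z h k
  proof -
    have "continuous_on UNIV (\<lambda>z. DD z h k)" using C1(2)[of k] by (simp add: C1_def)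
    then show ?thesis by (rule continuous_on_compose2[OF _ line]) simp
  qed
  have apply_int: "integral {-R..R} F v = integral {-R..R} (\<lambda>s. F s v)"
    if "continuous_on {-R..R} F" for F :: "real \<Rightarrow> 'v \<Rightarrow>\<^sub>L 'v" and v
    using integral_linear[OF integrable_continuous_real[OF that] blinfun.bounded_linear_left[of v]]
    by (simp add: o_def)
  have inner_int: "integral {-R..R} F \<bullet> w = integral {-R..R} (\<lambda>s. F s \<bullet> w)"
    if "continuous_on {-R..R} F" for F :: "real \<Rightarrow> 'v" and w
    using integral_linear[OF integrable_continuous_real[OF that] bounded_linear_inner_left[of w]]
    by (simp add: o_def)
  have form: "integral {-R..R} F v \<bullet> w = integral {-R..R} (\<lambda>s. F s v \<bullet> w)"
    if "continuous_on {-R..R} F" for F :: "real \<Rightarrow> 'v \<Rightarrow>\<^sub>L 'v" and v w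
    using that by (simp add: apply_int inner_int continuous_intros)
  have sa': "self_adjoint (G1 z)" for z
    unfolding self_adjoint_def G1_def
  proof (intro allI)
    fix u v
    have "integral {-R..R} (M z) u \<bullet> v = integral {-R..R} (M z) v \<bullet> u"
      unfolding form[OF contM] M_def
      by (intro integral_cong) (metis self_adjointD[OF sa] inner_commute)
    then show "integral {-R..R} (M z) u \<bullet> v = u \<bullet> integral {-R..R} (M z) v" by (simp add: inner_commute)
  qed
  have pinch: "norm (G1 z) * (v \<bullet> v) \<le> C * (G1 z v \<bullet> v)" for z v
  proof -
    have "norm (G1 z) \<le> integral {-R..R} (\<lambda>s. norm (M z s))"
      unfolding G1_def
      by (intro integral_norm_bound_integral integrable_continuous_real contM continuous_intros) auto
    then have "norm (G1 z) * (v \<bullet> v) \<le> integral {-R..R} (\<lambda>s. norm (M z s)) * (v \<bullet> v)"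
      by (rule mult_right_mono) simp
    also have "\<dots> = integral {-R..R} (\<lambda>s. norm (M z s) * (v \<bullet> v))" by simp
    also have "\<dots> \<le> integral {-R..R} (\<lambda>s. C * (M z s v \<bullet> v))"
      by (intro integral_le integrable_continuous_real contM continuous_intros) (auto simp: M_def C)
    also have "\<dots> = C * (G1 z v \<bullet> v)" unfolding G1_def form[OF contM] by simp
    finally show ?thesis .
  qed
  have M0: "M z s = 0" if z: "G1 z = 0" for z s
  proof (rule ccontr)
    assume ne: "M z s \<noteq> 0"
    then have s: "s \<in> {-R..R}" using R[of "?L z + s *\<^sub>R b"] Lb[of z s] by (auto simp: M_def)
    obtain e :: 'v where e: "norm e = 1" using vector_choose_size[of 1] by auto
    have "((\<lambda>s. M z s e \<bullet> e) has_integral integral {-R..R} (\<lambda>s. M z s e \<bullet> e)) (cbox (-R) R)"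
      unfolding cbox_interval
      by (intro integrable_integral integrable_continuous_real continuous_intros contM)
    also have "integral {-R..R} (\<lambda>s. M z s e \<bullet> e) = 0"
      using form[OF contM, of z e e] z by (simp add: G1_def)
    finally have "M z s e \<bullet> e = 0"
      using s R0 psd
      by (intro has_integral_0_cbox_imp_0[of "-R" R "\<lambda>s. M z s e \<bullet> e"] continuous_intros contM)
         (auto simp: M_def)
    then show False using C(2)[of "?L z + s *\<^sub>R b" e] e ne by (simp add: M_def norm_eq_1)
  qed
  have zero: "D1 z h = 0" "DD1 z h k = 0" if "G1 z = 0" for z h k
  proof -
    have "D (?L z + s *\<^sub>R b) h = 0" "DD (?L z + s *\<^sub>R b) h k = 0" for s h k
      using M0[OF that, of s] dens by (auto simp: M_def nakano_density_def)
    then show "D1 z h = 0" "DD1 z h k = 0" by (simp_all add: D1_def DD1_def)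
  qed
  have G1_ne: "G1 z \<noteq> 0 \<longleftrightarrow> (\<exists>s. M z s \<noteq> 0)" for z
  proof
    assume "G1 z \<noteq> 0"
    moreover have "G1 z = integral {-R..R} (\<lambda>s. 0)" if "\<And>s. M z s = 0"
      unfolding G1_def by (intro integral_cong) (simp add: that)
    ultimately show "\<exists>s. M z s \<noteq> 0" by auto
  qed (use M0 in auto)
  have conv: "convex {z. G1 z \<noteq> 0}"
  proof (rule convexI)
    fix z1 z2 and a c :: real
    assume z: "z1 \<in> {z. G1 z \<noteq> 0}" "z2 \<in> {z. G1 z \<noteq> 0}" and ac: "0 \<le> a" "0 \<le> c" "a + c = 1"
    then obtain s1 s2 where "?L z1 + s1 *\<^sub>R b \<in> {z. G z \<noteq> 0}" "?L z2 + s2 *\<^sub>R b \<in> {z. G z \<noteq> 0}"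
      by (auto simp: G1_ne M_def)
    moreover have "convex {z. G z \<noteq> 0}" using dens by (auto simp: nakano_density_def)
    ultimately have "a *\<^sub>R (?L z1 + s1 *\<^sub>R b) + c *\<^sub>R (?L z2 + s2 *\<^sub>R b) \<in> {z. G z \<noteq> 0}"
      using ac by (auto simp only: convex_def)
    moreover have "a *\<^sub>R (?L z1 + s1 *\<^sub>R b) + c *\<^sub>R (?L z2 + s2 *\<^sub>R b)
        = ?L (a *\<^sub>R z1 + c *\<^sub>R z2) + (a * s1 + c * s2) *\<^sub>R b"
      by (simp add: L.add L.scaleR algebra_simps)
    ultimately have "M (a *\<^sub>R z1 + c *\<^sub>R z2) (a * s1 + c * s2) \<noteq> 0" by (simp add: M_def)
    then show "a *\<^sub>R z1 + c *\<^sub>R z2 \<in> {z. G1 z \<noteq> 0}" by (auto simp: G1_ne)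
  qed
  have bdd: "\<exists>B. \<forall>z. norm (DD1 z h k) \<le> B" for h k
  proof -
    have "\<exists>B. \<forall>z. norm (DD z (?L h) (?L k)) \<le> B" using dens by (auto simp: nakano_density_def)
    then obtain B where "\<And>z. norm (DD z (?L h) (?L k)) \<le> B" by blast
    then have "norm (DD1 z h k) \<le> B * (R - (-R))" for z
      unfolding DD1_def using R0 by (intro integral_bound contDD) auto
    then show ?thesis by blast
  qed
  have nak: "nakano (G1 z) (D1 z) (DD1 z)" if "G1 z \<noteq> 0" for z
    unfolding nakano_def
  proof (intro allI impI)
    fix u :: "'a \<Rightarrow> 'v" and y
    let ?N = "Basis - {b}"
    assume eq: "G1 z y = (\<Sum>j\<in>Basis. D1 z j (u j))"
    have Lj: "j \<in> ?N \<Longrightarrow> ?L j = j" for j using b by (simp add: drop_coord_Basis)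
    have Lb0: "?L b = 0" using b by (simp add: drop_coord_Basis)
    have lin0: "D w 0 = 0" "DD w 0 k = 0" "DD w h 0 = 0" for w h k
    proof -
      show "D w 0 = 0" using linear_simps(3)[OF C1_linear[OF C1(1)]] by simp
      show "DD w 0 k = 0" using linear_simps(3)[OF C1_linear[OF C1(2)]] by simp
      show "DD w h 0 = 0"
        using linear_simps(3)[OF C1_linear[OF C1(2)], of w h] C2_symmetric_blinfun[OF C2 open_UNIV UNIV_I, of w h 0]
        by simp
    qed
    have N: "(\<Sum>j\<in>Basis. F j) = (\<Sum>j\<in>?N. F j)" if "F b = 0" for F :: "'a \<Rightarrow> 'z::comm_monoid_add"
      using b that by (simp add: sum.remove)
    have "(\<Sum>j\<in>Basis. D1 z j (u j)) = (\<Sum>j\<in>?N. integral {-R..R} (\<lambda>s. D (?L z + s *\<^sub>R b) j (u j)))"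
      by (subst N) (auto simp: D1_def Lb0 lin0 Lj apply_int contD intro!: sum.cong)
    also have "\<dots> = integral {-R..R} (\<lambda>s. \<Sum>j\<in>?N. D (?L z + s *\<^sub>R b) j (u j))"
      by (intro integral_sum[symmetric] integrable_continuous_real continuous_intros contD) auto
    finally have eq': "integral {-R..R} (\<lambda>s. G (?L z + s *\<^sub>R b)) y
        = integral {-R..R} (\<lambda>s. \<Sum>j\<in>?N. D (?L z + s *\<^sub>R b) j (u j))"
      using eq by (simp add: G1_def M_def[abs_def])
    have "(\<Sum>j\<in>Basis. \<Sum>k\<in>Basis. DD1 z j k (u j) \<bullet> u k)
        = (\<Sum>j\<in>?N. \<Sum>k\<in>?N. DD1 z j k (u j) \<bullet> u k)"
    proof -
      have 0: "DD1 z b k = 0" "DD1 z j b = 0" for j k by (simp_all add: DD1_def Lb0 lin0)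
      have "(\<Sum>k\<in>Basis. DD1 z j k (u j) \<bullet> u k) = (\<Sum>k\<in>?N. DD1 z j k (u j) \<bullet> u k)" for j
        by (rule N) (simp add: 0)
      moreover have "(\<Sum>j\<in>Basis. \<Sum>k\<in>?N. DD1 z j k (u j) \<bullet> u k) = (\<Sum>j\<in>?N. \<Sum>k\<in>?N. DD1 z j k (u j) \<bullet> u k)"
        by (rule N) (simp add: 0)
      ultimately show ?thesis by simp
    qed
    also have "\<dots> = (\<Sum>j\<in>?N. \<Sum>k\<in>?N. integral {-R..R} (\<lambda>s. DD (?L z + s *\<^sub>R b) j k (u j) \<bullet> u k))"
      by (auto simp: DD1_def Lj form contDD intro!: sum.cong)
    also have "\<dots> = integral {-R..R} (\<lambda>s. \<Sum>j\<in>?N. \<Sum>k\<in>?N. DD (?L z + s *\<^sub>R b) j k (u j) \<bullet> u k)"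
      by (simp add: integral_sum integrable_continuous_real continuous_intros contDD)
    also have "\<dots> \<le> integral {-R..R} (\<lambda>s. G (?L z + s *\<^sub>R b)) y \<bullet> y"
    proof (rule marginal_estimate[OF dens b(2) _ eq'])
      fix s assume "G (?L z + s *\<^sub>R b) \<noteq> 0"
      from R[OF this] show "\<bar>s\<bar> < R" by (simp add: Lb)
    qed
    also have "\<dots> = G1 z y \<bullet> y" by (simp add: G1_def M_def[abs_def])
    finally show "(\<Sum>j\<in>Basis. \<Sum>k\<in>Basis. DD1 z j k (u j) \<bullet> u k) \<le> G1 z y \<bullet> y" .
  qed
  have supp: "\<exists>R. \<forall>z. G1 z \<noteq> 0 \<longrightarrow> (\<forall>b'\<in>S \<inter> Basis - {b}. \<bar>z \<bullet> b'\<bar> < R)"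
  proof -
    have "\<exists>R. \<forall>z. G z \<noteq> 0 \<longrightarrow> (\<forall>b\<in>S. \<bar>z \<bullet> b\<bar> < R)"
      using dens by (simp add: nakano_density_def)
    then obtain R' where R': "\<And>z b. G z \<noteq> 0 \<Longrightarrow> b \<in> S \<Longrightarrow> \<bar>z \<bullet> b\<bar> < R'" by blast
    have "\<bar>z \<bullet> b'\<bar> < R'" if z: "G1 z \<noteq> 0" "b' \<in> S \<inter> Basis - {b}" for z b'
    proof -
      obtain s where "M z s \<noteq> 0" using z(1) by (auto simp: G1_ne)
      then have "\<bar>(?L z + s *\<^sub>R b) \<bullet> b'\<bar> < R'" using z(2) by (intro R') (auto simp: M_def)
      then show ?thesis using z(2) by (simp add: Lb')
    qed
    then show ?thesis by blast
  qed
  have "nakano_density (S \<inter> Basis - {b}) G1 D1 DD1"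
    unfolding nakano_density_def
  proof (intro conjI allI impI)
    show "\<exists>C\<ge>0. \<forall>z v. norm (G1 z) * (v \<bullet> v) \<le> C * (G1 z v \<bullet> v)" using C(1) pinch by blast
  qed (fact C2' sa' bdd conv supp | erule nak zero)+
  then show ?thesis by (simp add: G1_def[abs_def] D1_def[abs_def] DD1_def[abs_def] M_def[abs_def])
qed

text \<open>
  By Tonelli's theorem and translation invariance, every point is counted with the measure of those
  translates which lie in a slab of unit width, and this measure is \<open>1\<close>.
\<close>

lemma nn_integral_slab:
  fixes f :: "'b::euclidean_space \<Rightarrow> ennreal"
  assumes f[measurable]: "f \<in> borel_measurable borel" and b: "b \<in> Basis"
  shows "(\<integral>\<^sup>+x. f x \<partial>lborel)
    = (\<integral>\<^sup>+x. (\<integral>\<^sup>+s. f (drop_coord b x + s *\<^sub>R b) \<partial>lborel) * indicator {0..1} (x \<bullet> b) \<partial>lborel)"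
proof -
  have bb: "b \<bullet> b = 1" using b by simp
  have inner: "(\<integral>\<^sup>+s. f (drop_coord b x + s *\<^sub>R b) \<partial>lborel) = (\<integral>\<^sup>+r. f (x + r *\<^sub>R b) \<partial>lborel)" for x
  proof -
    have "(\<integral>\<^sup>+s. f (drop_coord b x + s *\<^sub>R b) \<partial>lborel)
        = (\<integral>\<^sup>+s. f (drop_coord b x + s *\<^sub>R b) \<partial>distr lborel borel ((+) (x \<bullet> b)))"
      by (simp only: lborel_distr_plus)
    also have "\<dots> = (\<integral>\<^sup>+r. f (drop_coord b x + (x \<bullet> b + r) *\<^sub>R b) \<partial>lborel)"
      by (subst nn_integral_distr) auto
    finally show ?thesis by (simp add: drop_coord_def algebra_simps)
  qed
  have shift: "(\<integral>\<^sup>+x. f (x + r *\<^sub>R b) * indicator {0..1} (x \<bullet> b) \<partial>lborel)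
      = (\<integral>\<^sup>+x. f x * indicator {0..1} (x \<bullet> b - r) \<partial>lborel)" for r
  proof -
    have "(\<integral>\<^sup>+x. f x * indicator {0..1} (x \<bullet> b - r) \<partial>lborel)
        = (\<integral>\<^sup>+x. f x * indicator {0..1} (x \<bullet> b - r) \<partial>distr lborel borel ((+) (r *\<^sub>R b)))"
      by (simp only: lborel_distr_plus)
    also have "\<dots> = (\<integral>\<^sup>+x. f (r *\<^sub>R b + x) * indicator {0..1} ((r *\<^sub>R b + x) \<bullet> b - r) \<partial>lborel)"
      by (subst nn_integral_distr) auto
    finally show ?thesis by (simp add: inner_add_left bb add.commute)
  qed
  have unit: "(\<integral>\<^sup>+r. indicator {0..1} (c - r) \<partial>lborel) = (1 :: ennreal)" for c :: real
  proof -
    have "(\<integral>\<^sup>+r. indicator {0..1} (c - r) \<partial>lborel) = (\<integral>\<^sup>+r. indicator {c-1..c} r \<partial>lborel)"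
      by (intro nn_integral_cong) (auto simp: indicator_def)
    then show ?thesis by simp
  qed
  have "(\<integral>\<^sup>+x. (\<integral>\<^sup>+s. f (drop_coord b x + s *\<^sub>R b) \<partial>lborel) * indicator {0..1} (x \<bullet> b) \<partial>lborel)
      = (\<integral>\<^sup>+x. (\<integral>\<^sup>+r. f (x + r *\<^sub>R b) * indicator {0..1} (x \<bullet> b) \<partial>lborel) \<partial>lborel)"
    by (simp add: inner nn_integral_multc)
  also have "\<dots> = (\<integral>\<^sup>+r. (\<integral>\<^sup>+x. f (x + r *\<^sub>R b) * indicator {0..1} (x \<bullet> b) \<partial>lborel) \<partial>lborel)"
    by (rule lborel_pair.Fubini'[symmetric]) measurable
  also have "\<dots> = (\<integral>\<^sup>+r. (\<integral>\<^sup>+x. f x * indicator {0..1} (x \<bullet> b - r) \<partial>lborel) \<partial>lborel)"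
    by (simp only: shift)
  also have "\<dots> = (\<integral>\<^sup>+x. (\<integral>\<^sup>+r. f x * indicator {0..1} (x \<bullet> b - r) \<partial>lborel) \<partial>lborel)"
    by (rule lborel_pair.Fubini') measurable
  also have "\<dots> = (\<integral>\<^sup>+x. f x \<partial>lborel)"
    by (simp add: nn_integral_cmult unit)
  finally show ?thesis by simp
qed

lemma nn_integral_interval:
  fixes f :: "real \<Rightarrow> real"
  assumes "continuous_on UNIV f" "\<And>s. 0 \<le> f s" "\<And>s. s \<notin> {-R..R} \<Longrightarrow> f s = 0"
  shows "(\<integral>\<^sup>+s. ennreal (f s) \<partial>lborel) = ennreal (integral {-R..R} f)"
proof (rule nn_integral_has_integral_lborel)
  show "f \<in> borel_measurable borel" using assms(1) by (rule borel_measurable_continuous_onI)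
  have "f integrable_on {-R..R}"
    using assms(1) by (intro integrable_continuous_real) (auto intro: continuous_on_subset)
  then show "(f has_integral integral {-R..R} f) UNIV"
    using assms(3) by (intro has_integral_on_superset[OF integrable_integral]) auto
qed (use assms in auto)

text \<open>
  The fibre is integrated one coordinate at a time. Quadratic forms are nonnegative, so Tonelli's
  theorem applies; the coordinates already integrated are restricted to the unit interval, because
  the marginal does not depend on them.
\<close>

lemma iterated_marginal:
  fixes G :: "'a::euclidean_space \<times> 'b::euclidean_space \<Rightarrow> 'v::euclidean_space \<Rightarrow>\<^sub>L 'v"
  assumes dens: "nakano_density ({0} \<times> Basis) G D DD" and "finite T" "T \<subseteq> (Basis :: 'b set)"
  shows "\<exists>G1 D1 DD1. nakano_density ({0} \<times> (Basis - T)) G1 D1 DD1 \<and>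
    (\<forall>b\<in>T. \<forall>z r. G1 (z + r *\<^sub>R (0, b)) = G1 z) \<and>
    (\<forall>t u. (\<integral>\<^sup>+x. ennreal (G (t, x) u \<bullet> u) \<partial>lborel)
      = (\<integral>\<^sup>+x. ennreal (G1 (t, x) u \<bullet> u) * indicator {x. \<forall>b\<in>T. 0 \<le> x \<bullet> b \<and> x \<bullet> b \<le> 1} x \<partial>lborel))"
  using assms(2,3)
proof (induction T rule: finite_induct)
  case empty
  show ?case by (rule exI[of _ G], rule exI[of _ D], rule exI[of _ DD]) (use dens in simp)
next
  case (insert b T)
  then obtain G1 D1 DD1 where IH: "nakano_density ({0} \<times> (Basis - T)) G1 D1 DD1"
    "\<And>b z r. b \<in> T \<Longrightarrow> G1 (z + r *\<^sub>R (0, b)) = G1 z"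
    "\<And>t u. (\<integral>\<^sup>+x. ennreal (G (t, x) u \<bullet> u) \<partial>lborel)
      = (\<integral>\<^sup>+x. ennreal (G1 (t, x) u \<bullet> u) * indicator {x. \<forall>b\<in>T. 0 \<le> x \<bullet> b \<and> x \<bullet> b \<le> 1} x \<partial>lborel)"
    by auto
  have b: "b \<in> Basis" "b \<notin> T" using insert by auto
  let ?b = "(0 :: 'a, b)"
  have bB: "?b \<in> {0} \<times> (Basis - T)" "?b \<in> Basis" using b by (auto simp: Basis_prod_def)
  have "\<exists>R. \<forall>z. G1 z \<noteq> 0 \<longrightarrow> (\<forall>b\<in>{0} \<times> (Basis - T). \<bar>z \<bullet> b\<bar> < R)"
    using IH(1) by (simp add: nakano_density_def)
  then obtain R0 where "\<And>z. G1 z \<noteq> 0 \<Longrightarrow> \<bar>z \<bullet> ?b\<bar> < R0" using bB by blast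
  then have R: "\<And>z. G1 z \<noteq> 0 \<Longrightarrow> \<bar>z \<bullet> ?b\<bar> < max R0 1" by (meson less_max_iff_disj)
  define R where "R = max R0 1"
  have R: "0 < R" "\<And>z. G1 z \<noteq> 0 \<Longrightarrow> \<bar>z \<bullet> ?b\<bar> < R" using R by (auto simp: R_def)
  define G2 where "G2 z = integral {-R..R} (\<lambda>s. G1 (drop_coord ?b z + s *\<^sub>R ?b))" for z
  obtain D2 DD2 where "nakano_density ({0} \<times> (Basis - T) \<inter> Basis - {?b}) G2 D2 DD2"
    using marginal_density[OF IH(1) bB R] unfolding G2_def by blast
  moreover have "({0} \<times> (Basis - T)) \<inter> Basis - {?b} = {0} \<times> (Basis - insert b T)"
    by (auto simp: Basis_prod_def)
  ultimately have dens2: "nakano_density ({0} \<times> (Basis - insert b T)) G2 D2 DD2" by simp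
  have inv: "G2 (z + r *\<^sub>R (0, b')) = G2 z" if "b' \<in> insert b T" for b' z r
  proof (cases "b' = b")
    case True
    then have "drop_coord ?b (z + r *\<^sub>R (0, b')) = drop_coord ?b z"
      using b by (simp add: drop_coord_def inner_add algebra_simps)
    then show ?thesis by (simp only: G2_def)
  next
    case False
    then have b': "b' \<in> T" using that by simp
    then have "b' \<bullet> b = 0" using False b insert.prems by (auto simp: inner_Basis)
    then have "drop_coord ?b (z + r *\<^sub>R (0, b')) + s *\<^sub>R ?b = (drop_coord ?b z + s *\<^sub>R ?b) + r *\<^sub>R (0, b')" for s
      by (simp add: drop_coord_def inner_add algebra_simps)
    then show ?thesis by (simp only: G2_def IH(2)[OF b'])
  qed
  have C1: "C1 UNIV G1 D1" using IH(1) by (auto simp: nakano_density_def C2_def)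
  note psd = nakano_density_psd[OF IH(1)]
  have int: "(\<integral>\<^sup>+x. ennreal (G (t, x) u \<bullet> u) \<partial>lborel)
      = (\<integral>\<^sup>+x. ennreal (G2 (t, x) u \<bullet> u) * indicator {x. \<forall>b\<in>insert b T. 0 \<le> x \<bullet> b \<and> x \<bullet> b \<le> 1} x \<partial>lborel)" for t u
  proof -
    let ?A = "{x. \<forall>b\<in>T. 0 \<le> x \<bullet> b \<and> x \<bullet> b \<le> 1}"
    have dc: "(t, drop_coord b x + s *\<^sub>R b) = drop_coord ?b (t, x) + s *\<^sub>R ?b" for x s
      by (simp add: drop_coord_def)
    have "closed (\<Inter>b\<in>T. {x. 0 \<le> x \<bullet> b} \<inter> {x. x \<bullet> b \<le> 1})"
      by (intro closed_INT ballI closed_Int closed_Collect_le continuous_intros)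
    also have "(\<Inter>b\<in>T. {x. 0 \<le> x \<bullet> b} \<inter> {x. x \<bullet> b \<le> 1}) = ?A" by auto
    finally have "closed ?A" .
    then have [measurable]: "?A \<in> sets borel" by (rule borel_closed)
    have [measurable]: "(\<lambda>x. G1 (t, x) u \<bullet> u) \<in> borel_measurable borel"
      by (intro borel_measurable_continuous_onI continuous_intros
          continuous_on_compose2[OF C1_cont[OF C1], of UNIV "\<lambda>x. (t, x)"]) auto
    have A: "indicator ?A (drop_coord b x + s *\<^sub>R b) = (indicator ?A x :: ennreal)" for x s
    proof -
      have "(drop_coord b x + s *\<^sub>R b) \<bullet> b' = x \<bullet> b'" if "b' \<in> T" for b'
        using that b insert.prems by (auto simp: drop_coord_def inner_add inner_diff inner_Basis)
      then show ?thesis by (simp add: indicator_def)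
    qed
    have one: "(\<integral>\<^sup>+s. ennreal (G1 (drop_coord ?b (t, x) + s *\<^sub>R ?b) u \<bullet> u) \<partial>lborel) = ennreal (G2 (t, x) u \<bullet> u)" for x
    proof -
      have line: "continuous_on X (\<lambda>s. drop_coord ?b (t, x) + s *\<^sub>R ?b)" for X by (intro continuous_intros)
      have cont: "continuous_on X (\<lambda>s. G1 (drop_coord ?b (t, x) + s *\<^sub>R ?b))" for X
        by (rule continuous_on_compose2[OF C1_cont[OF C1] line]) simp
      have "(\<integral>\<^sup>+s. ennreal (G1 (drop_coord ?b (t, x) + s *\<^sub>R ?b) u \<bullet> u) \<partial>lborel)
          = ennreal (integral {-R..R} (\<lambda>s. G1 (drop_coord ?b (t, x) + s *\<^sub>R ?b) u \<bullet> u))"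
      proof (rule nn_integral_interval)
        fix s assume s: "s \<notin> {-R..R}"
        have "(drop_coord ?b (t, x) + s *\<^sub>R ?b) \<bullet> ?b = s"
          using bB by (simp add: drop_coord_def inner_add inner_diff)
        then have "G1 (drop_coord ?b (t, x) + s *\<^sub>R ?b) = 0"
          using R(2)[of "drop_coord ?b (t, x) + s *\<^sub>R ?b"] s by fastforce
        then show "G1 (drop_coord ?b (t, x) + s *\<^sub>R ?b) u \<bullet> u = 0" by simp
      qed (intro continuous_intros cont psd)+
      also have "integral {-R..R} (\<lambda>s. G1 (drop_coord ?b (t, x) + s *\<^sub>R ?b) u \<bullet> u) = G2 (t, x) u \<bullet> u"
      proof -
        have bl: "bounded_linear (\<lambda>A. blinfun_apply A u \<bullet> u)"
          by (intro bounded_linear_compose[OF bounded_linear_inner_left] blinfun.bounded_linear_left)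
        show ?thesis
          using integral_linear[OF integrable_continuous_real[OF cont] bl, of "-R" R] by (simp add: o_def G2_def)
      qed
      finally show ?thesis .
    qed
    have "(\<integral>\<^sup>+x. ennreal (G (t, x) u \<bullet> u) \<partial>lborel)
        = (\<integral>\<^sup>+x. (\<integral>\<^sup>+s. ennreal (G1 (t, drop_coord b x + s *\<^sub>R b) u \<bullet> u) * indicator ?A (drop_coord b x + s *\<^sub>R b) \<partial>lborel)
            * indicator {0..1} (x \<bullet> b) \<partial>lborel)"
      unfolding IH(3) by (rule nn_integral_slab) (use b in measurable)
    also have "\<dots> = (\<integral>\<^sup>+x. (\<integral>\<^sup>+s. ennreal (G1 (t, drop_coord b x + s *\<^sub>R b) u \<bullet> u) \<partial>lborel) * indicator ?A x
            * indicator {0..1} (x \<bullet> b) \<partial>lborel)"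
      unfolding A by (subst nn_integral_multc) (auto simp: drop_coord_def)
    also have "\<dots> = (\<integral>\<^sup>+x. ennreal (G2 (t, x) u \<bullet> u) * indicator {x. \<forall>b\<in>insert b T. 0 \<le> x \<bullet> b \<and> x \<bullet> b \<le> 1} x \<partial>lborel)"
      unfolding dc one by (intro nn_integral_cong) (auto simp: indicator_def)
    finally show ?thesis .
  qed
  show ?case using dens2 inv int by blast
qed

lemma full_marginal:
  fixes G :: "'a::euclidean_space \<times> 'b::euclidean_space \<Rightarrow> 'v::euclidean_space \<Rightarrow>\<^sub>L 'v"
  assumes dens: "nakano_density ({0} \<times> Basis) G D DD"
  obtains G1 :: "'a \<times> 'b \<Rightarrow> 'v \<Rightarrow>\<^sub>L 'v" and D1 DD1 where "nakano_density {} G1 D1 DD1"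
    "\<And>t x. G1 (t, x) = G1 (t, 0)"
    "\<And>t u. (\<integral>\<^sup>+x. ennreal (G (t, x) u \<bullet> u) \<partial>lborel) = ennreal (G1 (t, 0) u \<bullet> u)"
proof -
  obtain G1 D1 DD1 where *: "nakano_density ({0} \<times> (Basis - Basis)) G1 D1 DD1"
    "\<And>b z r. b \<in> Basis \<Longrightarrow> G1 (z + r *\<^sub>R (0, b)) = G1 z"
    "\<And>t u. (\<integral>\<^sup>+x. ennreal (G (t, x) u \<bullet> u) \<partial>lborel)
      = (\<integral>\<^sup>+x. ennreal (G1 (t, x) u \<bullet> u) * indicator {x :: 'b. \<forall>b\<in>Basis. 0 \<le> x \<bullet> b \<and> x \<bullet> b \<le> 1} x \<partial>lborel)"
    using iterated_marginal[OF dens finite_Basis order_refl] by blast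
  have inv: "G1 (t, x) = G1 (t, 0)" for t x
  proof -
    have "G1 (t, \<Sum>b\<in>T. (x \<bullet> b) *\<^sub>R b) = G1 (t, 0)" if "finite T" "T \<subseteq> Basis" for T
      using that
    proof (induction T rule: finite_induct)
      case (insert b T)
      have "(t, \<Sum>b\<in>insert b T. (x \<bullet> b) *\<^sub>R b) = (t, \<Sum>b\<in>T. (x \<bullet> b) *\<^sub>R b) + (x \<bullet> b) *\<^sub>R (0, b)"
        using insert by (simp add: add.commute)
      moreover have "b \<in> Basis" "T \<subseteq> Basis" using insert.prems by auto
      ultimately show ?case using insert.IH by (simp only: *(2))
    qed simp
    from this[OF finite_Basis order_refl] show ?thesis by (simp add: euclidean_representation)
  qed
  have box: "{x :: 'b. \<forall>b\<in>Basis. 0 \<le> x \<bullet> b \<and> x \<bullet> b \<le> 1} = cbox 0 One"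
    by (auto simp: mem_box)
  have vol: "emeasure lborel (cbox 0 One :: 'b set) = 1"
    by (subst emeasure_lborel_cbox) auto
  have int: "(\<integral>\<^sup>+x. ennreal (G (t, x) u \<bullet> u) \<partial>lborel) = ennreal (G1 (t, 0) u \<bullet> u)" for t u
  proof -
    have "(\<integral>\<^sup>+x. ennreal (G (t, x) u \<bullet> u) \<partial>lborel)
        = (\<integral>\<^sup>+x. ennreal (G1 (t, 0) u \<bullet> u) * indicator (cbox 0 (One :: 'b)) x \<partial>lborel)"
      unfolding *(3) box
    proof (rule nn_integral_cong)
      fix x :: 'b
      show "ennreal (G1 (t, x) u \<bullet> u) * indicator (cbox 0 One) x
          = ennreal (G1 (t, 0) u \<bullet> u) * indicator (cbox 0 One) x"
        by (simp only: inv[of t x])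
    qed
    then show ?thesis by (simp add: nn_integral_cmult_indicator vol)
  qed
  have "nakano_density {} G1 D1 DD1" using *(1) by simp
  then show thesis using inv int by (rule that)
qed

section \<open>Smooth cutoffs of convex sets\<close>

definition cutoff_prod :: "('a::euclidean_space \<times> real) set \<Rightarrow> 'a \<Rightarrow> real"
  where "cutoff_prod L z = (\<Prod>(n, c)\<in>L. cutoff (c + n \<bullet> z))"

lemma cutoff_prod_range: "0 \<le> cutoff_prod L z" "cutoff_prod L z \<le> 1"
  by (auto simp: cutoff_prod_def cutoff_nonneg cutoff_le_1 intro!: prod_nonneg prod_le_1)

lemma cutoff_prod_nonzero_iff:
  assumes "finite L"
  shows "cutoff_prod L z \<noteq> 0 \<longleftrightarrow> (\<forall>(n, c)\<in>L. 0 < c + n \<bullet> z)"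
proof -
  have "cutoff s \<noteq> 0 \<longleftrightarrow> 0 < s" for s
    using cutoff_pos[of s] cutoff_eq_0(1)[of s] by (cases "0 < s") auto
  then show ?thesis using assms by (auto simp: cutoff_prod_def)
qed

lemma cutoff_prod_insert:
  "finite L \<Longrightarrow> (n, c) \<notin> L \<Longrightarrow> cutoff_prod (insert (n, c) L) z = cutoff (c + n \<bullet> z) * cutoff_prod L z"
  by (simp add: cutoff_prod_def)

text \<open>
  A factor that vanishes has vanishing first and second derivatives. Hence the derivatives of the
  truncated metric vanish wherever the metric does, even at boundary points of the support.
\<close>

lemma nakano_cutoff_prod:
  fixes G :: "'a::euclidean_space \<Rightarrow> 'v::euclidean_space \<Rightarrow>\<^sub>L 'v"
  assumes C2: "C2 U G D DD" "open U" and sa: "\<And>z. z \<in> U \<Longrightarrow> self_adjoint (G z)"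
    and psd: "\<And>z v. z \<in> U \<Longrightarrow> 0 \<le> G z v \<bullet> v"
    and nak: "\<And>z. z \<in> U \<Longrightarrow> nakano (G z) (D z) (DD z)"
    and L: "finite L"
  shows "\<exists>D1 DD1. C2 U (\<lambda>z. cutoff_prod L z *\<^sub>R G z) D1 DD1 \<and>
    (\<forall>z\<in>U. cutoff_prod L z \<noteq> 0 \<longrightarrow> nakano (cutoff_prod L z *\<^sub>R G z) (D1 z) (DD1 z)) \<and>
    (\<forall>z\<in>U. \<forall>h k. cutoff_prod L z = 0 \<longrightarrow> D1 z h = 0 \<and> DD1 z h k = 0)"
  using L
proof (induction L rule: finite_induct)
  case empty
  show ?case using C2(1) nak by (intro exI[of _ D] exI[of _ DD]) (simp add: cutoff_prod_def)
next
  case (insert p L)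
  obtain n c where p: "p = (n, c)" by (cases p)
  obtain D1 DD1 where IH: "C2 U (\<lambda>z. cutoff_prod L z *\<^sub>R G z) D1 DD1"
    "\<And>z. z \<in> U \<Longrightarrow> cutoff_prod L z \<noteq> 0 \<Longrightarrow> nakano (cutoff_prod L z *\<^sub>R G z) (D1 z) (DD1 z)"
    "\<And>z h k. z \<in> U \<Longrightarrow> cutoff_prod L z = 0 \<Longrightarrow> D1 z h = 0 \<and> DD1 z h k = 0"
    using insert.IH by blast
  let ?r = "\<lambda>z. cutoff (c + n \<bullet> z)" and ?r1 = "\<lambda>z. cutoff' (c + n \<bullet> z)" and ?r2 = "\<lambda>z. cutoff'' (c + n \<bullet> z)"
  let ?G = "\<lambda>z. cutoff_prod L z *\<^sub>R G z"
  define D2 where "D2 z h = ?r z *\<^sub>R D1 z h + (?r1 z * (n \<bullet> h)) *\<^sub>R ?G z" for z h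
  define DD2 where "DD2 z k h = (?r z *\<^sub>R DD1 z k h + (?r1 z * (n \<bullet> k)) *\<^sub>R D1 z h) +
      ((?r1 z * (n \<bullet> h)) *\<^sub>R D1 z k + (?r2 z * (n \<bullet> k) * (n \<bullet> h)) *\<^sub>R ?G z)" for z k h
  have eq0: "cutoff_prod (insert p L) z = ?r z * cutoff_prod L z" for z
    using insert.hyps by (simp add: p cutoff_prod_insert)
  have "C2 U (\<lambda>z. ?r z *\<^sub>R ?G z) D2 DD2"
    unfolding D2_def DD2_def
    by (rule bounded_bilinear.C2_mult[OF bounded_bilinear_scaleR C2_cutoff_affine IH(1)])
  moreover have saG: "self_adjoint (?G z)" if "z \<in> U" for z
    using sa[OF that] by (simp add: self_adjoint_def blinfun.scaleR_left)
  have "nakano (?r z *\<^sub>R ?G z) (D2 z) (DD2 z)" if z: "z \<in> U" "?r z * cutoff_prod L z \<noteq> 0" for z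
  proof -
    have "0 < ?r z" using z(2) cutoff_nonneg[of "c + n \<bullet> z"] by auto
    then show ?thesis
      unfolding D2_def DD2_def
      using z IH(2) saG psd[OF z(1)] cutoff_prod_range(1)[of L z] cutoff_log_concave[of "c + n \<bullet> z"]
      by (intro nakano_log_concave_mult C2_self_adjoint(1)[OF IH(1) C2(2)])
         (auto simp: blinfun.scaleR_left intro: mult_nonneg_nonneg)
  qed
  moreover have "D2 z h = 0 \<and> DD2 z h k = 0" if z: "z \<in> U" "?r z * cutoff_prod L z = 0" for z h k
  proof (cases "cutoff_prod L z = 0")
    case True
    then show ?thesis using IH(3)[OF z(1) True] by (simp add: D2_def DD2_def)
  next
    case False
    then have "c + n \<bullet> z \<le> 0" using z(2) cutoff_pos[of "c + n \<bullet> z"] by force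
    then show ?thesis by (simp add: D2_def DD2_def cutoff_eq_0)
  qed
  ultimately show ?case unfolding eq0 scaleR_scaleR[symmetric] by blast
qed

lemma C2_cutoff_prod:
  assumes "finite L"
  shows "\<exists>D DD. C2 UNIV (cutoff_prod L :: 'a::euclidean_space \<Rightarrow> real) D DD"
  using assms
proof (induction L rule: finite_induct)
  case empty
  have "cutoff_prod {} = (\<lambda>z :: 'a. 1)" by (auto simp: cutoff_prod_def)
  then have "C2 UNIV (cutoff_prod {} :: 'a \<Rightarrow> real) (\<lambda>z h. 0) (\<lambda>z h k. 0)"
    by (auto simp: C2_def C1_def)
  then show ?case by blast
next
  case (insert p L)
  obtain n c where p: "p = (n, c)" by (cases p)
  have "cutoff_prod (insert p L) = (\<lambda>z. cutoff (c + n \<bullet> z) * cutoff_prod L z)"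
    using insert.hyps by (auto simp: p cutoff_prod_insert)
  then show ?case
    using insert.IH bounded_bilinear.C2_mult[OF bounded_bilinear_mult C2_cutoff_affine, of UNIV "cutoff_prod L"]
    by (simp only:) blast
qed

text \<open>
  Each point outside the convex set is separated from \<open>K\<close> by a half-space. A large box bounds the
  support, and by compactness finitely many half-spaces deal with the part of the box outside the set.
\<close>

lemma separating_cutoffs:
  fixes \<Omega> :: "'a::euclidean_space set"
  assumes \<Omega>: "open \<Omega>" "convex \<Omega>" and K: "compact K" "K \<subseteq> \<Omega>" "K \<noteq> {}"
  obtains L P where "finite L" "compact P" "P \<subseteq> \<Omega>"
    "\<And>z. z \<in> K \<Longrightarrow> cutoff_prod L z = 1" "\<And>z. z \<notin> P \<Longrightarrow> cutoff_prod L z = 0"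
proof -
  obtain R where R: "\<And>z. z \<in> K \<Longrightarrow> norm z \<le> R"
    using compact_imp_bounded[OF K(1)] by (auto simp: bounded_iff)
  define LB where "LB = (\<lambda>b. (b, R + 1)) ` (Basis :: 'a set) \<union> (\<lambda>b. (- b, R + 1)) ` Basis"
  define C where "C = cbox (- (R + 1) *\<^sub>R One) ((R + 1) *\<^sub>R One :: 'a) - \<Omega>"
  have "compact C" unfolding C_def using \<Omega>(1) by (simp add: compact_diff)
  have sep: "\<exists>p. (\<forall>z\<in>K. 1 \<le> snd p + fst p \<bullet> z) \<and> snd p + fst p \<bullet> y < 0" if y: "y \<notin> \<Omega>" for y
  proof -
    have "convex ((\<lambda>x. - y + x) ` \<Omega>)" using \<Omega>(2) by (rule convex_translation)
    moreover have "0 \<notin> (\<lambda>x. - y + x) ` \<Omega>" using y by force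
    ultimately have "\<exists>a. a \<noteq> 0 \<and> (\<forall>x\<in>(\<lambda>x. - y + x) ` \<Omega>. 0 \<le> a \<bullet> x)"
      by (rule separating_hyperplane_set_0)
    then obtain a where a: "a \<noteq> 0" "\<And>x. x \<in> (\<lambda>x. - y + x) ` \<Omega> \<Longrightarrow> 0 \<le> a \<bullet> x" by blast
    have pos: "0 < a \<bullet> (x - y)" if x: "x \<in> \<Omega>" for x
    proof -
      obtain e where e: "e > 0" "cball x e \<subseteq> \<Omega>" using \<Omega>(1) x open_contains_cball by blast
      have "x - (e / norm a) *\<^sub>R a \<in> \<Omega>" using e a(1) by (intro subsetD[OF e(2)]) (simp add: dist_norm)
      then have "0 \<le> a \<bullet> (- y + (x - (e / norm a) *\<^sub>R a))" by (intro a(2)) auto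
      also have "\<dots> = a \<bullet> (x - y) - e * norm a"
        using a(1) by (simp add: inner_add inner_diff power2_norm_eq_inner[symmetric] power2_eq_square)
      finally show ?thesis using e(1) a(1) by (smt (verit) mult_pos_pos zero_less_norm_iff)
    qed
    obtain x0 where x0: "x0 \<in> K" "\<And>x. x \<in> K \<Longrightarrow> a \<bullet> (x0 - y) \<le> a \<bullet> (x - y)"
    proof -
      have "continuous_on K (\<lambda>x. a \<bullet> (x - y))" by (intro continuous_intros)
      from continuous_attains_inf[OF K(1,3) this] show thesis using that by blast
    qed
    define d where "d = a \<bullet> (x0 - y)"
    have d: "d > 0" using pos x0(1) K(2) by (auto simp: d_def)
    \<comment> \<open>the affine function is \<open>-1\<close> at \<open>y\<close> and at least \<open>1\<close> on \<open>K\<close>\<close>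
    let ?p = "((2 / d) *\<^sub>R a, - 1 - (2 / d) * (a \<bullet> y))"
    have "1 \<le> snd ?p + fst ?p \<bullet> z" if "z \<in> K" for z
    proof -
      have "d \<le> a \<bullet> z - a \<bullet> y" using x0(2)[OF that] by (simp add: d_def inner_diff)
      then have "(2 / d) * d \<le> (2 / d) * (a \<bullet> z - a \<bullet> y)" using d by (intro mult_left_mono) auto
      then show ?thesis using d by (simp add: algebra_simps)
    qed
    moreover have "snd ?p + fst ?p \<bullet> y < 0" by simp
    ultimately show ?thesis by blast
  qed
  then obtain f where f: "\<And>y z. y \<notin> \<Omega> \<Longrightarrow> z \<in> K \<Longrightarrow> 1 \<le> snd (f y) + fst (f y) \<bullet> z"
    "\<And>y. y \<notin> \<Omega> \<Longrightarrow> snd (f y) + fst (f y) \<bullet> y < 0"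
    by metis
  have op: "open {z. snd (f y) + fst (f y) \<bullet> z < 0}" for y
    by (intro open_Collect_less continuous_intros)
  have "C \<subseteq> (\<Union>y\<in>C. {z. snd (f y) + fst (f y) \<bullet> z < 0})" using f(2) by (auto simp: C_def)
  from compactE_image[OF \<open>compact C\<close> op this]
  obtain Y where Y: "Y \<subseteq> C" "finite Y" "C \<subseteq> (\<Union>y\<in>Y. {z. snd (f y) + fst (f y) \<bullet> z < 0})" by blast
  define L where "L = f ` Y \<union> LB"
  have L: "finite L" using Y(2) by (simp add: L_def LB_def)
  define P where "P = {z. \<forall>p\<in>L. 0 \<le> snd p + fst p \<bullet> z}"
  have box: "P \<subseteq> cbox (- (R + 1) *\<^sub>R One) ((R + 1) *\<^sub>R One)"
  proof
    fix z assume z: "z \<in> P"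
    have "- (R + 1) \<le> z \<bullet> b \<and> z \<bullet> b \<le> R + 1" if "b \<in> Basis" for b
    proof -
      have "(b, R + 1) \<in> L" "(- b, R + 1) \<in> L" using that by (auto simp: L_def LB_def)
      then have "0 \<le> R + 1 + b \<bullet> z" "0 \<le> R + 1 + (- b) \<bullet> z" using z unfolding P_def by force+
      then show ?thesis by (simp add: inner_commute)
    qed
    then show "z \<in> cbox (- (R + 1) *\<^sub>R One) ((R + 1) *\<^sub>R One)" by (simp add: mem_box)
  qed
  have "closed P"
  proof -
    have "closed (\<Inter>p\<in>L. {z. 0 \<le> snd p + fst p \<bullet> z})"
      by (intro closed_INT ballI closed_Collect_le continuous_intros)
    also have "(\<Inter>p\<in>L. {z. 0 \<le> snd p + fst p \<bullet> z}) = P" by (auto simp: P_def)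
    finally show ?thesis .
  qed
  show thesis
  proof (rule that[OF L, of P])
    show "compact P" using \<open>closed P\<close> box bounded_cbox bounded_subset compact_eq_bounded_closed by blast
    show "P \<subseteq> \<Omega>"
    proof
      fix z assume z: "z \<in> P"
      show "z \<in> \<Omega>"
      proof (rule ccontr)
        assume "z \<notin> \<Omega>"
        then have "z \<in> C" using z box by (auto simp: C_def)
        then obtain y where y: "y \<in> Y" "snd (f y) + fst (f y) \<bullet> z < 0" using Y(3) by blast
        then have "0 \<le> snd (f y) + fst (f y) \<bullet> z" using z by (auto simp: P_def L_def)
        then show False using y(2) by linarith
      qed
    qed
    show "cutoff_prod L z = 0" if z: "z \<notin> P" for z
    proof -
      obtain p where "p \<in> L" "snd p + fst p \<bullet> z < 0" using z by (force simp: P_def)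
      then show ?thesis using cutoff_prod_nonzero_iff[OF L, of z] by fastforce
    qed
    show "cutoff_prod L z = 1" if z: "z \<in> K" for z
    proof -
      have "1 \<le> snd p + fst p \<bullet> z" if "p \<in> L" for p
      proof -
        have "\<bar>z \<bullet> b\<bar> \<le> R" if "b \<in> Basis" for b using R[OF z] Basis_le_norm[OF that, of z] by linarith
        then have "1 \<le> snd p + fst p \<bullet> z" if "p \<in> LB"
          using that by (force simp: LB_def inner_commute abs_le_iff)
        then show ?thesis using that Y(1) f(1) z by (auto simp: L_def C_def)
      qed
      then show ?thesis unfolding cutoff_prod_def by (intro prod.neutral) (auto intro!: cutoff_eq_1)
    qed
  qed
qed

section \<open>Integration by parts\<close>

text \<open>
  A function supported in a closed subset of an open set may be continued by zero.
\<close>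

lemma C1_extend_zero:
  assumes f: "C1 U f f'" and U: "open U" and P: "closed P" "P \<subseteq> U" "\<And>z. z \<notin> P \<Longrightarrow> f z = 0"
  shows "C1 UNIV f (\<lambda>z h. if z \<in> U then f' z h else 0)"
    and "\<And>z h. z \<in> U \<Longrightarrow> z \<notin> P \<Longrightarrow> f' z h = 0"
proof -
  have oP: "open (- P)" using P(1) by auto
  have off: "(f has_derivative (\<lambda>h. 0)) (at z)" if "z \<notin> P" for z
  proof -
    have "((\<lambda>z. 0) has_derivative (\<lambda>h. 0)) (at z)" by simp
    then show ?thesis
      by (rule has_derivative_transform_within_open[OF _ oP]) (use that P(3) in auto)
  qed
  have off': "f' z h = 0" if "z \<in> U" "z \<notin> P" for z h
  proof -
    have "(f has_derivative f' z) (at z)" using f that(1) by (auto simp: C1_def)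
    from has_derivative_unique[OF this off[OF that(2)]] show ?thesis by simp
  qed
  then show "\<And>z h. z \<in> U \<Longrightarrow> z \<notin> P \<Longrightarrow> f' z h = 0" .
  show "C1 UNIV f (\<lambda>z h. if z \<in> U then f' z h else 0)"
    unfolding C1_def
  proof (intro conjI ballI allI)
    fix z
    show "(f has_derivative (\<lambda>h. if z \<in> U then f' z h else 0)) (at z)"
      using f off[of z] P(2) by (cases "z \<in> U") (auto simp: C1_def)
  next
    fix h
    have "continuous_on U (\<lambda>z. if z \<in> U then f' z h else 0) \<longleftrightarrow> continuous_on U (\<lambda>z. f' z h)"
      by (intro continuous_on_cong) auto
    then have "continuous_on U (\<lambda>z. if z \<in> U then f' z h else 0)" using f by (auto simp: C1_def)
    moreover have "continuous_on (- P) (\<lambda>z. if z \<in> U then f' z h else 0) \<longleftrightarrow> continuous_on (- P) (\<lambda>z. 0 :: 'b)"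
      using off' by (intro continuous_on_cong) auto
    then have "continuous_on (- P) (\<lambda>z. if z \<in> U then f' z h else 0)" by simp
    ultimately have "continuous_on (U \<union> - P) (\<lambda>z. if z \<in> U then f' z h else 0)"
      by (intro continuous_on_open_Un U oP)
    moreover have "U \<union> - P = UNIV" using P(2) by auto
    ultimately show "continuous_on UNIV (\<lambda>z. if z \<in> U then f' z h else 0)" by simp
  qed
qed

lemma integrable_compact_support:
  fixes f :: "'a::euclidean_space \<Rightarrow> real"
  assumes "compact P" "continuous_on P f" "\<And>z. z \<notin> P \<Longrightarrow> f z = 0"
  shows "integrable lborel f"
proof -
  have "(\<lambda>x. indicator P x *\<^sub>R f x) = f" using assms(3) by (intro ext) (auto simp: indicator_def)
  then show ?thesis using borel_integrable_compact[OF assms(1,2)] by simp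
qed

text \<open>
  The integral of a difference quotient vanishes by translation invariance, and difference quotients
  converge to the derivative with a bound of compact support.
\<close>

lemma integral_deriv_eq_0:
  fixes f :: "'a::euclidean_space \<Rightarrow> real"
  assumes f: "C1 UNIV f f'" and P: "compact P" "\<And>z. z \<notin> P \<Longrightarrow> f z = 0"
  shows "(\<integral>z. f' z h \<partial>lborel) = 0"
proof -
  have cont: "continuous_on X f" "continuous_on X (\<lambda>z. f' z h)" for X
    using C1_cont[OF f] f by (auto simp: C1_def intro: continuous_on_subset)
  have off: "f' z h = 0" if "z \<notin> P" for z
    using C1_extend_zero(2)[OF f open_UNIV compact_imp_closed[OF P(1)] _ P(2), of z] that by simp
  define Q where "Q = (\<lambda>(z, s). z - s *\<^sub>R h) ` (P \<times> {0..1::real})"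
  have Q: "compact Q" unfolding Q_def
    by (intro compact_continuous_image compact_Times P(1)) (auto simp: split_beta intro!: continuous_intros)
  have QI: "z \<in> Q" if "z + s *\<^sub>R h \<in> P" "0 \<le> s" "s \<le> 1" for z s
    using that by (force simp: Q_def image_iff)
  have "bounded ((\<lambda>z. f' z h) ` P)" by (intro compact_imp_bounded compact_continuous_image cont P)
  then obtain B where B: "\<And>z. z \<in> P \<Longrightarrow> \<bar>f' z h\<bar> \<le> B" by (auto simp: bounded_iff)
  define B' where "B' = max B 0"
  have B': "\<bar>f' z h\<bar> \<le> B'" for z using B[of z] off[of z] by (cases "z \<in> P") (auto simp: B'_def)
  have line: "((\<lambda>s. f (z + s *\<^sub>R h)) has_real_derivative f' (z + s *\<^sub>R h) h) (at s)" for z s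
    using C1_line[OF f, of z s h] by (simp add: has_real_derivative_iff_has_vector_derivative)
  define q where "q n z = (f (z + (1 / real (Suc n)) *\<^sub>R h) - f z) * real (Suc n)" for n z
  have "(\<lambda>n. \<integral>z. q n z \<partial>lborel) \<longlonglongrightarrow> (\<integral>z. f' z h \<partial>lborel)"
  proof (rule integral_dominated_convergence[where w = "\<lambda>z. B' * indicator Q z"])
    show "integrable lborel (\<lambda>z. B' * indicator Q z)"
      by (intro integrable_mult_right) (auto intro!: emeasure_compact_finite Q borel_compact)
    show "AE z in lborel. (\<lambda>n. q n z) \<longlonglongrightarrow> f' z h"
    proof (rule AE_I2)
      fix z
      have "((\<lambda>s. (f (z + s *\<^sub>R h) - f (z + 0 *\<^sub>R h)) / (s - 0)) \<longlongrightarrow> f' (z + 0 *\<^sub>R h) h) (at 0)"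
        using line[of z 0] unfolding has_field_derivative_iff .
      then have "((\<lambda>s. (f (z + s *\<^sub>R h) - f z) / s) \<longlongrightarrow> f' z h) (at 0)" by simp
      moreover have "filterlim (\<lambda>n. 1 / real (Suc n)) (at 0) sequentially"
        using LIMSEQ_inverse_real_of_nat by (simp add: filterlim_at inverse_eq_divide)
      ultimately have "(\<lambda>n. (f (z + (1 / real (Suc n)) *\<^sub>R h) - f z) / (1 / real (Suc n))) \<longlonglongrightarrow> f' z h"
        by (rule filterlim_compose)
      then show "(\<lambda>n. q n z) \<longlonglongrightarrow> f' z h" by (simp add: q_def)
    qed
    fix n
    show "AE z in lborel. norm (q n z) \<le> B' * indicator Q z"
    proof (rule AE_I2)
      fix z
      let ?s = "1 / real (Suc n)"
      have s: "0 < ?s" "?s \<le> 1" by auto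
      obtain r where r: "0 < r" "r < ?s" "f (z + ?s *\<^sub>R h) - f (z + 0 *\<^sub>R h) = (?s - 0) * f' (z + r *\<^sub>R h) h"
        using MVT2[OF s(1), of "\<lambda>s. f (z + s *\<^sub>R h)" "\<lambda>s. f' (z + s *\<^sub>R h) h"] line by blast
      then have "q n z = f' (z + r *\<^sub>R h) h" by (simp add: q_def)
      then show "norm (q n z) \<le> B' * indicator Q z"
        using B'[of "z + r *\<^sub>R h"] off[of "z + r *\<^sub>R h"] QI[of z r] r s
        by (cases "z + r *\<^sub>R h \<in> P") (auto simp: indicator_def B'_def)
    qed
    show "q n \<in> borel_measurable lborel"
    proof -
      have "continuous_on UNIV (\<lambda>z. z + (1 / real (Suc n)) *\<^sub>R h)" by (intro continuous_intros)
      then have "continuous_on UNIV (\<lambda>z. f (z + (1 / real (Suc n)) *\<^sub>R h))"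
        by (rule continuous_on_compose2[OF cont(1)[of UNIV]]) simp
      then have "continuous_on UNIV (q n)" unfolding q_def by (intro continuous_intros cont)
      then show ?thesis by (simp add: borel_measurable_continuous_onI)
    qed
  qed (auto intro!: borel_measurable_continuous_onI cont)
  moreover have "(\<integral>z. q n z \<partial>lborel) = 0" for n
  proof -
    have int: "integrable lborel f" using P cont by (intro integrable_compact_support)
    let ?c = "(1 / real (Suc n)) *\<^sub>R h"
    have "integrable lborel (\<lambda>z. f (?c + z))" "(\<integral>z. f (?c + z) \<partial>lborel) = (\<integral>z. f z \<partial>lborel)"
    proof -
      have m: "f \<in> borel_measurable borel" by (intro borel_measurable_continuous_onI cont)
      show "integrable lborel (\<lambda>z. f (?c + z))"
        using int integrable_distr_eq[of "(+) ?c" lborel borel f] m by (simp add: lborel_distr_plus)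
      show "(\<integral>z. f (?c + z) \<partial>lborel) = (\<integral>z. f z \<partial>lborel)"
        using integral_distr[of "(+) ?c" lborel borel f] m by (simp add: lborel_distr_plus)
    qed
    then show ?thesis using int by (simp add: q_def add.commute)
  qed
  ultimately show ?thesis by (simp add: LIMSEQ_const_iff)
qed

lemma integral_by_parts2:
  fixes \<theta> \<psi> :: "'a::euclidean_space \<Rightarrow> real"
  assumes \<psi>: "C2 UNIV \<psi> D\<psi> DD\<psi>" and \<theta>: "C2 U \<theta> D\<theta> DD\<theta>" and U: "open U"
    and P: "compact P" "P \<subseteq> U" "\<And>z. z \<notin> P \<Longrightarrow> \<psi> z = 0"
  shows "integrable lborel (\<lambda>z. \<psi> z * DD\<theta> z j k)" "integrable lborel (\<lambda>z. DD\<psi> z k j * \<theta> z)"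
    and "(\<integral>z. \<psi> z * DD\<theta> z j k \<partial>lborel) = (\<integral>z. DD\<psi> z k j * \<theta> z \<partial>lborel)"
proof -
  have C1\<psi>: "C1 UNIV \<psi> D\<psi>" "\<And>h. C1 UNIV (\<lambda>z. D\<psi> z h) (\<lambda>z k. DD\<psi> z k h)" using \<psi> by (auto simp: C2_def)
  have C1\<theta>: "C1 U \<theta> D\<theta>" "\<And>h. C1 U (\<lambda>z. D\<theta> z h) (\<lambda>z k. DD\<theta> z k h)" using \<theta> by (auto simp: C2_def)
  note cP = compact_imp_closed[OF P(1)]
  have 1: "D\<psi> z h = 0" if "z \<notin> P" for z h
    using C1_extend_zero(2)[OF C1\<psi>(1) open_UNIV cP _ P(3)] that by simp
  have 2: "DD\<psi> z k h = 0" if "z \<notin> P" for z h k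
    using C1_extend_zero(2)[OF C1\<psi>(2) open_UNIV cP _ 1] that by simp
  have cont: "continuous_on P \<psi>" "continuous_on P (\<lambda>z. D\<psi> z h)" "continuous_on P (\<lambda>z. DD\<psi> z k h)"
    "continuous_on P \<theta>" "continuous_on P (\<lambda>z. D\<theta> z h)" "continuous_on P (\<lambda>z. DD\<theta> z k h)" for h k
    using C1_cont[OF C1\<psi>(1)] C1_cont[OF C1\<psi>(2)] C1\<psi>(2)[of h] C1_cont[OF C1\<theta>(1)] C1_cont[OF C1\<theta>(2)] C1\<theta>(2)[of h] P(2)
    by (auto simp: C1_def intro: continuous_on_subset)
  show i1: "integrable lborel (\<lambda>z. \<psi> z * DD\<theta> z j k)"
    using P(1,3) cont by (intro integrable_compact_support continuous_intros) auto
  show i2: "integrable lborel (\<lambda>z. DD\<psi> z k j * \<theta> z)"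
    using P(1) cont 2 by (intro integrable_compact_support continuous_intros) auto
  have i3: "integrable lborel (\<lambda>z. D\<psi> z j * D\<theta> z k)"
    using P(1) cont 1 by (intro integrable_compact_support continuous_intros) auto
  have "C1 U (\<lambda>z. \<psi> z * D\<theta> z k) (\<lambda>z h. \<psi> z * DD\<theta> z h k + D\<psi> z h * D\<theta> z k)"
    by (rule bounded_bilinear.C1_mult[OF bounded_bilinear_mult C1_subset[OF C1\<psi>(1)] C1\<theta>(2)]) simp
  from integral_deriv_eq_0[OF C1_extend_zero(1)[OF this U cP P(2)] P(1), of j]
  have "(\<integral>z. (if z \<in> U then \<psi> z * DD\<theta> z j k + D\<psi> z j * D\<theta> z k else 0) \<partial>lborel) = 0" using P(3) by simp
  also have "(\<lambda>z. if z \<in> U then \<psi> z * DD\<theta> z j k + D\<psi> z j * D\<theta> z k else 0) = (\<lambda>z. \<psi> z * DD\<theta> z j k + D\<psi> z j * D\<theta> z k)"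
    using P(2,3) 1 by (intro ext) (metis mult_zero_left add_0 subsetD)
  finally have e1: "(\<integral>z. \<psi> z * DD\<theta> z j k \<partial>lborel) + (\<integral>z. D\<psi> z j * D\<theta> z k \<partial>lborel) = 0"
    using i1 i3 by simp
  have "C1 U (\<lambda>z. D\<psi> z j * \<theta> z) (\<lambda>z h. D\<psi> z j * D\<theta> z h + DD\<psi> z h j * \<theta> z)"
    by (rule bounded_bilinear.C1_mult[OF bounded_bilinear_mult C1_subset[OF C1\<psi>(2)] C1\<theta>(1)]) simp
  from integral_deriv_eq_0[OF C1_extend_zero(1)[OF this U cP P(2)] P(1), of k]
  have "(\<integral>z. (if z \<in> U then D\<psi> z j * D\<theta> z k + DD\<psi> z k j * \<theta> z else 0) \<partial>lborel) = 0" using 1 by simp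
  also have "(\<lambda>z. if z \<in> U then D\<psi> z j * D\<theta> z k + DD\<psi> z k j * \<theta> z else 0) = (\<lambda>z. D\<psi> z j * D\<theta> z k + DD\<psi> z k j * \<theta> z)"
    using P(2) 1 2 by (intro ext) (metis mult_zero_left add_0 subsetD)
  finally have "(\<integral>z. D\<psi> z j * D\<theta> z k \<partial>lborel) + (\<integral>z. DD\<psi> z k j * \<theta> z \<partial>lborel) = 0"
    using i2 i3 by simp
  then show "(\<integral>z. \<psi> z * DD\<theta> z j k \<partial>lborel) = (\<integral>z. DD\<psi> z k j * \<theta> z \<partial>lborel)" using e1 by simp
qed

section \<open>Limits of Nakano semi-positive functions\<close>

text \<open>
  The graph of the convex function \<open>s \<mapsto> G(t + s b)\<^sup>-\<^sup>1 e \<bullet> e\<close> lies above its tangent at \<open>0\<close>. For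
  \<open>e = G t w\<close> the slope is \<open>- D t b w \<bullet> w\<close>, so that values of \<open>G\<close> alone control its derivative.
\<close>

lemma nakano_inverse_form_tangent:
  fixes G :: "'a::euclidean_space \<Rightarrow> 'v::euclidean_space \<Rightarrow>\<^sub>L 'v"
  assumes C2: "C2 U G D DD" and U: "open U" "convex U"
    and sa: "\<And>z. z \<in> U \<Longrightarrow> self_adjoint (G z)"
    and pos: "\<And>z v. z \<in> U \<Longrightarrow> v \<noteq> 0 \<Longrightarrow> 0 < G z v \<bullet> v"
    and nak: "\<And>z. z \<in> U \<Longrightarrow> nakano (G z) (D z) (DD z)"
    and b: "b \<in> Basis" and t: "t \<in> U" "t + s *\<^sub>R b \<in> U" and x: "G (t + s *\<^sub>R b) x = G t w"
  shows "G t w \<bullet> w - s * (D t b w \<bullet> w) \<le> x \<bullet> G t w"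
proof -
  have C1: "C1 U G D" "\<And>h. C1 U (\<lambda>z. D z h) (\<lambda>z k. DD z k h)" using C2 by (auto simp: C2_def)
  define J where "J = {s. t + s *\<^sub>R b \<in> U}"
  have J: "open J" "convex J"
  proof -
    have "J = (\<lambda>s. t + s *\<^sub>R b) -` U" by (auto simp: J_def)
    then show "open J" using U(1) by (auto intro!: open_vimage continuous_intros)
    show "convex J"
    proof (rule convexI)
      fix p q and u v :: real
      assume "p \<in> J" "q \<in> J" "0 \<le> u" "0 \<le> v" and uv: "u + v = 1"
      then have "u *\<^sub>R (t + p *\<^sub>R b) + v *\<^sub>R (t + q *\<^sub>R b) \<in> U" using U(2) by (auto simp: J_def convex_def)
      moreover have "u *\<^sub>R (t + p *\<^sub>R b) + v *\<^sub>R (t + q *\<^sub>R b) = (u + v) *\<^sub>R t + (u * p + v * q) *\<^sub>R b"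
        by (simp add: algebra_simps)
      ultimately show "u *\<^sub>R p + v *\<^sub>R q \<in> J" using uv by (simp add: J_def)
    qed
  qed
  have "\<forall>r. \<exists>y. r \<in> J \<longrightarrow> G (t + r *\<^sub>R b) y = G t w" using positive_definite_surj[OF pos] unfolding J_def by (metis mem_Collect_eq)
  then obtain a where a: "\<And>r. r \<in> J \<Longrightarrow> G (t + r *\<^sub>R b) (a r) = G t w" by metis
  have inj: "y = y'" if "G z y = G z y'" "z \<in> U" for z y y'
  proof (rule ccontr)
    assume "y \<noteq> y'"
    then have "0 < G z (y - y') \<bullet> (y - y')" using that(2) by (intro pos) auto
    then show False using that(1) by (simp add: blinfun.diff_right)
  qed
  have 0: "0 \<in> J" "s \<in> J" using t by (auto simp: J_def)
  have "G t (a 0) = G t w" using a[OF 0(1)] by simp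
  then have a0: "a 0 = w" using t(1) by (rule inj)
  have "G (t + s *\<^sub>R b) (a s) = G (t + s *\<^sub>R b) x" using a[OF 0(2)] x by simp
  then have as: "a s = x" using t(2) by (rule inj)
  have "convex_on J (\<lambda>s. a s \<bullet> G t w)"
  proof (rule inverse_form_convex[OF J, where M = "\<lambda>s. G (t + s *\<^sub>R b)" and M' = "\<lambda>s. D (t + s *\<^sub>R b) b"
        and M'' = "\<lambda>s. DD (t + s *\<^sub>R b) b b"])
    fix s assume "s \<in> J"
    then have s: "t + s *\<^sub>R b \<in> U" by (simp add: J_def)
    show "((\<lambda>s. G (t + s *\<^sub>R b)) has_vector_derivative D (t + s *\<^sub>R b) b) (at s)" by (rule C1_line[OF C1(1) s])
    show "((\<lambda>s. D (t + s *\<^sub>R b) b) has_vector_derivative DD (t + s *\<^sub>R b) b b) (at s)" by (rule C1_line[OF C1(2) s])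
    show "self_adjoint (G (t + s *\<^sub>R b))" using sa s by blast
    show "self_adjoint (D (t + s *\<^sub>R b) b)" by (rule C2_self_adjoint(1)[OF C2 U(1) sa s])
    show "0 < G (t + s *\<^sub>R b) v \<bullet> v" if "v \<noteq> 0" for v using pos s that by blast
    show "DD (t + s *\<^sub>R b) b b w \<bullet> w \<le> G (t + s *\<^sub>R b) y \<bullet> y"
      if "G (t + s *\<^sub>R b) y = D (t + s *\<^sub>R b) b w" for w y
      by (rule nakano_direction[OF nak[OF s] b that])
    show "G (t + s *\<^sub>R b) (a s) = G t w" by (rule a) fact
  qed
  moreover have "((\<lambda>s. a s \<bullet> G t w) has_real_derivative - (D t b w \<bullet> w)) (at 0)"
  proof -
    have "((\<lambda>s. G (t + s *\<^sub>R b)) has_vector_derivative D (t + 0 *\<^sub>R b) b) (at 0)"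
      using t by (intro C1_line[OF C1(1)]) simp
    then have d: "((\<lambda>s. G (t + s *\<^sub>R b)) has_vector_derivative D t b) (at 0)" by simp
    have ev: "\<forall>\<^sub>F r in nhds 0. G (t + r *\<^sub>R b) (a r) = G t w"
      using eventually_nhds_in_open[OF J(1) 0(1)] by eventually_elim (rule a)
    show ?thesis
      by (rule solution_form_derivative[OF d _ _ ev]) (use sa[OF t(1)] pos[OF t(1)] a0 in auto)
  qed
  ultimately have "- (D t b w \<bullet> w) * (s - 0) \<le> a s \<bullet> G t w - a 0 \<bullet> G t w"
    using J 0 by (intro convex_on_imp_above_tangent[of J "\<lambda>s. a s \<bullet> G t w"])
      (auto intro: convex_connected has_field_derivative_at_within simp: interior_open)
  then show ?thesis by (simp add: a0 as inner_commute algebra_simps)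
qed

lemma polarization:
  assumes "self_adjoint A"
  shows "4 * (A u \<bullet> v) = A (u + v) \<bullet> (u + v) - A (u - v) \<bullet> (u - v)"
  using self_adjointD[OF assms, of v u]
  by (simp add: blinfun.add_right blinfun.diff_right inner_add inner_diff inner_commute)

lemma tendsto_self_adjoint:
  fixes A :: "nat \<Rightarrow> 'v::euclidean_space \<Rightarrow>\<^sub>L 'v"
  assumes sa: "\<And>n. self_adjoint (A n)" "self_adjoint A0"
    and lim: "\<And>w. (\<lambda>n. A n w \<bullet> w) \<longlonglongrightarrow> A0 w \<bullet> w"
  shows "(\<lambda>n. A n v) \<longlonglongrightarrow> A0 v"
proof -
  have "(\<lambda>n. A n v \<bullet> w) \<longlonglongrightarrow> A0 v \<bullet> w" for w
  proof -
    have "(\<lambda>n. (A n (v + w) \<bullet> (v + w) - A n (v - w) \<bullet> (v - w)) / 4)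
        \<longlonglongrightarrow> (A0 (v + w) \<bullet> (v + w) - A0 (v - w) \<bullet> (v - w)) / 4"
      by (intro tendsto_intros lim) auto
    then show ?thesis unfolding polarization[OF sa(1), symmetric] polarization[OF sa(2), symmetric]
      by simp
  qed
  then show ?thesis by (subst tendsto_componentwise_iff) simp
qed

text \<open>
  Convexity of the inverse operators makes first derivatives converge along with the functions,
  and second derivatives enter the curvature inequality linearly, so that they converge in the sense
  of distributions. Hence the inequality, tested against nonnegative functions, survives a
  pointwise limit.
\<close>

lemma nakano_limit:
  fixes G :: "nat \<Rightarrow> 'a::euclidean_space \<Rightarrow> 'v::euclidean_space \<Rightarrow>\<^sub>L 'v"
  assumes r: "0 < r" and C2: "\<And>n. C2 (ball t0 r) (G n) (D n) (DD n)" and C2': "C2 (ball t0 r) GL DL DDL"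
    and sa: "\<And>n t. t \<in> ball t0 r \<Longrightarrow> self_adjoint (G n t)"
    and sa0: "\<And>t. t \<in> ball t0 r \<Longrightarrow> self_adjoint (GL t)"
    and l: "0 < l" "\<And>n t v. t \<in> ball t0 r \<Longrightarrow> l * (v \<bullet> v) \<le> G n t v \<bullet> v"
    and \<Lambda>: "\<And>n t. t \<in> ball t0 r \<Longrightarrow> norm (G n t) \<le> \<Lambda>"
    and nak: "\<And>n t. t \<in> ball t0 r \<Longrightarrow> nakano (G n t) (D n t) (DD n t)"
    and lim: "\<And>t v. t \<in> ball t0 r \<Longrightarrow> (\<lambda>n. G n t v) \<longlonglongrightarrow> GL t v"
  shows "nakano (GL t0) (DL t0) (DDL t0)"
  unfolding nakano_def
proof (intro allI impI)
  fix u :: "'a \<Rightarrow> 'v" and y00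
  assume y00: "GL t0 y00 = (\<Sum>j\<in>Basis. DL t0 j (u j))"
  let ?U = "ball t0 r"
  define V where "V = ball t0 (r / 2)"
  have VU: "V \<subseteq> ?U" using r by (auto simp: V_def)
  have C1: "C1 ?U (G n) (D n)" "C1 ?U (\<lambda>z. D n z h) (\<lambda>z k. DD n z k h)" for n h using C2[of n] by (auto simp: C2_def)
  have C1': "C1 ?U GL DL" "C1 ?U (\<lambda>z. DL z h) (\<lambda>z k. DDL z k h)" for h using C2' by (auto simp: C2_def)
  have l0: "l * (v \<bullet> v) \<le> GL t v \<bullet> v" if "t \<in> ?U" for t v
  proof (rule LIMSEQ_le_const)
    show "(\<lambda>n. G n t v \<bullet> v) \<longlonglongrightarrow> GL t v \<bullet> v" by (intro tendsto_intros lim that)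
  qed (use l(2)[OF that] in auto)
  have pos: "0 < G n t v \<bullet> v" if "t \<in> ?U" "v \<noteq> 0" for n t v
    using l(1) l(2)[OF that(1), of v n] that(2) by (smt (verit) inner_gt_zero_iff mult_pos_pos)
  have pos0: "0 < GL t v \<bullet> v" if "t \<in> ?U" "v \<noteq> 0" for t v
    using l(1) l0[OF that(1), of v] that(2) by (smt (verit) inner_gt_zero_iff mult_pos_pos)
  have \<Lambda>0: "0 \<le> \<Lambda>" using \<Lambda>[of t0 0] r norm_ge_zero order_trans by (metis centre_in_ball)
  have nlim: "(\<lambda>n. G n t) \<longlonglongrightarrow> GL t" if "t \<in> ?U" for t
    by (rule tendsto_componentwise1) (rule lim[OF that])
  have norm_sol: "norm x \<le> norm e / l" if "t \<in> ?U" "G n t x = e" for t n x e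
    using coercive_norm_le[of l "G n t" x] l that by (simp add: field_simps)

  have inU: "t + s *\<^sub>R j \<in> ?U" if "t \<in> V" "j \<in> Basis" "\<bar>s\<bar> < r / 2" for t s j
  proof -
    have "dist t0 (t + s *\<^sub>R j) \<le> dist t0 t + dist t (t + s *\<^sub>R j)" by (rule dist_triangle)
    also have "dist t (t + s *\<^sub>R j) = \<bar>s\<bar>" using that(2) by (simp add: dist_norm)
    finally show ?thesis using that by (simp add: V_def)
  qed
  \<comment> \<open>The two tangent inequalities bound the first derivatives and squeeze their limits.\<close>
  have tangent: "G n t w \<bullet> w - s * (D n t j w \<bullet> w) \<le> x \<bullet> G n t w"
    if "t \<in> V" "j \<in> Basis" "\<bar>s\<bar> < r / 2" "G n (t + s *\<^sub>R j) x = G n t w" for n t w s x j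
    by (rule nakano_inverse_form_tangent[OF C2 open_ball convex_ball sa pos nak that(2) _ _ that(4)])
       (use that(1) VU inU[OF that(1-3)] in auto)
  define K where "K = \<Lambda>\<^sup>2 / l * (4 / r)"
  have K0: "0 \<le> K" using l r by (simp add: K_def)
  have K: "norm (D n t j) \<le> K" if t: "t \<in> V" "j \<in> Basis" for n t j
  proof (rule norm_self_adjoint_le[OF _ K0])
    show "self_adjoint (D n t j)"
      using t VU by (intro C2_self_adjoint(1)[OF C2 open_ball sa]) auto
    fix w
    have tU: "t \<in> ?U" using t VU by auto
    have bound: "- s * (D n t j w \<bullet> w) \<le> \<Lambda>\<^sup>2 / l * (w \<bullet> w)" if s: "\<bar>s\<bar> < r / 2" for s
    proof -
      obtain x where x: "G n (t + s *\<^sub>R j) x = G n t w" using positive_definite_surj[OF pos[OF inU[OF t s]]] by blast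
      have "0 \<le> G n t w \<bullet> w" using l(1) l(2)[OF tU, of w n] by (smt (verit) inner_ge_zero mult_nonneg_nonneg)
      then have "- s * (D n t j w \<bullet> w) \<le> x \<bullet> G n t w" using tangent[OF t s x] by simp
      also have "\<dots> \<le> norm x * norm (G n t w)" by (rule norm_cauchy_schwarz)
      also have "\<dots> \<le> norm (G n t w) / l * norm (G n t w)"
        by (intro mult_right_mono norm_sol[OF inU[OF t s] x]) auto
      also have "\<dots> = (norm (G n t w))\<^sup>2 / l" by (simp add: power2_eq_square)
      also have "\<dots> \<le> (\<Lambda> * norm w)\<^sup>2 / l"
        using l(1) order_trans[OF norm_blinfun mult_right_mono[OF \<Lambda>[OF tU] norm_ge_zero], of n w]
        by (intro divide_right_mono power_mono) auto
      finally show ?thesis by (simp add: power_mult_distrib power2_norm_eq_inner)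
    qed
    define X where "X = D n t j w \<bullet> w"
    define Q where "Q = \<Lambda>\<^sup>2 / l * (w \<bullet> w)"
    have "- (r / 4) * X \<le> Q" "- (- (r / 4)) * X \<le> Q"
      unfolding X_def Q_def by (rule bound, use r in simp)+
    then have XQ: "\<bar>r / 4 * X\<bar> \<le> Q" unfolding abs_le_iff by (simp only: minus_minus minus_mult_left)
    have "\<bar>X\<bar> = 4 / r * \<bar>r / 4 * X\<bar>" using r by (simp add: abs_mult)
    also have "\<dots> \<le> 4 / r * Q" using r by (intro mult_left_mono XQ) auto
    finally show "\<bar>D n t j w \<bullet> w\<bar> \<le> K * (w \<bullet> w)" by (simp add: K_def X_def Q_def mult_ac)
  qed
  have Dlim_form: "(\<lambda>n. D n t j w \<bullet> w) \<longlonglongrightarrow> DL t j w \<bullet> w" if t: "t \<in> V" "j \<in> Basis" for t j w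
  proof -
    have tU: "t \<in> ?U" using t VU by auto
    have "\<forall>s. \<exists>x. \<bar>s\<bar> < r / 2 \<longrightarrow> GL (t + s *\<^sub>R j) x = GL t w"
      using positive_definite_surj[OF pos0[OF inU[OF t]]] by metis
    then obtain a where a: "\<And>s. \<bar>s\<bar> < r / 2 \<Longrightarrow> GL (t + s *\<^sub>R j) (a s) = GL t w" by metis
    have a0: "a 0 = w"
      using pos0[OF tU, of "a 0 - w"] a[of 0] r by (force simp: blinfun.diff_right)
    have deriv: "((\<lambda>s. a s \<bullet> GL t w) has_real_derivative - (DL t j w \<bullet> w)) (at 0)"
    proof -
      have "((\<lambda>s. GL (t + s *\<^sub>R j)) has_vector_derivative DL (t + 0 *\<^sub>R j) j) (at 0)"
        using tU by (intro C1_line[OF C1'(1)]) simp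
      then have d: "((\<lambda>s. GL (t + s *\<^sub>R j)) has_vector_derivative DL t j) (at 0)" by simp
      have "\<forall>\<^sub>F s in nhds 0. s \<in> {- (r / 2)<..<r / 2}" using r by (intro eventually_nhds_in_open) auto
      then have ev: "\<forall>\<^sub>F s in nhds 0. GL (t + s *\<^sub>R j) (a s) = GL t w"
        by eventually_elim (intro a, auto)
      show ?thesis
        by (rule solution_form_derivative[OF d _ _ ev]) (use sa0[OF tU] pos0[OF tU] a0 in auto)
    qed
    define q where "q s = (a s \<bullet> GL t w - GL t w \<bullet> w) / s" for s
    have q: "(q \<longlongrightarrow> - (DL t j w \<bullet> w)) (at 0)"
      using deriv by (simp add: has_field_derivative_iff q_def[abs_def] a0 inner_commute)
    have limx: "(\<lambda>n. (x n \<bullet> G n t w - G n t w \<bullet> w) / s) \<longlonglongrightarrow> q s"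
      if "s \<noteq> 0" "\<bar>s\<bar> < r / 2" "\<And>n. G n (t + s *\<^sub>R j) (x n) = G n t w" for s x
    proof -
      have sU: "t + s *\<^sub>R j \<in> ?U" by (rule inU[OF t that(2)])
      have "x \<longlonglongrightarrow> a s"
        by (rule blinfun.tendsto_solution[OF nlim[OF sU] lim[OF tU] _ a[OF that(2)] l(1)])
           (use that(3) coercive_norm_le[OF l0[OF sU]] in auto)
      then show ?thesis unfolding q_def using that(1) by (intro tendsto_intros lim tU) auto
    qed
    show ?thesis
    proof (rule order_tendstoI)
      fix c assume c: "c < DL t j w \<bullet> w"
      have "\<forall>\<^sub>F s in at_right 0. q s < - c"
        using c by (intro order_tendstoD(2)[OF filterlim_mono[OF q order_refl]]) (auto simp: at_le)
      moreover have "\<forall>\<^sub>F s in at_right 0. s \<in> {0<..<r / 2}" using r by (intro eventually_at_right_real) auto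
      ultimately have "\<forall>\<^sub>F s in at_right 0. q s < - c \<and> s \<in> {0<..<r / 2}" by eventually_elim auto
      then obtain s where s: "q s < - c" "0 < s" "s < r / 2"
        using eventually_happens'[OF trivial_limit_at_right_real] by fastforce
      have "\<forall>n. \<exists>x. G n (t + s *\<^sub>R j) x = G n t w"
        using positive_definite_surj[OF pos[OF inU[OF t]]] s by (metis abs_of_pos)
      then obtain x where x: "\<And>n. G n (t + s *\<^sub>R j) (x n) = G n t w" by metis
      have "\<forall>\<^sub>F n in sequentially. (x n \<bullet> G n t w - G n t w \<bullet> w) / s < - c"
        using s x by (intro order_tendstoD(2)[OF limx]) auto
      then show "\<forall>\<^sub>F n in sequentially. c < D n t j w \<bullet> w"
      proof eventually_elim
        case (elim n)
        have "G n t w \<bullet> w - s * (D n t j w \<bullet> w) \<le> x n \<bullet> G n t w" using s by (intro tangent t x) auto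
        then have "- (D n t j w \<bullet> w) \<le> (x n \<bullet> G n t w - G n t w \<bullet> w) / s" using s by (simp add: field_simps)
        then show ?case using elim by linarith
      qed
    next
      fix c assume c: "DL t j w \<bullet> w < c"
      have "\<forall>\<^sub>F s in at_left 0. - c < q s"
        using c by (intro order_tendstoD(1)[OF filterlim_mono[OF q order_refl]]) (auto simp: at_le)
      moreover have "\<forall>\<^sub>F s in at_left 0. s \<in> {- (r / 2)<..<0}" using r by (intro eventually_at_left_real) auto
      ultimately have "\<forall>\<^sub>F s in at_left 0. - c < q s \<and> s \<in> {- (r / 2)<..<0}" by eventually_elim auto
      then obtain s where s: "- c < q s" "s < 0" "- (r / 2) < s"
        using eventually_happens'[OF trivial_limit_at_left_real] by fastforce
      have s': "\<bar>s\<bar> < r / 2" using s by auto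
      have "\<forall>n. \<exists>x. G n (t + s *\<^sub>R j) x = G n t w"
        using positive_definite_surj[OF pos[OF inU[OF t s']]] by metis
      then obtain x where x: "\<And>n. G n (t + s *\<^sub>R j) (x n) = G n t w" by metis
      have "\<forall>\<^sub>F n in sequentially. - c < (x n \<bullet> G n t w - G n t w \<bullet> w) / s"
        using s s' x by (intro order_tendstoD(1)[OF limx]) auto
      then show "\<forall>\<^sub>F n in sequentially. D n t j w \<bullet> w < c"
      proof eventually_elim
        case (elim n)
        have "G n t w \<bullet> w - s * (D n t j w \<bullet> w) \<le> x n \<bullet> G n t w" using s' by (intro tangent t x) auto
        then have "(x n \<bullet> G n t w - G n t w \<bullet> w) / s \<le> - (D n t j w \<bullet> w)" using s by (simp add: field_simps)
        then show ?case using elim by linarith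
      qed
    qed
  qed
  have saD: "self_adjoint (D n t j)" "self_adjoint (DL t j)" if "t \<in> V" for n t j
    using that VU by (auto intro!: C2_self_adjoint(1)[OF C2 open_ball sa] C2_self_adjoint(1)[OF C2' open_ball sa0])
  have Dlim: "(\<lambda>n. D n t j v) \<longlonglongrightarrow> DL t j v" if t: "t \<in> V" "j \<in> Basis" for t j v
    by (rule tendsto_self_adjoint[OF saD(1)[OF t(1)] saD(2)[OF t(1)] Dlim_form[OF t]])

  define p where "p n t = (\<Sum>j\<in>Basis. D n t j (u j))" for n t
  define p0 where "p0 t = (\<Sum>j\<in>Basis. DL t j (u j))" for t
  have "\<forall>n t. \<exists>y. t \<in> ?U \<longrightarrow> G n t y = p n t" using positive_definite_surj[OF pos] by metis
  then obtain y where y: "\<And>n t. t \<in> ?U \<Longrightarrow> G n t (y n t) = p n t" by metis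
  have "\<forall>t. \<exists>y. t \<in> ?U \<longrightarrow> GL t y = p0 t" using positive_definite_surj[OF pos0] by metis
  then obtain y0 where y0: "\<And>t. t \<in> ?U \<Longrightarrow> GL t (y0 t) = p0 t" by metis
  have contD: "continuous_on V (\<lambda>t. D n t j)" "continuous_on V (\<lambda>t. DL t j)" for n j
    using C1(2)[THEN C1_cont] C1'(2)[THEN C1_cont] VU by (auto intro: continuous_on_subset)
  have contG: "continuous_on V (G n)" "continuous_on V GL" for n
    using C1(1)[THEN C1_cont] C1'(1)[THEN C1_cont] VU by (auto intro: continuous_on_subset)
  have contp: "continuous_on V (p n)" "continuous_on V p0" for n
    unfolding p_def p0_def by (intro continuous_intros contD)+
  have conty: "continuous_on V (y n)" for n
    unfolding continuous_on_def
  proof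
    fix t assume t: "t \<in> V"
    then have tU: "t \<in> ?U" using VU by auto
    show "(y n \<longlongrightarrow> y n t) (at t within V)"
    proof (rule blinfun.tendsto_solution[OF _ _ _ y[OF tU] l(1)])
      show "(G n \<longlongrightarrow> G n t) (at t within V)" "(p n \<longlongrightarrow> p n t) (at t within V)"
        using contG(1)[of n] contp(1)[of n] t by (auto simp: continuous_on_def)
      show "\<forall>\<^sub>F t in at t within V. G n t (y n t) = p n t"
        unfolding eventually_at_filter by (intro always_eventually allI impI y subsetD[OF VU])
    qed (rule coercive_norm_le[OF l(2)[OF tU]])
  qed
  have conty0: "continuous_on V y0"
    unfolding continuous_on_def
  proof
    fix t assume t: "t \<in> V"
    then have tU: "t \<in> ?U" using VU by auto
    show "(y0 \<longlongrightarrow> y0 t) (at t within V)"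
    proof (rule blinfun.tendsto_solution[OF _ _ _ y0[OF tU] l(1)])
      show "(GL \<longlongrightarrow> GL t) (at t within V)" "(p0 \<longlongrightarrow> p0 t) (at t within V)"
        using contG(2) contp(2) t by (auto simp: continuous_on_def)
      show "\<forall>\<^sub>F t in at t within V. GL t (y0 t) = p0 t"
        unfolding eventually_at_filter by (intro always_eventually allI impI y0 subsetD[OF VU])
    qed (rule coercive_norm_le[OF l0[OF tU]])
  qed
  have plim: "(\<lambda>n. p n t) \<longlonglongrightarrow> p0 t" if "t \<in> V" for t
    unfolding p_def p0_def by (intro tendsto_sum Dlim that)
  have ylim: "(\<lambda>n. y n t) \<longlonglongrightarrow> y0 t" if t: "t \<in> V" for t
  proof -
    have tU: "t \<in> ?U" using VU t by auto
    show ?thesis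
      by (rule blinfun.tendsto_solution[OF nlim[OF tU] plim[OF t] _ y0[OF tU] l(1)])
         (use y[OF tU] coercive_norm_le[OF l0[OF tU]] in auto)
  qed
  define f where "f n t = y n t \<bullet> p n t" for n t
  define f0 where "f0 t = y0 t \<bullet> p0 t" for t
  have flim: "(\<lambda>n. f n t) \<longlonglongrightarrow> f0 t" if "t \<in> V" for t
    unfolding f_def f0_def by (intro tendsto_intros ylim plim that)
  have contf: "continuous_on V (f n)" "continuous_on V f0" for n
    unfolding f_def f0_def by (intro continuous_intros conty contp conty0)+
  define F where "F = (\<Sum>j\<in>(Basis :: 'a set). K * norm (u j))\<^sup>2 / l"
  have fF: "\<bar>f n t\<bar> \<le> F" if t: "t \<in> V" for n t
  proof -
    have tU: "t \<in> ?U" using VU t by auto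
    have p: "norm (p n t) \<le> (\<Sum>j\<in>(Basis :: 'a set). K * norm (u j))"
      unfolding p_def by (intro sum_norm_le order_trans[OF norm_blinfun] mult_right_mono K t) auto
    have "\<bar>f n t\<bar> \<le> norm (y n t) * norm (p n t)" unfolding f_def by (rule Cauchy_Schwarz_ineq2)
    also have "\<dots> \<le> norm (p n t) / l * norm (p n t)" by (intro mult_right_mono norm_sol[OF tU y[OF tU]]) auto
    also have "\<dots> = (norm (p n t))\<^sup>2 / l" by (simp add: power2_eq_square)
    also have "\<dots> \<le> F" unfolding F_def using l(1) p by (intro divide_right_mono power_mono) auto
    finally show ?thesis .
  qed
  define A where "A n t = (\<Sum>j\<in>Basis. \<Sum>k\<in>Basis. DD n t j k (u j) \<bullet> u k)" for n t
  define A0 where "A0 t = (\<Sum>j\<in>Basis. \<Sum>k\<in>Basis. DDL t j k (u j) \<bullet> u k)" for t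
  have Af: "A n t \<le> f n t" if "t \<in> ?U" for n t
    using nakanoD[OF nak[OF that], of n "y n t" u] y[OF that, of n]
    by (simp add: A_def f_def p_def inner_commute)

  \<comment> \<open>Integration by parts moves the second derivatives to the test function, so that no convergence of
    second derivatives is required.\<close>
  have tested: "(\<integral>t. \<psi> t * A0 t \<partial>lborel) \<le> (\<integral>t. \<psi> t * f0 t \<partial>lborel) \<and>
      integrable lborel (\<lambda>t. \<psi> t * A0 t) \<and> integrable lborel (\<lambda>t. \<psi> t * f0 t)"
    if \<psi>: "C2 UNIV \<psi> D\<psi> DD\<psi>" "\<And>t. 0 \<le> \<psi> t" and P: "compact P" "P \<subseteq> V" "\<And>t. t \<notin> P \<Longrightarrow> \<psi> t = 0"
    for \<psi> D\<psi> DD\<psi> P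
  proof -
    define \<theta> where "\<theta> n k j t = G n t (u j) \<bullet> u k" for n k j t
    define \<theta>0 where "\<theta>0 k j t = GL t (u j) \<bullet> u k" for k j t
    have bl: "bounded_linear (\<lambda>B. blinfun_apply B (u j) \<bullet> u k)" for j k
      by (intro bounded_linear_compose[OF bounded_linear_inner_left] blinfun.bounded_linear_left)
    have PU: "P \<subseteq> ?U" using P(2) VU by auto
    have \<theta>: "C2 ?U (\<theta> n k j) (\<lambda>t h. D n t h (u j) \<bullet> u k) (\<lambda>t h i. DD n t h i (u j) \<bullet> u k)" for n k j
      unfolding \<theta>_def by (rule C2_bounded_linear[OF bl C2])
    have \<theta>0: "C2 ?U (\<theta>0 k j) (\<lambda>t h. DL t h (u j) \<bullet> u k) (\<lambda>t h i. DDL t h i (u j) \<bullet> u k)" for k j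
      unfolding \<theta>0_def by (rule C2_bounded_linear[OF bl C2'])
    note parts = integral_by_parts2[OF \<psi>(1) \<theta> open_ball P(1) PU P(3)]
    note parts0 = integral_by_parts2[OF \<psi>(1) \<theta>0 open_ball P(1) PU P(3)]
    have eqA: "(\<lambda>t. \<psi> t * A n t) = (\<lambda>t. \<Sum>j\<in>Basis. \<Sum>k\<in>Basis. \<psi> t * (DD n t j k (u j) \<bullet> u k))" for n
      by (simp add: A_def sum_distrib_left)
    have eqA0: "(\<lambda>t. \<psi> t * A0 t) = (\<lambda>t. \<Sum>j\<in>Basis. \<Sum>k\<in>Basis. \<psi> t * (DDL t j k (u j) \<bullet> u k))"
      by (simp add: A0_def sum_distrib_left)
    have intA: "integrable lborel (\<lambda>t. \<psi> t * A n t)" for n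
      unfolding eqA by (intro Bochner_Integration.integrable_sum parts)
    have intA0: "integrable lborel (\<lambda>t. \<psi> t * A0 t)"
      unfolding eqA0 by (intro Bochner_Integration.integrable_sum parts0)
    have cont\<psi>: "continuous_on X \<psi>" for X
      using \<psi>(1) by (auto simp: C2_def intro: continuous_on_subset C1_cont)
    have intf: "integrable lborel (\<lambda>t. \<psi> t * f n t)" for n
      using P by (intro integrable_compact_support[OF P(1)] continuous_intros cont\<psi> continuous_on_subset[OF contf(1) P(2)]) auto
    have intf0: "integrable lborel (\<lambda>t. \<psi> t * f0 t)"
      using P by (intro integrable_compact_support[OF P(1)] continuous_intros cont\<psi> continuous_on_subset[OF contf(2) P(2)]) auto
    have int\<psi>: "integrable lborel \<psi>" using P by (intro integrable_compact_support[OF P(1)] cont\<psi>)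
    have "(\<lambda>n. \<integral>t. \<psi> t * f n t \<partial>lborel) \<longlonglongrightarrow> (\<integral>t. \<psi> t * f0 t \<partial>lborel)"
    proof (rule integral_dominated_convergence[where w = "\<lambda>t. \<psi> t * F"])
      show "AE t in lborel. (\<lambda>n. \<psi> t * f n t) \<longlonglongrightarrow> \<psi> t * f0 t"
      proof (rule AE_I2)
        fix t show "(\<lambda>n. \<psi> t * f n t) \<longlonglongrightarrow> \<psi> t * f0 t"
          using flim[of t] P(2) P(3)[of t] by (cases "t \<in> P") (auto intro!: tendsto_intros)
      qed
      fix n show "AE t in lborel. norm (\<psi> t * f n t) \<le> \<psi> t * F"
      proof (rule AE_I2)
        fix t show "norm (\<psi> t * f n t) \<le> \<psi> t * F"
          using fF[of t n] P(2) P(3)[of t] \<psi>(2)[of t] by (cases "t \<in> P") (auto simp: abs_mult intro!: mult_left_mono)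
      qed
    qed (use intf intf0 int\<psi> in auto)
    moreover have "(\<lambda>n. \<integral>t. \<psi> t * A n t \<partial>lborel) \<longlonglongrightarrow> (\<integral>t. \<psi> t * A0 t \<partial>lborel)"
    proof -
      have "(\<lambda>n. \<integral>t. DD\<psi> t k j * \<theta> n k j t \<partial>lborel) \<longlonglongrightarrow> (\<integral>t. DD\<psi> t k j * \<theta>0 k j t \<partial>lborel)" for j k
      proof (rule integral_dominated_convergence[where w = "\<lambda>t. norm (DD\<psi> t k j) * (\<Lambda> * norm (u j) * norm (u k))"])
        have C1\<psi>: "C1 UNIV \<psi> D\<psi>" "C1 UNIV (\<lambda>z. D\<psi> z j) (\<lambda>z k. DD\<psi> z k j)" using \<psi>(1) by (auto simp: C2_def)
        have 1: "D\<psi> t j = 0" if "t \<notin> P" for t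
          using C1_extend_zero(2)[OF C1\<psi>(1) open_UNIV compact_imp_closed[OF P(1)] _ P(3)] that by simp
        have 2: "DD\<psi> t k j = 0" if "t \<notin> P" for t
          using C1_extend_zero(2)[OF C1\<psi>(2) open_UNIV compact_imp_closed[OF P(1)] _ 1] that by simp
        have "continuous_on UNIV (\<lambda>t. DD\<psi> t k j)" using C1\<psi>(2) by (simp add: C1_def)
        then have "continuous_on P (\<lambda>t. DD\<psi> t k j)" by (rule continuous_on_subset) simp
        then show "integrable lborel (\<lambda>t. norm (DD\<psi> t k j) * (\<Lambda> * norm (u j) * norm (u k)))"
          using 2 by (intro integrable_compact_support[OF P(1)] continuous_intros) auto
        show "AE t in lborel. (\<lambda>n. DD\<psi> t k j * \<theta> n k j t) \<longlonglongrightarrow> DD\<psi> t k j * \<theta>0 k j t"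
        proof (rule AE_I2)
          fix t show "(\<lambda>n. DD\<psi> t k j * \<theta> n k j t) \<longlonglongrightarrow> DD\<psi> t k j * \<theta>0 k j t"
            using 2[of t] PU by (cases "t \<in> P") (auto simp: \<theta>_def \<theta>0_def intro!: tendsto_intros lim)
        qed
        fix n show "AE t in lborel. norm (DD\<psi> t k j * \<theta> n k j t) \<le> norm (DD\<psi> t k j) * (\<Lambda> * norm (u j) * norm (u k))"
        proof (rule AE_I2)
          fix t
          show "norm (DD\<psi> t k j * \<theta> n k j t) \<le> norm (DD\<psi> t k j) * (\<Lambda> * norm (u j) * norm (u k))"
          proof (cases "t \<in> P")
            case True
            then have tU: "t \<in> ?U" using PU by auto
            have "\<bar>\<theta> n k j t\<bar> \<le> norm (G n t (u j)) * norm (u k)" unfolding \<theta>_def by (rule Cauchy_Schwarz_ineq2)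
            also have "\<dots> \<le> (norm (G n t) * norm (u j)) * norm (u k)" by (intro mult_right_mono norm_blinfun) auto
            also have "\<dots> \<le> \<Lambda> * norm (u j) * norm (u k)" by (intro mult_right_mono \<Lambda> tU) auto
            finally show ?thesis by (auto simp: abs_mult intro!: mult_left_mono)
          qed (simp add: 2)
        qed
      qed (use parts(2) parts0(2) in auto)
      then show ?thesis
        unfolding eqA eqA0
        by (simp add: Bochner_Integration.integral_sum Bochner_Integration.integrable_sum parts parts0 tendsto_sum)
    qed
    moreover have "(\<integral>t. \<psi> t * A n t \<partial>lborel) \<le> (\<integral>t. \<psi> t * f n t \<partial>lborel)" for n
    proof (rule integral_mono[OF intA intf])
      fix t show "\<psi> t * A n t \<le> \<psi> t * f n t"
        using Af[of t n] P(3)[of t] PU \<psi>(2)[of t] by (cases "t \<in> P") (auto intro!: mult_left_mono)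
    qed
    ultimately have "(\<integral>t. \<psi> t * A0 t \<partial>lborel) \<le> (\<integral>t. \<psi> t * f0 t \<partial>lborel)"
      by (intro LIMSEQ_le) auto
    then show ?thesis using intA0 intf0 by blast
  qed

  have t0: "t0 \<in> V" "t0 \<in> ?U" using r by (auto simp: V_def)
  \<comment> \<open>A strict violation at \<open>t0\<close> would persist nearby and show up against a cutoff supported there.\<close>
  have "A0 t0 \<le> f0 t0"
  proof (rule ccontr)
    assume "\<not> A0 t0 \<le> f0 t0"
    define e where "e = (A0 t0 - f0 t0) / 2"
    have e: "e > 0" using \<open>\<not> A0 t0 \<le> f0 t0\<close> by (simp add: e_def)
    have contA0: "continuous_on V A0"
    proof -
      have "continuous_on V (\<lambda>t. DDL t j k)" for j k
        using C1'(2)[of k] VU by (auto simp: C1_def intro: continuous_on_subset)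
      then show ?thesis unfolding A0_def by (intro continuous_intros)
    qed
    have "continuous_on V (\<lambda>t. A0 t - f0 t)" by (intro continuous_intros contA0 contf)
    then have "((\<lambda>t. A0 t - f0 t) \<longlongrightarrow> A0 t0 - f0 t0) (at t0 within V)" using t0 by (auto simp: continuous_on_def)
    moreover have "e < A0 t0 - f0 t0" using e by (simp add: e_def)
    ultimately have "\<forall>\<^sub>F t in at t0 within V. e < A0 t - f0 t" by (rule order_tendstoD(1))
    then obtain d where d: "d > 0" "\<And>t. t \<in> V \<Longrightarrow> t \<noteq> t0 \<Longrightarrow> dist t t0 < d \<Longrightarrow> e < A0 t - f0 t"
      by (auto simp: eventually_at)
    define d' where "d' = min d (r / 2)"
    have d': "0 < d'" using d r by (simp add: d'_def)
    have big: "e \<le> A0 t - f0 t" if "t \<in> ball t0 d'" for t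
      using d(2)[of t] that e by (cases "t = t0") (auto simp: d'_def V_def e_def dist_commute)
    have sub: "cball t0 (d' / 2) \<subseteq> ball t0 d'" and ne: "cball t0 (d' / 2) \<noteq> {}" using d' by auto
    obtain L P where LP: "finite L" "compact P" "P \<subseteq> ball t0 d'"
      "\<And>t. t \<in> cball t0 (d' / 2) \<Longrightarrow> cutoff_prod L t = 1" "\<And>t. t \<notin> P \<Longrightarrow> cutoff_prod L t = 0"
      by (rule separating_cutoffs[OF open_ball convex_ball compact_cball sub ne]) blast
    obtain D\<psi> DD\<psi> where \<psi>: "C2 UNIV (cutoff_prod L :: 'a \<Rightarrow> real) D\<psi> DD\<psi>" using C2_cutoff_prod[OF LP(1)] by blast
    have PV: "P \<subseteq> V" using LP(3) by (auto simp: d'_def V_def)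
    let ?\<psi> = "cutoff_prod L"
    from tested[OF \<psi> cutoff_prod_range(1) LP(2) PV LP(5)]
    have T: "(\<integral>t. ?\<psi> t * A0 t \<partial>lborel) \<le> (\<integral>t. ?\<psi> t * f0 t \<partial>lborel)"
      "integrable lborel (\<lambda>t. ?\<psi> t * A0 t)" "integrable lborel (\<lambda>t. ?\<psi> t * f0 t)" by auto
    have ind: "integrable lborel (\<lambda>t. e * indicator (cball t0 (d' / 2)) t :: real)"
      by (intro integrable_mult_right) (auto intro!: emeasure_compact_finite)
    have "0 < e * measure lborel (cball t0 (d' / 2))" using e d' by (intro mult_pos_pos content_cball_pos) auto
    also have "\<dots> = (\<integral>t. e * indicator (cball t0 (d' / 2)) t \<partial>lborel)" by simp
    also have "\<dots> \<le> (\<integral>t. ?\<psi> t * A0 t - ?\<psi> t * f0 t \<partial>lborel)"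
    proof (rule integral_mono[OF ind])
      show "integrable lborel (\<lambda>t. ?\<psi> t * A0 t - ?\<psi> t * f0 t)" using T by simp
      fix t
      have "0 \<le> ?\<psi> t * (A0 t - f0 t)"
        using big[of t] e LP(3) LP(5)[of t] cutoff_prod_range(1)[of L t] by (cases "t \<in> P") auto
      moreover have "e \<le> ?\<psi> t * (A0 t - f0 t)" if "t \<in> cball t0 (d' / 2)"
        using big[of t] LP(4)[OF that] that d' by auto
      ultimately show "e * indicator (cball t0 (d' / 2)) t \<le> ?\<psi> t * A0 t - ?\<psi> t * f0 t"
        by (auto simp: indicator_def algebra_simps)
    qed
    also have "\<dots> = (\<integral>t. ?\<psi> t * A0 t \<partial>lborel) - (\<integral>t. ?\<psi> t * f0 t \<partial>lborel)" using T by simp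
    finally show False using T(1) by linarith
  qed
  moreover have "y0 t0 = y00"
    using pos0[OF t0(2), of "y0 t0 - y00"] y0[OF t0(2)] y00 by (force simp: p0_def blinfun.diff_right)
  ultimately show "(\<Sum>j\<in>Basis. \<Sum>k\<in>Basis. DDL t0 j k (u j) \<bullet> u k) \<le> GL t0 y00 \<bullet> y00"
    using y00 by (simp add: A0_def f0_def p0_def inner_commute)
qed

section \<open>Matrices as operators\<close>

text \<open>
  Complex vectors are regarded as a real Euclidean space, whose inner product is the real part of the
  Hermitian one.
\<close>

definition matrix_op :: "complex ^ 'r ^ 'r \<Rightarrow> (complex ^ 'r) \<Rightarrow>\<^sub>L (complex ^ 'r)"
  where "matrix_op A = Blinfun ((*v) A)"

lemma matrix_op_apply: "blinfun_apply (matrix_op A) v = A *v v"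
  unfolding matrix_op_def by (subst bounded_linear_Blinfun_apply) auto

lemma bounded_linear_matrix_op: "bounded_linear matrix_op"
proof -
  have "linear matrix_op"
  proof (rule linearI)
    fix A B :: "complex ^ 'r ^ 'r" and c
    show "matrix_op (A + B) = matrix_op A + matrix_op B"
      by (rule blinfun_eqI) (simp add: matrix_op_apply blinfun.add_left matrix_vector_mult_add_rdistrib)
    show "matrix_op (c *\<^sub>R A) = c *\<^sub>R matrix_op A"
      by (rule blinfun_eqI) (simp add: matrix_op_apply blinfun.scaleR_left vec_eq_iff
          matrix_vector_mult_def scaleR_sum_right)
  qed
  then show ?thesis by (simp add: linear_conv_bounded_linear)
qed

lemma bounded_bilinear_matrix_mult:
  "bounded_bilinear ((**) :: complex ^ 'r ^ 'r \<Rightarrow> complex ^ 'r ^ 'r \<Rightarrow> complex ^ 'r ^ 'r)"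
proof -
  have "bilinear ((**) :: complex ^ 'r ^ 'r \<Rightarrow> complex ^ 'r ^ 'r \<Rightarrow> complex ^ 'r ^ 'r)"
    unfolding bilinear_def
    by (intro conjI allI linearI)
       (simp_all add: vec_eq_iff matrix_matrix_mult_def sum.distrib scaleR_sum_right algebra_simps)
  then show ?thesis by (simp add: bilinear_conv_bounded_bilinear)
qed

definition cdot :: "complex ^ 'r \<Rightarrow> complex ^ 'r \<Rightarrow> complex"
  where "cdot w v = (\<Sum>i\<in>UNIV. cnj (v $ i) * w $ i)"

lemma Re_cdot: "Re (cdot w v) = w \<bullet> v"
  by (simp add: cdot_def inner_vec_def inner_complex_def mult.commute)

lemma inner_of_cdot: "inner_of A u v = cdot (A *v u) v"
  by (simp add: inner_of_def cdot_def)

lemma cdot_linear: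
  "cdot (w + w') v = cdot w v + cdot w' v" "cdot (w - w') v = cdot w v - cdot w' v"
  "cdot (- w) v = - cdot w v" "cdot w (v + v') = cdot w v + cdot w v'" "cdot 0 v = 0" "cdot w 0 = 0"
  by (simp_all add: cdot_def sum.distrib sum_subtractf sum_negf algebra_simps)

lemma cdot_sum: "cdot (sum f S) v = (\<Sum>j\<in>S. cdot (f j) v)" "cdot w (sum f S) = (\<Sum>j\<in>S. cdot w (f j))"
  by (induction S rule: infinite_finite_induct) (simp_all add: cdot_linear)

lemma cnj_cdot: "cnj (cdot w v) = cdot v w"
  by (simp add: cdot_def mult.commute)

lemma hermitian_cdot:
  assumes "hermitian_matrix A"
  shows "cdot (A *v u) v = cdot u (A *v v)"
proof -
  have A: "cnj (A $ i $ j) = A $ j $ i" for i j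
  proof -
    have "map_matrix cnj (transpose A) $ j $ i = A $ j $ i"
      using assms by (simp add: hermitian_matrix_def)
    then show ?thesis by (simp add: map_matrix_def transpose_def)
  qed
  have "cdot (A *v u) v = (\<Sum>i\<in>UNIV. \<Sum>j\<in>UNIV. cnj (v $ i) * (A $ i $ j * u $ j))"
    by (simp add: cdot_def matrix_vector_mult_def sum_distrib_left)
  also have "\<dots> = (\<Sum>j\<in>UNIV. \<Sum>i\<in>UNIV. cnj (v $ i) * (A $ i $ j * u $ j))" by (rule sum.swap)
  also have "\<dots> = cdot u (A *v v)"
    by (simp add: cdot_def matrix_vector_mult_def A sum_distrib_left sum_distrib_right mult_ac)
  finally show ?thesis .
qed

lemma hermitian_self_adjoint: "hermitian_matrix A \<Longrightarrow> self_adjoint (matrix_op A)"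
  using hermitian_cdot[of A] by (simp add: self_adjoint_def matrix_op_apply Re_cdot[symmetric])

lemma matrix_inv_mult:
  fixes A :: "complex ^ 'r ^ 'r"
  assumes "invertible A"
  shows "matrix_inv A ** A = mat 1" "A ** matrix_inv A = mat 1"
  using assms someI_ex[of "\<lambda>B. A ** B = mat 1 \<and> B ** A = mat 1"]
  by (auto simp: invertible_def matrix_inv_def)

section \<open>Partial derivatives\<close>

lemma partial_deriv_eq:
  fixes f :: "'a::euclidean_space \<Rightarrow> 'b::real_normed_vector"
  assumes "(f has_derivative f') (at x)"
  shows "partial_deriv b f x = f' b" "((\<lambda>s. f (x + s *\<^sub>R b)) has_vector_derivative f' b) (at 0)"
proof -
  interpret bounded_linear f' using assms by (rule has_derivative_bounded_linear)
  have "((\<lambda>s. x + s *\<^sub>R b) has_derivative (\<lambda>r. r *\<^sub>R b)) (at 0)"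
    by (auto intro!: derivative_eq_intros)
  moreover have "(f has_derivative f') (at (x + 0 *\<^sub>R b))" using assms by simp
  ultimately show d: "((\<lambda>s. f (x + s *\<^sub>R b)) has_vector_derivative f' b) (at 0)"
    unfolding has_vector_derivative_def using diff_chain_at[of "\<lambda>s. x + s *\<^sub>R b" "\<lambda>r. r *\<^sub>R b" 0 f f']
    by (simp add: o_def scaleR)
  then show "partial_deriv b f x = f' b" unfolding partial_deriv_def by (rule vector_derivative_at)
qed

definition grad :: "('a::euclidean_space \<Rightarrow> 'b::real_normed_vector) \<Rightarrow> 'a \<Rightarrow> 'a \<Rightarrow> 'b"
  where "grad f x h = (\<Sum>j\<in>Basis. (h \<bullet> j) *\<^sub>R partial_deriv j f x)"

definition hess :: "('a::euclidean_space \<Rightarrow> 'b::real_normed_vector) \<Rightarrow> 'a \<Rightarrow> 'a \<Rightarrow> 'a \<Rightarrow> 'b"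
  where "hess f x k h = (\<Sum>j\<in>Basis. (h \<bullet> j) *\<^sub>R grad (partial_deriv j f) x k)"

lemma sum_Basis_scaleR:
  fixes f :: "'a::euclidean_space \<Rightarrow> 'b::real_normed_vector"
  assumes "b \<in> Basis" shows "(\<Sum>j\<in>Basis. (b \<bullet> j) *\<^sub>R f j) = f b"
proof -
  have "(\<Sum>j\<in>Basis. (b \<bullet> j) *\<^sub>R f j) = (\<Sum>j\<in>Basis. if j = b then f b else 0)"
    using assms by (intro sum.cong) (auto simp: inner_Basis)
  then show ?thesis using assms by simp
qed

lemma grad_Basis: "b \<in> Basis \<Longrightarrow> grad f x b = partial_deriv b f x"
  by (simp add: grad_def sum_Basis_scaleR)

lemma hess_Basis: "j \<in> Basis \<Longrightarrow> k \<in> Basis \<Longrightarrow> hess f x k j = partial_deriv k (partial_deriv j f) x"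
  by (simp add: hess_def sum_Basis_scaleR grad_Basis)

lemma differentiable_grad:
  fixes f :: "'a::euclidean_space \<Rightarrow> 'b::real_normed_vector"
  assumes "f differentiable (at x)"
  shows "(f has_derivative grad f x) (at x)"
proof -
  obtain f' where f': "(f has_derivative f') (at x)" using assms by (auto simp: differentiable_def)
  interpret bounded_linear f' using f' by (rule has_derivative_bounded_linear)
  have "f' h = grad f x h" for h
  proof -
    have "f' h = f' (\<Sum>j\<in>Basis. (h \<bullet> j) *\<^sub>R j)" by (simp add: euclidean_representation)
    also have "\<dots> = grad f x h" by (simp add: sum scaleR grad_def partial_deriv_eq(1)[OF f'])
    finally show ?thesis .
  qed
  then have "f' = grad f x" by auto
  then show ?thesis using f' by simp
qed

lemma Ck_on_2_C2:
  assumes "Ck_on 2 U f"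
  shows "C2 U f (grad f) (hess f)"
proof -
  have f: "\<And>x. x \<in> U \<Longrightarrow> f differentiable (at x)"
    "\<And>b x. b \<in> Basis \<Longrightarrow> x \<in> U \<Longrightarrow> partial_deriv b f differentiable (at x)"
    "\<And>b c. b \<in> Basis \<Longrightarrow> c \<in> Basis \<Longrightarrow> continuous_on U (partial_deriv c (partial_deriv b f))"
    using assms by (auto simp: numeral_2_eq_2)
  have cont: "continuous_on U (partial_deriv b f)" if "b \<in> Basis" for b
    using f(2)[OF that] by (intro continuous_at_imp_continuous_on) (auto intro: differentiable_imp_continuous_within)
  show ?thesis
    unfolding C2_def C1_def
  proof (intro conjI ballI allI)
    fix x assume "x \<in> U" then show "(f has_derivative grad f x) (at x)" by (intro differentiable_grad f)
  next
    fix h show "continuous_on U (\<lambda>x. grad f x h)" unfolding grad_def by (intro continuous_intros cont)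
  next
    fix h x assume x: "x \<in> U"
    have "((\<lambda>x. \<Sum>j\<in>Basis. (h \<bullet> j) *\<^sub>R partial_deriv j f x) has_derivative
        (\<lambda>k. \<Sum>j\<in>Basis. (h \<bullet> j) *\<^sub>R grad (partial_deriv j f) x k)) (at x)"
      using x by (intro has_derivative_sum has_derivative_scaleR_right differentiable_grad f)
    then show "((\<lambda>x. grad f x h) has_derivative (\<lambda>k. hess f x k h)) (at x)"
      by (simp add: grad_def[abs_def] hess_def[abs_def])
  next
    fix h k show "continuous_on U (\<lambda>x. hess f x k h)"
      unfolding hess_def grad_def by (intro continuous_intros f) auto
  qed
qed

section \<open>The curvature of a Hermitian metric\<close>

text \<open>
  The field \<open>X = G\<^sup>-\<^sup>1 \<partial>\<^sub>j G\<close> solves \<open>G X = \<partial>\<^sub>j G\<close>; differentiating this equation avoids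
  differentiating the inverse matrix.
\<close>

lemma curvature_eq:
  fixes G :: "'a::euclidean_space \<Rightarrow> complex ^ 'r ^ 'r"
  assumes U: "open U" "x \<in> U" and C2: "Ck_on 2 U G" and inv: "\<And>x. x \<in> U \<Longrightarrow> invertible (G x)"
    and jk: "j \<in> Basis" "k \<in> Basis"
  shows "G x ** curvature G j k x
    = partial_deriv k G x ** (matrix_inv (G x) ** partial_deriv j G x) - partial_deriv k (partial_deriv j G) x"
proof -
  interpret mm: bounded_bilinear "(**) :: complex ^ 'r ^ 'r \<Rightarrow> complex ^ 'r ^ 'r \<Rightarrow> complex ^ 'r ^ 'r"
    by (rule bounded_bilinear_matrix_mult)
  define X where "X s = matrix_inv (G (x + s *\<^sub>R k)) ** partial_deriv j G (x + s *\<^sub>R k)" for s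
  define q where "q = matrix_inv (G x) ** (partial_deriv k (partial_deriv j G) x - partial_deriv k G x ** X 0)"
  have d: "G differentiable (at x)" "partial_deriv j G differentiable (at x)"
    using C2 U(2) jk by (auto simp: numeral_2_eq_2)
  have dG: "((\<lambda>s. G (x + s *\<^sub>R k)) has_vector_derivative partial_deriv k G x) (at 0)"
    using partial_deriv_eq[OF differentiable_grad[OF d(1)], of k] by simp
  have dD: "((\<lambda>s. partial_deriv j G (x + s *\<^sub>R k)) has_vector_derivative partial_deriv k (partial_deriv j G) x) (at 0)"
    using partial_deriv_eq[OF differentiable_grad[OF d(2)], of k] by simp
  have Gq: "G x ** q = partial_deriv k (partial_deriv j G) x - partial_deriv k G x ** X 0"
    unfolding q_def matrix_mul_assoc matrix_inv_mult(2)[OF inv[OF U(2)]] by simp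
  obtain K where K: "K > 0" "\<And>(A :: complex ^ 'r ^ 'r) (B :: complex ^ 'r ^ 'r). norm (A ** B) \<le> norm A * norm B * K"
    using mm.pos_bounded by blast
  define l where "l = 1 / (norm (matrix_inv (G x)) * K + 1)"
  have l: "0 < l" using K(1) by (simp add: l_def add_nonneg_pos)
  have coercive: "l * norm Y \<le> norm (G x ** Y)" for Y :: "complex ^ 'r ^ 'r"
  proof -
    have "Y = matrix_inv (G x) ** (G x ** Y)"
      unfolding matrix_mul_assoc matrix_inv_mult(1)[OF inv[OF U(2)]] by simp
    then have "norm Y \<le> norm (matrix_inv (G x)) * norm (G x ** Y) * K"
      using K(2)[of "matrix_inv (G x)" "G x ** Y"] by simp
    also have "\<dots> \<le> (norm (matrix_inv (G x)) * K + 1) * norm (G x ** Y)" by (simp add: algebra_simps)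
    finally show ?thesis using K(1) add_nonneg_pos[of "norm (matrix_inv (G x)) * K" 1]
      by (simp add: l_def field_simps)
  qed
  have "(X has_vector_derivative q) (at 0)"
  proof (rule mm.has_vector_derivative_solution[OF dG dD])
    have "open ((\<lambda>s. x + s *\<^sub>R k) -` U)" using U(1) by (intro open_vimage continuous_intros)
    then have "\<forall>\<^sub>F s in nhds 0. s \<in> (\<lambda>s. x + s *\<^sub>R k) -` U" using U(2) by (intro eventually_nhds_in_open) auto
    then show "\<forall>\<^sub>F s in nhds 0. G (x + s *\<^sub>R k) ** X s = partial_deriv j G (x + s *\<^sub>R k)"
    proof eventually_elim
      case (elim s)
      then have "invertible (G (x + s *\<^sub>R k))" by (intro inv) simp
      then show ?case unfolding X_def matrix_mul_assoc by (simp add: matrix_inv_mult)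
    qed
    show "G (x + 0 *\<^sub>R k) ** q = partial_deriv k (partial_deriv j G) x - partial_deriv k G x ** X 0" using Gq by simp
    show "l * norm Y \<le> norm (G (x + 0 *\<^sub>R k) ** Y)" for Y :: "complex ^ 'r ^ 'r"
      using coercive[of Y] by simp
  qed (rule l)
  then have "curvature G j k x = - q"
    unfolding curvature_def partial_deriv_def X_def[abs_def] by (subst vector_derivative_at) auto
  then show ?thesis using Gq by (simp add: mm.minus_right X_def)
qed

text \<open>
  The curvature sum equals \<open>y \<bullet> G y - \<Sum>\<^sub>j\<^sub>k (\<partial>\<^sub>j \<partial>\<^sub>k G) u\<^sub>j \<bullet> u\<^sub>k\<close> with \<open>y = G\<^sup>-\<^sup>1 p\<close>. It is real
  because all derivatives of \<open>G\<close> are Hermitian and second derivatives are symmetric.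
\<close>

lemma curvature_sum_nonneg_iff:
  fixes G :: "'a::euclidean_space \<Rightarrow> complex ^ 'r ^ 'r"
  assumes U: "open U" "x \<in> U" and C2: "Ck_on 2 U G" and met: "hermitian_metric_on U G"
  shows "(\<forall>u. (\<Sum>j\<in>Basis. \<Sum>k\<in>Basis. inner_of (G x) (curvature G j k x *v u j) (u k)) \<in> \<real>\<^sub>\<ge>\<^sub>0)
    \<longleftrightarrow> nakano (matrix_op (G x)) (\<lambda>h. matrix_op (grad G x h)) (\<lambda>h k. matrix_op (hess G x h k))"
proof -
  have inv: "\<And>x. x \<in> U \<Longrightarrow> invertible (G x)" and herm: "\<And>x. x \<in> U \<Longrightarrow> hermitian_matrix (G x)"
    using met by (auto simp: hermitian_metric_on_def pos_def_matrix_def)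
  note G2 = Ck_on_2_C2[OF C2]
  let ?Gj = "\<lambda>j. partial_deriv j G x" and ?Gkj = "\<lambda>k j. partial_deriv k (partial_deriv j G) x"
  let ?K = "matrix_inv (G x)"
  have sym: "?Gkj k j = ?Gkj j k" if "j \<in> Basis" "k \<in> Basis" for j k
    using C2_symmetric[OF G2 U, of k j] that by (simp add: hess_Basis)
  have hermD: "hermitian_matrix (grad G x h)" "hermitian_matrix (hess G x k h)" for h k
  proof -
    have bl: "bounded_linear (\<lambda>A :: complex ^ 'r ^ 'r. map_matrix cnj (transpose A) - A)"
    proof -
      have "linear (\<lambda>A :: complex ^ 'r ^ 'r. map_matrix cnj (transpose A) - A)"
        by (rule linearI) (simp_all add: vec_eq_iff map_matrix_def transpose_def algebra_simps)
      then show ?thesis by (simp add: linear_conv_bounded_linear)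
    qed
    have z: "f' x h = 0" if "C1 U f f'" "\<And>x. x \<in> U \<Longrightarrow> f x = 0" "x \<in> U"
      for f :: "'a \<Rightarrow> complex ^ 'r ^ 'r" and f' x h
    proof -
      have "(f has_derivative f' x) (at x)" using that by (auto simp: C1_def)
      moreover have "(f has_derivative (\<lambda>h. 0)) (at x)"
        by (rule has_derivative_transform_within_open[OF has_derivative_const[of 0] U(1) that(3)])
           (use that(2) in auto)
      ultimately have "f' x = (\<lambda>h. 0)" by (rule has_derivative_unique)
      then show ?thesis by simp
    qed
    have C: "C1 U (\<lambda>z. map_matrix cnj (transpose (G z)) - G z) (\<lambda>z h. map_matrix cnj (transpose (grad G z h)) - grad G z h)"
      "\<And>h. C1 U (\<lambda>z. map_matrix cnj (transpose (grad G z h)) - grad G z h)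
        (\<lambda>z k. map_matrix cnj (transpose (hess G z k h)) - hess G z k h)"
      using C2_bounded_linear[OF bl G2] by (auto simp: C2_def)
    have g0: "map_matrix cnj (transpose (grad G y h)) - grad G y h = 0" if "y \<in> U" for y h
      by (rule z[OF C(1) _ that]) (use herm in \<open>simp add: hermitian_matrix_def\<close>)
    show "hermitian_matrix (grad G x h)" using g0[OF U(2)] by (simp add: hermitian_matrix_def)
    show "hermitian_matrix (hess G x k h)"
      using z[OF C(2) g0 U(2)] by (simp add: hermitian_matrix_def)
  qed
  have hj: "hermitian_matrix (?Gj j)" "hermitian_matrix (?Gkj k j)" if "j \<in> Basis" "k \<in> Basis" for j k
    using hermD(1)[of j] hermD(2)[of k j] that by (simp_all add: grad_Basis hess_Basis)
  have main: "(\<Sum>j\<in>Basis. \<Sum>k\<in>Basis. inner_of (G x) (curvature G j k x *v u j) (u k))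
      = complex_of_real ((G x *v y) \<bullet> y - (\<Sum>j\<in>Basis. \<Sum>k\<in>Basis. (?Gkj j k *v u j) \<bullet> u k))"
    if y: "G x *v y = (\<Sum>j\<in>Basis. ?Gj j *v u j)" for u y
  proof -
    let ?S = "\<Sum>j\<in>Basis. \<Sum>k\<in>Basis. inner_of (G x) (curvature G j k x *v u j) (u k)"
    have yK: "y = ?K *v (\<Sum>j\<in>Basis. ?Gj j *v u j)"
      unfolding y[symmetric] by (simp add: matrix_vector_mul_assoc matrix_inv_mult(1)[OF inv[OF U(2)]])
    have summand: "inner_of (G x) (curvature G j k x *v u j) (u k)
        = cdot (?K *v (?Gj j *v u j)) (?Gj k *v u k) - cdot (?Gkj k j *v u j) (u k)"
      if "j \<in> Basis" "k \<in> Basis" for j k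
    proof -
      have "inner_of (G x) (curvature G j k x *v u j) (u k) = cdot ((G x ** curvature G j k x) *v u j) (u k)"
        by (simp add: inner_of_cdot matrix_vector_mul_assoc)
      also have "\<dots> = cdot (?Gj k *v (?K *v (?Gj j *v u j))) (u k) - cdot (?Gkj k j *v u j) (u k)"
      proof -
        have "(G x ** curvature G j k x) *v u j = ?Gj k *v (?K *v (?Gj j *v u j)) - ?Gkj k j *v u j"
          using curvature_eq[OF U C2 inv that]
          by (simp add: matrix_vector_mult_diff_rdistrib matrix_vector_mul_assoc matrix_mul_assoc)
        then show ?thesis by (simp only: cdot_linear)
      qed
      finally show ?thesis using hermitian_cdot[OF hj(1)[OF that(2) that(2)]] by simp
    qed
    have "?S = (\<Sum>j\<in>Basis. \<Sum>k\<in>Basis. cdot (?K *v (?Gj j *v u j)) (?Gj k *v u k))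
        - (\<Sum>j\<in>Basis. \<Sum>k\<in>Basis. cdot (?Gkj k j *v u j) (u k))"
      by (simp add: summand sum_subtractf)
    also have "(\<Sum>j\<in>Basis. \<Sum>k\<in>Basis. cdot (?K *v (?Gj j *v u j)) (?Gj k *v u k)) = cdot y (G x *v y)"
    proof -
      have "(\<Sum>j\<in>Basis. ?K *v (?Gj j *v u j)) = y"
        unfolding yK by (rule linear_sum[OF matrix_vector_mul_linear, symmetric, unfolded o_def]) 
      then show ?thesis unfolding y by (simp add: cdot_sum[symmetric])
    qed
    finally have S: "?S = cdot y (G x *v y) - (\<Sum>j\<in>Basis. \<Sum>k\<in>Basis. cdot (?Gkj k j *v u j) (u k))" .
    have real1: "cnj (cdot y (G x *v y)) = cdot y (G x *v y)"
      by (simp add: cnj_cdot hermitian_cdot[OF herm[OF U(2)]])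
    have real2: "cnj (\<Sum>j\<in>Basis. \<Sum>k\<in>Basis. cdot (?Gkj k j *v u j) (u k))
        = (\<Sum>j\<in>Basis. \<Sum>k\<in>Basis. cdot (?Gkj k j *v u j) (u k))"
    proof -
      have "cnj (\<Sum>j\<in>Basis. \<Sum>k\<in>Basis. cdot (?Gkj k j *v u j) (u k))
          = (\<Sum>j\<in>Basis. \<Sum>k\<in>Basis. cdot (?Gkj j k *v u k) (u j))"
        by (simp add: cnj_cdot hermitian_cdot[OF hj(2)] sym)
      also have "\<dots> = (\<Sum>j\<in>Basis. \<Sum>k\<in>Basis. cdot (?Gkj k j *v u j) (u k))" by (rule sum.swap)
      finally show ?thesis .
    qed
    have "cnj ?S = ?S" unfolding S complex_cnj_diff real1 real2 ..
    moreover have "z = complex_of_real (Re z)" if "cnj z = z" for z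
      using that by (simp add: complex_eq_iff)
    ultimately have "?S = complex_of_real (Re ?S)" by blast
    also have "Re ?S = (G x *v y) \<bullet> y - (\<Sum>j\<in>Basis. \<Sum>k\<in>Basis. (?Gkj j k *v u j) \<bullet> u k)"
      unfolding S by (simp add: Re_cdot inner_commute sym)
    finally show ?thesis .
  qed
  show ?thesis
  proof
    assume L: "\<forall>u. (\<Sum>j\<in>Basis. \<Sum>k\<in>Basis. inner_of (G x) (curvature G j k x *v u j) (u k)) \<in> \<real>\<^sub>\<ge>\<^sub>0"
    show "nakano (matrix_op (G x)) (\<lambda>h. matrix_op (grad G x h)) (\<lambda>h k. matrix_op (hess G x h k))"
      unfolding nakano_def
    proof (intro allI impI)
      fix u y assume "matrix_op (G x) y = (\<Sum>j\<in>Basis. matrix_op (grad G x j) (u j))"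
      then have y: "G x *v y = (\<Sum>j\<in>Basis. ?Gj j *v u j)" by (simp add: matrix_op_apply grad_Basis)
      have "(\<Sum>j\<in>Basis. \<Sum>k\<in>Basis. inner_of (G x) (curvature G j k x *v u j) (u k)) \<in> \<real>\<^sub>\<ge>\<^sub>0" using L by blast
      then show "(\<Sum>j\<in>Basis. \<Sum>k\<in>Basis. matrix_op (hess G x j k) (u j) \<bullet> u k) \<le> matrix_op (G x) y \<bullet> y"
        unfolding main[OF y] by (simp add: complex_nonneg_Reals_iff matrix_op_apply hess_Basis)
    qed
  next
    assume N: "nakano (matrix_op (G x)) (\<lambda>h. matrix_op (grad G x h)) (\<lambda>h k. matrix_op (hess G x h k))"
    show "\<forall>u. (\<Sum>j\<in>Basis. \<Sum>k\<in>Basis. inner_of (G x) (curvature G j k x *v u j) (u k)) \<in> \<real>\<^sub>\<ge>\<^sub>0"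
    proof
      fix u :: "'a \<Rightarrow> complex ^ 'r"
      define y where "y = ?K *v (\<Sum>j\<in>Basis. ?Gj j *v u j)"
      have y: "G x *v y = (\<Sum>j\<in>Basis. ?Gj j *v u j)"
        by (simp add: y_def matrix_vector_mul_assoc matrix_inv_mult(2)[OF inv[OF U(2)]])
      have "matrix_op (G x) y = (\<Sum>j\<in>Basis. matrix_op (grad G x j) (u j))"
        using y by (simp add: matrix_op_apply grad_Basis)
      from nakanoD[OF N this]
      show "(\<Sum>j\<in>Basis. \<Sum>k\<in>Basis. inner_of (G x) (curvature G j k x *v u j) (u k)) \<in> \<real>\<^sub>\<ge>\<^sub>0"
        unfolding main[OF y] by (simp add: complex_nonneg_Reals_iff matrix_op_apply hess_Basis)
    qed
  qed
qed

section \<open>Truncated densities\<close>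

lemma C1_restrict_fst:
  fixes f :: "'a::euclidean_space \<times> 'b::euclidean_space \<Rightarrow> 'c::real_normed_vector"
  assumes "C1 UNIV f f'"
  shows "C1 UNIV (\<lambda>t. f (t, 0)) (\<lambda>t h. f' (t, 0) (h, 0))"
  unfolding C1_def
proof (intro conjI ballI allI)
  fix t
  have "((\<lambda>t :: 'a. (t, 0 :: 'b)) has_derivative (\<lambda>h. (h, 0))) (at t)"
    by (intro has_derivative_Pair has_derivative_ident has_derivative_const)
  moreover have "(f has_derivative f' (t, 0)) (at (t, 0))" using assms by (auto simp: C1_def)
  ultimately show "((\<lambda>t. f (t, 0)) has_derivative (\<lambda>h. f' (t, 0) (h, 0))) (at t)"
    using diff_chain_at[of "\<lambda>t. (t, 0)" "\<lambda>h. (h, 0)" t f "f' (t, 0)"] by (simp add: o_def)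
next
  fix h
  have "continuous_on UNIV (\<lambda>z. f' z (h, 0))" using assms by (auto simp: C1_def)
  moreover have "continuous_on UNIV (\<lambda>t :: 'a. (t, 0 :: 'b))" by (intro continuous_intros)
  ultimately show "continuous_on UNIV (\<lambda>t. f' (t, 0) (h, 0))" by (rule continuous_on_compose2) simp
qed

lemma uniformly_coercive:
  fixes G :: "'a::euclidean_space \<Rightarrow> 'v::euclidean_space \<Rightarrow>\<^sub>L 'v"
  assumes "compact P" "continuous_on P G" "\<And>z v. z \<in> P \<Longrightarrow> v \<noteq> 0 \<Longrightarrow> 0 < G z v \<bullet> v"
  obtains l where "0 < l" "\<And>z v. z \<in> P \<Longrightarrow> l * (v \<bullet> v) \<le> G z v \<bullet> v"
proof (cases "P = {}")
  case True
  then show ?thesis using that[of 1] by simp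
next
  case False
  let ?Q = "P \<times> sphere (0 :: 'v) 1"
  have "compact ?Q" using assms(1) by (intro compact_Times) auto
  moreover have "?Q \<noteq> {}" using False by simp
  moreover have "continuous_on ?Q (\<lambda>q. G (fst q) (snd q) \<bullet> snd q)"
    by (intro continuous_intros continuous_on_compose2[OF assms(2)]) auto
  ultimately obtain q where q: "q \<in> ?Q" "\<And>q'. q' \<in> ?Q \<Longrightarrow> G (fst q) (snd q) \<bullet> snd q \<le> G (fst q') (snd q') \<bullet> snd q'"
    using continuous_attains_inf[of ?Q "\<lambda>q. G (fst q) (snd q) \<bullet> snd q"] by blast
  define l where "l = G (fst q) (snd q) \<bullet> snd q"
  show ?thesis
  proof (rule that)
    have "snd q \<noteq> 0" using q(1) by (auto simp: mem_Times_iff)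
    then show "0 < l" unfolding l_def using q(1) by (intro assms(3)) (auto simp: mem_Times_iff)
    fix z v assume z: "z \<in> P"
    show "l * (v \<bullet> v) \<le> G z v \<bullet> v"
    proof (cases "v = 0")
      case False
      have "l \<le> G (fst (z, v /\<^sub>R norm v)) (snd (z, v /\<^sub>R norm v)) \<bullet> snd (z, v /\<^sub>R norm v)"
        unfolding l_def using z False by (intro q(2)) simp
      also have "\<dots> = (G z v \<bullet> v) / (norm v)\<^sup>2"
        by (simp add: blinfun.scaleR_right power2_eq_square field_simps)
      finally show ?thesis using False by (simp add: field_simps power2_norm_eq_inner)
    qed (simp add: blinfun.zero_right)
  qed
qed

text \<open>
  The cutoff makes the metric compactly supported. On the compact support the metric is uniformly
  positive and bounded, which yields the pinching.
\<close>

lemma truncated_density: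
  fixes G :: "'a::euclidean_space \<Rightarrow> 'v::euclidean_space \<Rightarrow>\<^sub>L 'v"
  assumes C2: "C2 \<Omega> G D DD" and \<Omega>: "open \<Omega>"
    and sa: "\<And>z. z \<in> \<Omega> \<Longrightarrow> self_adjoint (G z)"
    and pos: "\<And>z v. z \<in> \<Omega> \<Longrightarrow> v \<noteq> 0 \<Longrightarrow> 0 < G z v \<bullet> v"
    and nak: "\<And>z. z \<in> \<Omega> \<Longrightarrow> nakano (G z) (D z) (DD z)"
    and L: "finite L" and P: "compact P" "P \<subseteq> \<Omega>" "\<And>z. z \<notin> P \<Longrightarrow> cutoff_prod L z = 0"
    and S: "S \<subseteq> Basis"
  shows "\<exists>D2 DD2. nakano_density S (\<lambda>z. cutoff_prod L z *\<^sub>R G z) D2 DD2"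
proof -
  let ?c = "cutoff_prod L"
  define H where "H z = ?c z *\<^sub>R G z" for z
  have psd: "0 \<le> G z v \<bullet> v" if "z \<in> \<Omega>" for z v
    using pos[OF that, of v] by (cases "v = 0") (auto simp: less_imp_le)
  obtain D1 DD1 where H: "C2 \<Omega> H D1 DD1"
    "\<And>z. z \<in> \<Omega> \<Longrightarrow> ?c z \<noteq> 0 \<Longrightarrow> nakano (H z) (D1 z) (DD1 z)"
    "\<And>z h k. z \<in> \<Omega> \<Longrightarrow> ?c z = 0 \<Longrightarrow> D1 z h = 0 \<and> DD1 z h k = 0"
    using nakano_cutoff_prod[OF C2 \<Omega> sa psd nak L] unfolding H_def by blast
  have H0: "H z = 0" if "z \<notin> P" for z using P(3)[OF that] by (simp add: H_def)
  have C1H: "C1 \<Omega> H D1" "\<And>h. C1 \<Omega> (\<lambda>z. D1 z h) (\<lambda>z k. DD1 z k h)" using H(1) by (auto simp: C2_def)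
  note clP = compact_imp_closed[OF P(1)]
  define D2 where "D2 z h = (if z \<in> \<Omega> then D1 z h else 0)" for z h
  define DD2 where "DD2 z k h = (if z \<in> \<Omega> then DD1 z k h else 0)" for z k h
  have D2_0: "D2 z h = 0" if "z \<notin> P" for z h
    using C1_extend_zero(2)[OF C1H(1) \<Omega> clP P(2) H0, of z h] that by (auto simp: D2_def)
  have C1D2: "C1 \<Omega> (\<lambda>z. D2 z h) (\<lambda>z k. DD1 z k h)" for h
    unfolding C1_def
  proof (intro conjI ballI allI)
    fix z assume z: "z \<in> \<Omega>"
    have "((\<lambda>z. D1 z h) has_derivative (\<lambda>k. DD1 z k h)) (at z)" using C1H(2) z by (auto simp: C1_def)
    then show "((\<lambda>z. D2 z h) has_derivative (\<lambda>k. DD1 z k h)) (at z)"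
      by (rule has_derivative_transform_within_open[OF _ \<Omega> z]) (simp add: D2_def)
  qed (use C1H(2) in \<open>auto simp: C1_def\<close>)
  have DD2_0: "DD2 z k h = 0" if "z \<notin> P" for z h k
    using C1_extend_zero(2)[OF C1D2[of h] \<Omega> clP P(2) D2_0, of z k] that by (auto simp: DD2_def)
  have C2': "C2 UNIV H D2 DD2"
    unfolding C2_def
  proof (intro conjI allI)
    show "C1 UNIV H D2"
      using C1_extend_zero(1)[OF C1H(1) \<Omega> clP P(2) H0] by (simp add: D2_def[abs_def])
    show "C1 UNIV (\<lambda>z. D2 z h) (\<lambda>z k. DD2 z k h)" for h
      using C1_extend_zero(1)[OF C1D2 \<Omega> clP P(2) D2_0, of h] by (simp add: DD2_def[abs_def])
  qed
  have contG: "continuous_on P G" using C2 P(2) by (auto simp: C2_def intro: continuous_on_subset C1_cont)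
  obtain l where l: "0 < l" "\<And>z v. z \<in> P \<Longrightarrow> l * (v \<bullet> v) \<le> G z v \<bullet> v"
    using uniformly_coercive[OF P(1) contG] pos P(2) by blast
  have "bounded (G ` P)" by (intro compact_imp_bounded compact_continuous_image contG P)
  then obtain B where B: "\<And>z. z \<in> P \<Longrightarrow> norm (G z) \<le> B" by (auto simp: bounded_iff)
  define C where "C = max B 0 / l"
  have C0: "0 \<le> C" using l(1) by (simp add: C_def)
  have pinch: "norm (H z) * (v \<bullet> v) \<le> C * (H z v \<bullet> v)" for z v
  proof (cases "z \<in> P")
    case True
    have "norm (G z) * (v \<bullet> v) \<le> max B 0 * (v \<bullet> v)"
      using B[OF True] by (intro mult_right_mono) auto
    also have "\<dots> = C * (l * (v \<bullet> v))" using l(1) by (simp add: C_def)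
    also have "\<dots> \<le> C * (G z v \<bullet> v)" by (intro mult_left_mono l(2) True C0)
    finally have "?c z * (norm (G z) * (v \<bullet> v)) \<le> ?c z * (C * (G z v \<bullet> v))"
      by (intro mult_left_mono cutoff_prod_range)
    then show ?thesis using cutoff_prod_range(1)[of L z] by (simp add: H_def blinfun.scaleR_left mult_ac)
  qed (simp add: H0)
  obtain e :: 'v where e: "norm e = 1" using vector_choose_size[of 1] by auto
  have H_ne: "H z \<noteq> 0 \<longleftrightarrow> ?c z \<noteq> 0" for z
  proof
    assume c: "?c z \<noteq> 0"
    then have z: "z \<in> \<Omega>" using P by blast
    have "e \<noteq> 0" using e by auto
    then have "G z \<noteq> 0" using pos[OF z, of e] by auto
    then show "H z \<noteq> 0" using c by (simp add: H_def)
  qed (auto simp: H_def)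
  have conv: "convex {z. H z \<noteq> 0}"
  proof -
    have "{z. H z \<noteq> 0} = (\<Inter>p\<in>L. {z. fst p \<bullet> z > - snd p})"
      unfolding H_ne cutoff_prod_nonzero_iff[OF L] by force
    also have "convex \<dots>" by (intro convex_INT convex_halfspace_gt)
    finally show ?thesis .
  qed
  have bdd: "\<exists>B. \<forall>z. norm (DD2 z h k) \<le> B" for h k
  proof -
    have "continuous_on UNIV (\<lambda>z. DD2 z h k)" using C2' by (auto simp: C2_def C1_def)
    then have "continuous_on P (\<lambda>z. DD2 z h k)" by (rule continuous_on_subset) simp
    then have "bounded ((\<lambda>z. DD2 z h k) ` P)" by (intro compact_imp_bounded compact_continuous_image P)
    then obtain B where "\<forall>z\<in>P. norm (DD2 z h k) \<le> B" by (auto simp: bounded_iff)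
    then have "norm (DD2 z h k) \<le> max B 0" for z
      using DD2_0[of z h k] by (cases "z \<in> P") (auto intro: max.coboundedI1)
    then show ?thesis by blast
  qed
  have supp: "\<exists>R. \<forall>z. H z \<noteq> 0 \<longrightarrow> (\<forall>b\<in>S. \<bar>z \<bullet> b\<bar> < R)"
  proof -
    obtain R where R: "\<forall>z\<in>P. norm z \<le> R" using compact_imp_bounded[OF P(1)] by (auto simp: bounded_iff)
    have "\<bar>z \<bullet> b\<bar> < R + 1" if "H z \<noteq> 0" "b \<in> S" for z b
    proof -
      have "z \<in> P" using that(1) H0 by blast
      then have "norm z \<le> R" using R by blast
      moreover have "\<bar>z \<bullet> b\<bar> \<le> norm z" using that(2) S by (intro Basis_le_norm) auto
      ultimately show ?thesis by linarith
    qed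
    then show ?thesis by blast
  qed
  have sa': "self_adjoint (H z)" for z
  proof (cases "z \<in> \<Omega>")
    case True then show ?thesis using sa[OF True] by (simp add: H_def self_adjoint_def blinfun.scaleR_left)
  next
    case False
    then have "H z = 0" using P(2) H0 by blast
    then show ?thesis by (simp add: self_adjoint_def)
  qed
  have nak': "nakano (H z) (D2 z) (DD2 z)" if "H z \<noteq> 0" for z
  proof -
    have z: "z \<in> \<Omega>" using that H0 P(2) by blast
    have "D2 z = D1 z" "DD2 z = DD1 z" using z by (auto simp: D2_def DD2_def fun_eq_iff)
    then show ?thesis using H(2)[OF z] that H_ne by simp
  qed
  have zero: "D2 z h = 0 \<and> DD2 z h k = 0" if "H z = 0" for z h k
    using H(3)[of z h k] that H_ne[of z] by (auto simp: D2_def DD2_def)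
  have "nakano_density S H D2 DD2"
    unfolding nakano_density_def
    using C2' sa' C0 pinch bdd conv nak' zero supp by (intro conjI allI impI) blast+
  then show ?thesis unfolding H_def[abs_def] by blast
qed

text \<open>
  Tuples that vanish in the fibre directions restrict the curvature inequality to the base.
\<close>

lemma truncated_marginal:
  fixes G :: "'a::euclidean_space \<times> 'b::euclidean_space \<Rightarrow> 'v::euclidean_space \<Rightarrow>\<^sub>L 'v"
  assumes "nakano_density ({0} \<times> Basis) G D DD"
  obtains g D1 DD1 where "C2 UNIV g D1 DD1" "\<And>t. self_adjoint (g t)"
    "\<And>t. g t \<noteq> 0 \<Longrightarrow> nakano (g t) (D1 t) (DD1 t)"
    "\<And>t u. g t u \<bullet> u = (\<integral>x. G (t, x) u \<bullet> u \<partial>lborel)"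
proof -
  obtain G1 :: "'a \<times> 'b \<Rightarrow> 'v \<Rightarrow>\<^sub>L 'v" and D1 DD1 where G1: "nakano_density {} G1 D1 DD1"
    "\<And>t u. (\<integral>\<^sup>+x. ennreal (G (t, x) u \<bullet> u) \<partial>lborel) = ennreal (G1 (t, 0) u \<bullet> u)"
    using full_marginal[OF assms] by metis
  have C2: "C2 UNIV G1 D1 DD1" and sa: "\<And>z. self_adjoint (G1 z)" using G1(1) by (auto simp: nakano_density_def)
  show thesis
  proof (rule that[of "\<lambda>t. G1 (t, 0)" "\<lambda>t h. D1 (t, 0) (h, 0)" "\<lambda>t h k. DD1 (t, 0) (h, 0) (k, 0)"])
    show "C2 UNIV (\<lambda>t. G1 (t, 0)) (\<lambda>t h. D1 (t, 0) (h, 0)) (\<lambda>t h k. DD1 (t, 0) (h, 0) (k, 0))"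
      unfolding C2_def
    proof (intro conjI allI)
      show "C1 UNIV (\<lambda>t. G1 (t, 0)) (\<lambda>t h. D1 (t, 0) (h, 0))"
        using C2 by (intro C1_restrict_fst) (simp add: C2_def)
      show "C1 UNIV (\<lambda>t. D1 (t, 0) (h, 0)) (\<lambda>t k. DD1 (t, 0) (k, 0) (h, 0))" for h
        by (rule C1_restrict_fst[of "\<lambda>z. D1 z (h, 0)" "\<lambda>z k. DD1 z k (h, 0)"]) (use C2 in \<open>simp add: C2_def\<close>)
    qed
    show "self_adjoint (G1 (t, 0))" for t by (rule sa)
    show "nakano (G1 (t, 0)) (\<lambda>h. D1 (t, 0) (h, 0)) (\<lambda>h k. DD1 (t, 0) (h, 0) (k, 0))" if "G1 (t, 0) \<noteq> 0" for t
      unfolding nakano_def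
    proof (intro allI impI)
      fix u :: "'a \<Rightarrow> 'v" and y
      assume y: "G1 (t, 0) y = (\<Sum>j\<in>Basis. D1 (t, 0) (j, 0) (u j))"
      have N: "nakano (G1 (t, 0)) (D1 (t, 0)) (DD1 (t, 0))" using G1(1) that by (simp add: nakano_density_def)
      define u' where "u' p = (if snd p = 0 then u (fst p) else 0)" for p :: "'a \<times> 'b"
      have u': "u' (j, 0) = u j" "b \<in> Basis \<Longrightarrow> u' (0, b) = 0" for j b by (auto simp: u'_def)
      have sumB: "(\<Sum>p\<in>Basis. F p) = (\<Sum>j\<in>Basis. F (j, 0))"
        if "\<And>b. b \<in> Basis \<Longrightarrow> F (0, b) = 0" for F :: "'a \<times> 'b \<Rightarrow> 'z::comm_monoid_add"
      proof -
        have "(\<Sum>p\<in>(Basis :: ('a \<times> 'b) set). F p) = (\<Sum>p\<in>(\<lambda>j. (j, 0)) ` Basis. F p)"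
          by (rule sum.mono_neutral_right) (auto simp: Basis_prod_def that)
        also have "\<dots> = (\<Sum>j\<in>Basis. F (j, 0))" by (subst sum.reindex) (auto simp: inj_on_def)
        finally show ?thesis .
      qed
      have "G1 (t, 0) y = (\<Sum>p\<in>Basis. D1 (t, 0) p (u' p))"
        unfolding y by (subst sumB) (simp_all add: u' blinfun.zero_right)
      from nakanoD[OF N this]
      have "(\<Sum>p\<in>Basis. \<Sum>q\<in>Basis. DD1 (t, 0) p q (u' p) \<bullet> u' q) \<le> G1 (t, 0) y \<bullet> y" .
      also have "(\<Sum>p\<in>Basis. \<Sum>q\<in>Basis. DD1 (t, 0) p q (u' p) \<bullet> u' q)
          = (\<Sum>j\<in>Basis. \<Sum>k\<in>Basis. DD1 (t, 0) (j, 0) (k, 0) (u j) \<bullet> u k)"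
        by (simp add: sumB u' blinfun.zero_right)
      finally show "(\<Sum>j\<in>Basis. \<Sum>k\<in>Basis. DD1 (t, 0) (j, 0) (k, 0) (u j) \<bullet> u k) \<le> G1 (t, 0) y \<bullet> y" .
    qed
    fix t :: 'a and u :: 'v
    have "C1 UNIV G D" using assms by (auto simp: nakano_density_def C2_def)
    moreover have "continuous_on UNIV (\<lambda>x :: 'b. (t, x))" by (intro continuous_intros)
    ultimately have "continuous_on UNIV (\<lambda>x. G (t, x))" by (rule continuous_on_compose2[OF C1_cont]) simp
    then have "continuous_on UNIV (\<lambda>x. G (t, x) u \<bullet> u)" by (intro continuous_intros)
    then have "(\<integral>x. G (t, x) u \<bullet> u \<partial>lborel) = enn2real (\<integral>\<^sup>+x. ennreal (G (t, x) u \<bullet> u) \<partial>lborel)"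
      using nakano_density_psd[OF assms]
      by (intro integral_eq_nn_integral AE_I2) (simp_all add: borel_measurable_continuous_onI)
    also have "\<dots> = G1 (t, 0) u \<bullet> u" unfolding G1(2) using nakano_density_psd[OF G1(1)] by simp
    finally show "G1 (t, 0) u \<bullet> u = (\<integral>x. G (t, x) u \<bullet> u \<partial>lborel)" by simp
  qed
qed

section \<open>The fibre integral of a Nakano semi-positive metric\<close>

lemma fiber_integral_form:
  assumes "fiber_integrable \<Omega> G t"
  shows "integrable lborel (\<lambda>x. indicator (slice \<Omega> t) x * (matrix_op (G (t, x)) u \<bullet> u))"
    and "(\<integral>x. indicator (slice \<Omega> t) x * (matrix_op (G (t, x)) u \<bullet> u) \<partial>lborel)
      = matrix_op (fiber_integral \<Omega> G t) u \<bullet> u"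
proof -
  define e where "e i j x = indicator (slice \<Omega> t) x *\<^sub>R (G (t, x) $ i $ j)" for i j x
  have e: "integrable lborel (e i j)" for i j
    using assms unfolding fiber_integrable_def set_integrable_def e_def by blast
  have eq: "indicator (slice \<Omega> t) x * (matrix_op (G (t, x)) u \<bullet> u)
      = Re (\<Sum>i\<in>UNIV. \<Sum>j\<in>UNIV. (cnj (u $ i) * u $ j) * e i j x)" for x
  proof -
    have "indicator (slice \<Omega> t) x * (matrix_op (G (t, x)) u \<bullet> u)
        = Re (indicator (slice \<Omega> t) x *\<^sub>R cdot (G (t, x) *v u) u)"
      by (simp add: matrix_op_apply Re_cdot[symmetric])
    also have "indicator (slice \<Omega> t) x *\<^sub>R cdot (G (t, x) *v u) u
        = (\<Sum>i\<in>UNIV. \<Sum>j\<in>UNIV. (cnj (u $ i) * u $ j) * e i j x)"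
      by (simp add: cdot_def matrix_vector_mult_def e_def sum_distrib_left scaleR_sum_right mult_ac)
    finally show ?thesis .
  qed
  have int: "integrable lborel (\<lambda>x. \<Sum>i\<in>UNIV. \<Sum>j\<in>UNIV. (cnj (u $ i) * u $ j) * e i j x)"
    by (intro Bochner_Integration.integrable_sum integrable_mult_right e)
  then show "integrable lborel (\<lambda>x. indicator (slice \<Omega> t) x * (matrix_op (G (t, x)) u \<bullet> u))"
    unfolding eq by (rule integrable_Re)
  have "(\<integral>x. indicator (slice \<Omega> t) x * (matrix_op (G (t, x)) u \<bullet> u) \<partial>lborel)
      = Re (\<integral>x. (\<Sum>i\<in>UNIV. \<Sum>j\<in>UNIV. (cnj (u $ i) * u $ j) * e i j x) \<partial>lborel)"
    unfolding eq using int by (rule integral_Re)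
  also have "(\<integral>x. (\<Sum>i\<in>UNIV. \<Sum>j\<in>UNIV. (cnj (u $ i) * u $ j) * e i j x) \<partial>lborel)
      = (\<Sum>i\<in>UNIV. \<Sum>j\<in>UNIV. (cnj (u $ i) * u $ j) * (\<integral>x. e i j x \<partial>lborel))"
    by (simp add: Bochner_Integration.integral_sum Bochner_Integration.integrable_sum e)
  also have "\<dots> = cdot (fiber_integral \<Omega> G t *v u) u"
    by (simp add: cdot_def matrix_vector_mult_def e_def[abs_def] fiber_integral_def set_lebesgue_integral_def
        sum_distrib_left mult_ac)
  finally show "(\<integral>x. indicator (slice \<Omega> t) x * (matrix_op (G (t, x)) u \<bullet> u) \<partial>lborel)
      = matrix_op (fiber_integral \<Omega> G t) u \<bullet> u"
    by (simp add: Re_cdot matrix_op_apply)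
qed

lemma hermitian_fiber_integral:
  assumes "\<And>z. z \<in> \<Omega> \<Longrightarrow> hermitian_matrix (G z)"
  shows "hermitian_matrix (fiber_integral \<Omega> G t)"
proof -
  have "cnj (LINT x:slice \<Omega> t|lborel. G (t, x) $ j $ i) = (LINT x:slice \<Omega> t|lborel. G (t, x) $ i $ j)" for i j
  proof -
    have c: "cnj (indicator (slice \<Omega> t) x *\<^sub>R G (t, x) $ j $ i) = indicator (slice \<Omega> t) x *\<^sub>R G (t, x) $ i $ j" for x
    proof (cases "x \<in> slice \<Omega> t")
      case True
      then have "map_matrix cnj (transpose (G (t, x))) $ i $ j = G (t, x) $ i $ j"
        using assms[of "(t, x)"] by (simp add: slice_def hermitian_matrix_def)
      then show ?thesis by (simp add: map_matrix_def transpose_def)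
    qed simp
    have "cnj (\<integral>x. indicator (slice \<Omega> t) x *\<^sub>R G (t, x) $ j $ i \<partial>lborel)
        = (\<integral>x. cnj (indicator (slice \<Omega> t) x *\<^sub>R G (t, x) $ j $ i) \<partial>lborel)"
      by (rule integral_bounded_linear'[OF bounded_linear_cnj bounded_linear_cnj, symmetric]) simp
    then show ?thesis unfolding set_lebesgue_integral_def by (simp only: c)
  qed
  then show ?thesis
    by (simp add: hermitian_matrix_def vec_eq_iff map_matrix_def transpose_def fiber_integral_def)
qed

text \<open>
  The metric is truncated by cutoffs which are \<open>1\<close> on an exhausting sequence of compact sets. The
  marginals of the truncated metrics converge to \<open>g\<close> by dominated convergence. On a small ball about
  \<open>t0\<close> they are bounded above by \<open>g\<close>, and they are bounded below because all cutoffs are \<open>1\<close> on a fixed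
  compact neighbourhood of a point over \<open>t0\<close>.
\<close>

lemma fiber_integral_nakano:
  fixes \<Omega> :: "('a::euclidean_space \<times> 'b::euclidean_space) set"
    and G :: "'a \<times> 'b \<Rightarrow> complex ^ 'r ^ 'r" and g :: "'a \<Rightarrow> complex ^ 'r ^ 'r"
  assumes \<Omega>: "open \<Omega>" "convex \<Omega>" and met: "hermitian_metric_on \<Omega> G" and C2G: "Ck_on 2 \<Omega> G"
    and int: "\<And>t. t \<in> fst ` \<Omega> \<Longrightarrow> fiber_integrable \<Omega> G t"
    and g: "\<And>t. t \<in> fst ` \<Omega> \<Longrightarrow> g t = fiber_integral \<Omega> G t"
    and nak: "\<And>z. z \<in> \<Omega> \<Longrightarrow> nakano (matrix_op (G z)) (\<lambda>h. matrix_op (grad G z h)) (\<lambda>h k. matrix_op (hess G z h k))"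
    and C2g: "Ck_on 2 (fst ` \<Omega>) g" and t0: "t0 \<in> fst ` \<Omega>"
  shows "\<exists>l>0. \<forall>u. l * (u \<bullet> u) \<le> matrix_op (g t0) u \<bullet> u"
    and "nakano (matrix_op (g t0)) (\<lambda>h. matrix_op (grad g t0 h)) (\<lambda>h k. matrix_op (hess g t0 h k))"
proof -
  define A where "A z = matrix_op (G z)" for z
  have herm: "\<And>z. z \<in> \<Omega> \<Longrightarrow> hermitian_matrix (G z)"
    using met by (auto simp: hermitian_metric_on_def pos_def_matrix_def)
  have sa: "\<And>z. z \<in> \<Omega> \<Longrightarrow> self_adjoint (A z)" unfolding A_def by (intro hermitian_self_adjoint herm)
  have pos: "0 < A z v \<bullet> v" if "z \<in> \<Omega>" "v \<noteq> 0" for z v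
    using met that unfolding A_def hermitian_metric_on_def pos_def_matrix_def
    by (simp add: matrix_op_apply inner_of_cdot Re_cdot)
  have psd: "0 \<le> A z v \<bullet> v" if "z \<in> \<Omega>" for z v
    using pos[OF that, of v] by (cases "v = 0") (auto simp: less_imp_le)
  have C2A: "C2 \<Omega> A (\<lambda>z h. matrix_op (grad G z h)) (\<lambda>z h k. matrix_op (hess G z h k))"
    unfolding A_def by (rule C2_bounded_linear[OF bounded_linear_matrix_op Ck_on_2_C2[OF C2G]])
  have C2g': "C2 (fst ` \<Omega>) (\<lambda>t. matrix_op (g t)) (\<lambda>t h. matrix_op (grad g t h)) (\<lambda>t h k. matrix_op (hess g t h k))"
    by (rule C2_bounded_linear[OF bounded_linear_matrix_op Ck_on_2_C2[OF C2g]])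
  define \<phi> where "\<phi> t u x = indicator (slice \<Omega> t) x * (A (t, x) u \<bullet> u)" for t u x
  have \<phi>: "integrable lborel (\<phi> t u)" "(\<integral>x. \<phi> t u x \<partial>lborel) = matrix_op (g t) u \<bullet> u" if "t \<in> fst ` \<Omega>" for t u
    using fiber_integral_form[OF int[OF that], of u] unfolding \<phi>_def A_def by (simp_all add: g[OF that])

  obtain x0 where z0: "(t0, x0) \<in> \<Omega>" using t0 by force
  obtain e where e: "e > 0" "cball t0 e \<times> cball x0 e \<subseteq> \<Omega>"
  proof -
    obtain A B where AB: "open A" "open B" "(t0, x0) \<in> A \<times> B" "A \<times> B \<subseteq> \<Omega>"
      using open_prod_elim[OF \<Omega>(1) z0] by metis
    obtain e1 where e1: "e1 > 0" "cball t0 e1 \<subseteq> A" using AB open_contains_cball by blast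
    obtain e2 where e2: "e2 > 0" "cball x0 e2 \<subseteq> B" using AB open_contains_cball by blast
    have "cball t0 (min e1 e2) \<subseteq> A" "cball x0 (min e1 e2) \<subseteq> B" using e1 e2 by auto
    then have "cball t0 (min e1 e2) \<times> cball x0 (min e1 e2) \<subseteq> \<Omega>" using AB(4) by blast
    moreover have "0 < min e1 e2" using e1 e2 by simp
    ultimately show thesis by (rule that[rotated])
  qed
  define K0 where "K0 = cball t0 e \<times> cball x0 e"
  have K0: "compact K0" "K0 \<subseteq> \<Omega>" "K0 \<noteq> {}" using e by (auto simp: K0_def intro: compact_Times)
  have U: "cball t0 e \<subseteq> fst ` \<Omega>"
  proof
    fix t assume "t \<in> cball t0 e"
    then have "(t, x0) \<in> \<Omega>" using e by auto
    then show "t \<in> fst ` \<Omega>" by force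
  qed

  \<comment> \<open>The compact sets \<open>K n\<close> exhaust \<open>\<Omega>\<close>; each contains \<open>K0\<close>, where the lower bound for the truncated
    integrals comes from.\<close>
  obtain \<C> where \<C>: "\<And>X. X \<in> \<C> \<Longrightarrow> \<exists>a b. X = cbox a b" "countable \<C>" "\<Union>\<C> = \<Omega>"
    using open_countable_Union_open_cbox[OF \<Omega>(1)] by metis
  have "\<C> \<noteq> {}" using \<C>(3) z0 by auto
  define K where "K n = K0 \<union> (\<Union>i\<le>n. from_nat_into \<C> i)" for n :: nat
  have K: "compact (K n)" "K n \<subseteq> \<Omega>" "K n \<noteq> {}" for n
  proof -
    have "compact (from_nat_into \<C> i)" "from_nat_into \<C> i \<subseteq> \<Omega>" for i
      using \<C>(1)[OF from_nat_into[OF \<open>\<C> \<noteq> {}\<close>], of i] from_nat_into[OF \<open>\<C> \<noteq> {}\<close>, of i] \<C>(3) by auto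
    then show "compact (K n)" "K n \<subseteq> \<Omega>" "K n \<noteq> {}"
      using K0 by (auto simp: K_def intro!: compact_Un compact_UN)
  qed
  have exhaust: "\<forall>\<^sub>F n in sequentially. z \<in> K n" if z: "z \<in> \<Omega>" for z
  proof -
    have "\<exists>X\<in>\<C>. z \<in> X" using z \<C>(3) by blast
    then obtain X where X: "X \<in> \<C>" "z \<in> X" by blast
    obtain i where i: "from_nat_into \<C> i = X" using from_nat_into_surj[OF \<C>(2) X(1)] by blast
    have "z \<in> K n" if "i \<le> n" for n using X(2) i that by (auto simp: K_def)
    then show ?thesis by (auto simp: eventually_sequentially)
  qed
  have "\<exists>L P. finite L \<and> compact P \<and> P \<subseteq> \<Omega> \<and> (\<forall>z\<in>K n. cutoff_prod L z = 1) \<and> (\<forall>z. z \<notin> P \<longrightarrow> cutoff_prod L z = 0)" for n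
    by (rule separating_cutoffs[OF \<Omega> K(1)[of n] K(2)[of n] K(3)[of n]]) blast
  then obtain L P where LP: "\<And>n. finite (L n)" "\<And>n. compact (P n)" "\<And>n. P n \<subseteq> \<Omega>"
    "\<And>n z. z \<in> K n \<Longrightarrow> cutoff_prod (L n) z = 1" "\<And>n z. z \<notin> P n \<Longrightarrow> cutoff_prod (L n) z = 0" by metis
  define H where "H n z = cutoff_prod (L n) z *\<^sub>R A z" for n z
  have sub: "{0} \<times> (Basis :: 'b set) \<subseteq> (Basis :: ('a \<times> 'b) set)" by (auto simp: Basis_prod_def)
  have nakA: "\<And>z. z \<in> \<Omega> \<Longrightarrow> nakano (A z) (\<lambda>h. matrix_op (grad G z h)) (\<lambda>h k. matrix_op (hess G z h k))"
    unfolding A_def by (rule nak)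
  have "\<exists>gn D1 DD1. C2 UNIV gn D1 DD1 \<and> (\<forall>t. self_adjoint (gn t)) \<and>
      (\<forall>t. gn t \<noteq> 0 \<longrightarrow> nakano (gn t) (D1 t) (DD1 t)) \<and> (\<forall>t u. gn t u \<bullet> u = (\<integral>x. H n (t, x) u \<bullet> u \<partial>lborel))" for n
  proof -
    obtain D2 DD2 where "nakano_density ({0} \<times> Basis) (H n) D2 DD2"
      using truncated_density[OF C2A \<Omega>(1) sa pos nakA LP(1) LP(2) LP(3) LP(5) sub, of n n] unfolding H_def[abs_def] by blast
    then show ?thesis by (rule truncated_marginal) blast
  qed
  then obtain gn D1 DD1 where gn: "\<And>n. C2 UNIV (gn n) (D1 n) (DD1 n)" "\<And>n t. self_adjoint (gn n t)"
    "\<And>n t. gn n t \<noteq> 0 \<Longrightarrow> nakano (gn n t) (D1 n t) (DD1 n t)"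
    "\<And>n t u. gn n t u \<bullet> u = (\<integral>x. H n (t, x) u \<bullet> u \<partial>lborel)" by metis

  have H_le: "0 \<le> H n (t, x) u \<bullet> u \<and> H n (t, x) u \<bullet> u \<le> \<phi> t u x" for n t x u
  proof (cases "(t, x) \<in> \<Omega>")
    case True
    have "cutoff_prod (L n) (t, x) * (A (t, x) u \<bullet> u) \<le> 1 * (A (t, x) u \<bullet> u)"
      using psd[OF True] cutoff_prod_range(2) by (intro mult_right_mono)
    then show ?thesis using True psd[OF True, of u] cutoff_prod_range(1)[of "L n" "(t, x)"]
      by (simp add: H_def \<phi>_def slice_def blinfun.scaleR_left)
  next
    case False
    then have "(t, x) \<notin> P n" using LP(3) by blast
    then show ?thesis using False by (simp add: H_def \<phi>_def slice_def LP(5))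
  qed
  have H_meas: "(\<lambda>x. H n (t, x) u \<bullet> u) \<in> borel_measurable lborel" if "t \<in> fst ` \<Omega>" for n t u
  proof -
    obtain c Dc where c: "C2 UNIV (cutoff_prod (L n) :: 'a \<times> 'b \<Rightarrow> real) c Dc" using C2_cutoff_prod[OF LP(1)] by blast
    have "continuous_on UNIV (\<lambda>x :: 'b. (t, x))" by (intro continuous_intros)
    then have "continuous_on UNIV (\<lambda>x. cutoff_prod (L n) (t, x))"
      using c by (intro continuous_on_compose2[OF C1_cont, of UNIV "cutoff_prod (L n)" c]) (auto simp: C2_def)
    then have [measurable]: "(\<lambda>x. cutoff_prod (L n) (t, x)) \<in> borel_measurable borel" by (rule borel_measurable_continuous_onI)
    have [measurable]: "\<phi> t u \<in> borel_measurable borel"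
      using borel_measurable_integrable[OF \<phi>(1)[OF that, of u]] by simp
    have "(\<lambda>x. H n (t, x) u \<bullet> u) = (\<lambda>x. cutoff_prod (L n) (t, x) * \<phi> t u x)"
    proof
      fix x show "H n (t, x) u \<bullet> u = cutoff_prod (L n) (t, x) * \<phi> t u x"
      proof (cases "(t, x) \<in> \<Omega>")
        case False
        then have "(t, x) \<notin> P n" using LP(3) by blast
        then show ?thesis by (simp add: H_def LP(5))
      qed (simp add: H_def \<phi>_def slice_def blinfun.scaleR_left)
    qed
    then show ?thesis by simp
  qed
  have H_int: "integrable lborel (\<lambda>x. H n (t, x) u \<bullet> u)" if "t \<in> fst ` \<Omega>" for n t u
  proof (rule Bochner_Integration.integrable_bound[OF \<phi>(1)[OF that, of u] H_meas[OF that]])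
    show "AE x in lborel. norm (H n (t, x) u \<bullet> u) \<le> norm (\<phi> t u x)"
    proof (rule AE_I2)
      fix x show "norm (H n (t, x) u \<bullet> u) \<le> norm (\<phi> t u x)" using H_le[of n t x u] by simp
    qed
  qed
  have upper: "gn n t u \<bullet> u \<le> matrix_op (g t) u \<bullet> u" if "t \<in> fst ` \<Omega>" for n t u
    unfolding gn(4) \<phi>(2)[OF that, symmetric] using H_le by (intro integral_mono H_int \<phi> that) auto
  have gn_psd: "0 \<le> gn n t u \<bullet> u" for n t u unfolding gn(4) using H_le by (intro integral_nonneg_AE AE_I2) auto

  have contA: "continuous_on K0 A" using C2A K0(2) by (auto simp: C2_def intro: continuous_on_subset C1_cont)
  obtain l0 where l0: "0 < l0" "\<And>z v. z \<in> K0 \<Longrightarrow> l0 * (v \<bullet> v) \<le> A z v \<bullet> v"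
    using uniformly_coercive[OF K0(1) contA] pos K0(2) by blast
  define l where "l = l0 * measure lborel (cball x0 e)"
  have l: "0 < l" unfolding l_def using l0 e content_cball_pos by (intro mult_pos_pos) auto
  have lower: "l * (u \<bullet> u) \<le> gn n t u \<bullet> u" if t: "t \<in> cball t0 e" for n t u
  proof -
    have "l * (u \<bullet> u) = (\<integral>x. l0 * (u \<bullet> u) * indicator (cball x0 e) x \<partial>lborel)"
      by (simp add: l_def)
    also have "\<dots> \<le> (\<integral>x. H n (t, x) u \<bullet> u \<partial>lborel)"
    proof (rule integral_mono)
      show "integrable lborel (\<lambda>x. l0 * (u \<bullet> u) * indicator (cball x0 e) x)"
        by (intro integrable_mult_right) (auto intro!: emeasure_compact_finite)
      show "integrable lborel (\<lambda>x. H n (t, x) u \<bullet> u)" using t U by (intro H_int) auto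
      fix x
      show "l0 * (u \<bullet> u) * indicator (cball x0 e) x \<le> H n (t, x) u \<bullet> u"
      proof (cases "x \<in> cball x0 e")
        case True
        then have z: "(t, x) \<in> K0" using t by (simp add: K0_def)
        then have "cutoff_prod (L n) (t, x) = 1" by (intro LP(4)) (simp add: K_def)
        then show ?thesis using True l0(2)[OF z, of u] by (simp add: H_def)
      next
        case False
        have "0 \<le> H n (t, x) u \<bullet> u" using H_le by blast
        then show ?thesis using False by simp
      qed
    qed
    finally show ?thesis by (simp only: gn(4))
  qed
  have t0e: "t0 \<in> cball t0 e" using e by simp
  show "\<exists>l>0. \<forall>u. l * (u \<bullet> u) \<le> matrix_op (g t0) u \<bullet> u"
  proof (intro exI[of _ l] conjI allI)
    fix u show "l * (u \<bullet> u) \<le> matrix_op (g t0) u \<bullet> u"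
      using lower[OF t0e, of u 0] upper[OF t0, of 0 u] by linarith
  qed (rule l)

  have contg: "continuous_on (cball t0 e) (\<lambda>t. matrix_op (g t))"
    using C2g' U by (auto simp: C2_def intro: continuous_on_subset C1_cont)
  then have "bounded ((\<lambda>t. matrix_op (g t)) ` cball t0 e)"
    by (intro compact_imp_bounded compact_continuous_image compact_cball)
  then have "\<exists>B. \<forall>t\<in>cball t0 e. norm (matrix_op (g t)) \<le> B" by (simp add: bounded_iff)
  then obtain \<Lambda> where \<Lambda>: "\<And>t. t \<in> cball t0 e \<Longrightarrow> norm (matrix_op (g t)) \<le> \<Lambda>" by blast
  have \<Lambda>0: "0 \<le> \<Lambda>" using \<Lambda>[OF t0e] norm_ge_zero order_trans by blast
  have norm_gn: "norm (gn n t) \<le> \<Lambda>" if t: "t \<in> cball t0 e" for n t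
  proof (rule norm_self_adjoint_le[OF gn(2) \<Lambda>0])
    fix v
    have "gn n t v \<bullet> v \<le> matrix_op (g t) v \<bullet> v" using t U by (intro upper) auto
    also have "\<dots> \<le> norm (matrix_op (g t) v) * norm v" by (rule norm_cauchy_schwarz)
    also have "\<dots> \<le> (\<Lambda> * norm v) * norm v"
      by (intro mult_right_mono order_trans[OF norm_blinfun] \<Lambda> t) auto
    also have "\<dots> = \<Lambda> * (v \<bullet> v)" by (simp add: power2_norm_eq_inner[symmetric] power2_eq_square)
    finally show "\<bar>gn n t v \<bullet> v\<bar> \<le> \<Lambda> * (v \<bullet> v)" using gn_psd[of n t v] by simp
  qed
  have sag: "self_adjoint (matrix_op (g t))" if "t \<in> fst ` \<Omega>" for t
    unfolding g[OF that] by (intro hermitian_self_adjoint hermitian_fiber_integral herm)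
  have lim_form: "(\<lambda>n. gn n t u \<bullet> u) \<longlonglongrightarrow> matrix_op (g t) u \<bullet> u" if t: "t \<in> fst ` \<Omega>" for t u
    unfolding gn(4) \<phi>(2)[OF t, symmetric]
  proof (rule integral_dominated_convergence[where w = "\<phi> t u"])
    show "AE x in lborel. (\<lambda>n. H n (t, x) u \<bullet> u) \<longlonglongrightarrow> \<phi> t u x"
    proof (rule AE_I2)
      fix x show "(\<lambda>n. H n (t, x) u \<bullet> u) \<longlonglongrightarrow> \<phi> t u x"
      proof (cases "(t, x) \<in> \<Omega>")
        case True
        have "\<forall>\<^sub>F n in sequentially. H n (t, x) u \<bullet> u = \<phi> t u x"
          using exhaust[OF True]
        proof eventually_elim
          case (elim n)
          then show ?case using True by (simp add: H_def LP(4) \<phi>_def slice_def)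
        qed
        then show ?thesis by (rule tendsto_eventually)
      next
        case False
        have "H n (t, x) u \<bullet> u = \<phi> t u x" for n
          using H_le[of n t x u] False by (simp add: \<phi>_def slice_def)
        then show ?thesis by simp
      qed
    qed
    show "AE x in lborel. norm (H n (t, x) u \<bullet> u) \<le> \<phi> t u x" for n
      using H_le by (intro AE_I2) (simp add: abs_of_nonneg)
  qed (use \<phi>(1)[OF t, of u] H_meas[OF t] in auto)
  have bsub: "ball t0 e \<subseteq> cball t0 e" "ball t0 e \<subseteq> fst ` \<Omega>" using U by auto
  show "nakano (matrix_op (g t0)) (\<lambda>h. matrix_op (grad g t0 h)) (\<lambda>h k. matrix_op (hess g t0 h k))"
  proof (rule nakano_limit[where G = gn and D = D1 and DD = DD1 and r = e and l = l and \<Lambda> = \<Lambda>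
        and GL = "\<lambda>t. matrix_op (g t)" and DL = "\<lambda>t h. matrix_op (grad g t h)" and DDL = "\<lambda>t h k. matrix_op (hess g t h k)"])
    show "C2 (ball t0 e) (gn n) (D1 n) (DD1 n)" for n by (rule C2_subset[OF gn(1)]) simp
    show "C2 (ball t0 e) (\<lambda>t. matrix_op (g t)) (\<lambda>t h. matrix_op (grad g t h)) (\<lambda>t h k. matrix_op (hess g t h k))"
      by (rule C2_subset[OF C2g' bsub(2)])
    fix t assume t: "t \<in> ball t0 e"
    show "self_adjoint (matrix_op (g t))" using sag t bsub(2) by blast
    show "l * (v \<bullet> v) \<le> gn n t v \<bullet> v" for n v using t by (intro lower) auto
    show "norm (gn n t) \<le> \<Lambda>" for n using t by (intro norm_gn) auto
    show "nakano (gn n t) (D1 n t) (DD1 n t)" for n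
    proof (rule gn(3))
      obtain v :: "complex ^ 'r" where v: "norm v = 1" using vector_choose_size[of 1] by auto
      have "l * (v \<bullet> v) \<le> gn n t v \<bullet> v" using t by (intro lower) auto
      then show "gn n t \<noteq> 0" using l v by (auto simp: norm_eq_1)
    qed
    show "(\<lambda>n. gn n t v) \<longlonglongrightarrow> matrix_op (g t) v" for v
      using t bsub(2) by (intro tendsto_self_adjoint gn(2) sag lim_form) auto
  qed (use e l gn(2) in auto)
qed

lemma coercive_invertible:
  fixes A :: "complex ^ 'r ^ 'r"
  assumes "0 < l" "\<And>u. l * (u \<bullet> u) \<le> matrix_op A u \<bullet> u"
  shows "invertible A"
proof -
  have "inj ((*v) A)"
  proof (rule injI)
    fix x y assume "A *v x = A *v y"
    then have "matrix_op A (x - y) \<bullet> (x - y) = 0"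
      by (simp add: matrix_op_apply matrix_vector_mult_diff_distrib)
    then have "l * ((x - y) \<bullet> (x - y)) \<le> 0" using assms(2)[of "x - y"] by simp
    then have "(x - y) \<bullet> (x - y) \<le> 0" using assms(1) by (simp add: mult_le_0_iff)
    then have "(x - y) \<bullet> (x - y) = 0" using inner_ge_zero[of "x - y"] by linarith
    then show "x = y" by simp
  qed
  then show ?thesis using matrix_left_invertible_injective[of A] invertible_left_inverse[of A] by blast
qed

theorem theorem1p4:
  fixes \<Omega> :: "((real ^ 'n) \<times> (real ^ 'm)) set"
    and gt :: "(real ^ 'n) \<times> (real ^ 'm) \<Rightarrow> complex ^ 'r ^ 'r"
    and g :: "real ^ 'n \<Rightarrow> complex ^ 'r ^ 'r"
  assumes "open \<Omega>" and "convex \<Omega>" and "\<Omega> \<noteq> {}"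
    and "hermitian_metric_on \<Omega> gt" and "smooth_on \<Omega> gt"
    and "\<And>t. t \<in> fst ` \<Omega> \<Longrightarrow> fiber_integrable \<Omega> gt t"
    and "\<And>t. t \<in> fst ` \<Omega> \<Longrightarrow> g t = fiber_integral \<Omega> gt t"
    and "nakano_semipositive \<Omega> gt"
    and "Ck_on 2 (fst ` \<Omega>) g"
  shows "nakano_semipositive (fst ` \<Omega>) g"
proof -
  have C2: "Ck_on 2 \<Omega> gt" using assms(5) unfolding smooth_on_def by blast
  have nak: "nakano (matrix_op (gt z)) (\<lambda>h. matrix_op (grad gt z h)) (\<lambda>h k. matrix_op (hess gt z h k))"
    if "z \<in> \<Omega>" for z
    using curvature_sum_nonneg_iff[OF assms(1) that C2 assms(4)] assms(8) that
    unfolding nakano_semipositive_def by blast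
  have herm: "\<And>z. z \<in> \<Omega> \<Longrightarrow> hermitian_matrix (gt z)"
    using assms(4) by (auto simp: hermitian_metric_on_def pos_def_matrix_def)
  have coercive: "\<exists>l>0. \<forall>u. l * (u \<bullet> u) \<le> matrix_op (g t) u \<bullet> u" if "t \<in> fst ` \<Omega>" for t
    by (rule fiber_integral_nakano(1)[OF assms(1,2,4) C2 _ _ _ assms(9) that])
       (erule assms(6) assms(7) nak)+
  have nakano_g: "nakano (matrix_op (g t)) (\<lambda>h. matrix_op (grad g t h)) (\<lambda>h k. matrix_op (hess g t h k))"
    if "t \<in> fst ` \<Omega>" for t
    by (rule fiber_integral_nakano(2)[OF assms(1,2,4) C2 _ _ _ assms(9) that])
       (erule assms(6) assms(7) nak)+
  have op: "open (fst ` \<Omega>)" using assms(1) by (rule open_image_fst)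
  have met: "hermitian_metric_on (fst ` \<Omega>) g"
    unfolding hermitian_metric_on_def pos_def_matrix_def
  proof (intro ballI conjI allI impI)
    fix t assume t: "t \<in> fst ` \<Omega>"
    obtain l where l: "0 < l" "\<And>u. l * (u \<bullet> u) \<le> matrix_op (g t) u \<bullet> u" using coercive[OF t] by blast
    show "invertible (g t)" using l by (rule coercive_invertible)
    show "hermitian_matrix (g t)" unfolding assms(7)[OF t] by (intro hermitian_fiber_integral herm)
    fix u :: "complex ^ 'r" assume "u \<noteq> 0"
    then have "0 < l * (u \<bullet> u)" using l(1) by simp
    also have "\<dots> \<le> Re (inner_of (g t) u u)"
      using l(2)[of u] by (simp add: inner_of_cdot Re_cdot matrix_op_apply)
    finally show "0 < Re (inner_of (g t) u u)" .
  qed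
  show ?thesis
    unfolding nakano_semipositive_def
  proof (intro conjI ballI)
    fix t assume t: "t \<in> fst ` \<Omega>"
    show "\<forall>u. (\<Sum>j\<in>Basis. \<Sum>k\<in>Basis. inner_of (g t) (curvature g j k t *v u j) (u k)) \<in> \<real>\<^sub>\<ge>\<^sub>0"
      using curvature_sum_nonneg_iff[OF op t assms(9) met] nakano_g[OF t] by blast
  qed (fact op met assms(9))+
qed

end
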